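(* Let $q>1$ be a prime power, let $m \in \mathbb{N}$, and let $\mathbf{A}$ be a nilpotent algebra in a congruence modular variety with $|A| = q$ such that all fundamental operations of $\mathbf{A}$ are of arity at most $m$. Let $h$ be the height of the congruence lattice of $\mathbf{A}$, and let \[ s := \big( m (q - 1) \big)^{h-1}. \] Then $\mathbf{A}$ is $s$-supernilpotent, and there is a polynomial $p \in \mathbb{R}[x]$ of degree at most $s$ such that the free spectrum of $\mathbf{A}$ satisfies $f_{\mathbf{A}}(n) = 2^{p(n)}$ for all $n \in \mathbb{N}$.
   Context: $\mathbb{N}=\{1,2,3,\dots\}$, $\mathbb{N}_0=\mathbb{N}\cup\{0\}$. Algebras are universal algebras; $A$ denotes the universe of $\mathbf{A}$; $0_A$ and $1_A$ denote the equality relation and the total relation on $A$. Commutator: for congruences $\alpha,\beta$ of $\mathbf{A}$, $[\alpha,\beta]$ is the (term condition) commutator, i.e. the smallest congruence $\delta$ such that for every term function $t(\mathbf{x},\mathbf{y})$ of $\mathbf{A}$ and all tuples $\mathbf{a},\mathbf{b}$ that are componentwise $\alpha$-related and $\mathbf{c},\mathbf{d}$ that are componentwise $\beta$-related, $t(\mathbf{a},\mathbf{c}) \mathrel{\delta} t(\mathbf{a},\mathbf{d})$ implies $t(\mathbf{b},\mathbf{c}) \mathrel{\delta} t(\mathbf{b},\mathbf{d})$. Nilpotency: put $\lambda_1 := 1_A$ and $\lambda_{k+1} := [1_A,\lambda_k]$ for $k\in\mathbb{N}$. $\mathbf{A}$ is $k$-nilpotent if $\lambda_{k+1}=0_A$,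 and nilpotent if it is $k$-nilpotent for some $k \in \mathbb{N}$. Supernilpotency: for $k\in\mathbb{N}$, $\mathbf{A}$ is $k$-supernilpotent if for all $n_1,\dots,n_{k+1}\in\mathbb{N}_0$, all $a^{(i)}_1,a^{(i)}_2\in A^{n_i}$ ($i=1,\dots,k+1$), and all $\big(\sum_{i=1}^{k+1} n_i\big)$-ary term functions $t$ of $\mathbf{A}$: if $t(a^{(1)}_{f(1)},\dots,a^{(k)}_{f(k)},a^{(k+1)}_1)=t(a^{(1)}_{f(1)},\dots,a^{(k)}_{f(k)},a^{(k+1)}_2)$ for all $f:\{1,\dots,k\}\to\{1,2\}$ that are not constantly $2$, then $t(a^{(1)}_2,\dots,a^{(k)}_2,a^{(k+1)}_1)=t(a^{(1)}_2,\dots,a^{(k)}_2,a^{(k+1)}_2)$. Free spectrum: $f_{\mathbf{A}}(n)$ is the number of $n$-ary term functions on $\mathbf{A}$ (equivalently, the size of the free algebra on $n$ generators in the variety generated by $\mathbf{A}$). The height of a finite lattice is the maximal size of a linearly ordered subset minus one. *)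

theory Defs
  imports
    Complex_Main
    "HOL-Library.FuncSet"
    "HOL-Computational_Algebra.Polynomial"
    "HOL-Number_Theory.Prime_Powers"
begin

section \<open>Algebras, terms and term functions\<close>

text \<open>
  A signature is a partial map sending each operation symbol to its arity; the elements of
  \<open>'f\<close> outside its domain are not symbols.  The signature may be empty or infinite, and nullary
  symbols are allowed.  The value of \<open>oper A f\<close> matters only on tuples over the universe
  whose length is the arity of \<open>f\<close>.
\<close>

type_synonym 'f signature = "'f \<Rightarrow> nat option"

record ('f, 'a) algebra =
  universe :: "'a set"
  oper :: "'f \<Rightarrow> 'a list \<Rightarrow> 'a"

definition tuples :: "'a set \<Rightarrow> nat \<Rightarrow> 'a list set" where
  "tuples X n = {xs. length xs = n \<and> set xs \<subseteq> X}"

definition is_algebra :: "'f signature \<Rightarrow> ('f, 'a) algebra \<Rightarrow> bool" where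
  "is_algebra \<Sigma> A \<longleftrightarrow>
     universe A \<noteq> {} \<and>
     (\<forall>f n. \<Sigma> f = Some n \<longrightarrow> (\<forall>xs\<in>tuples (universe A) n. oper A f xs \<in> universe A))"

datatype (trm_vars: 'v, 'f) trm = Var 'v | Fun 'f "('v, 'f) trm list"

primrec wf_trm :: "'f signature \<Rightarrow> ('v, 'f) trm \<Rightarrow> bool" where
  "wf_trm \<Sigma> (Var x) \<longleftrightarrow> True"
| "wf_trm \<Sigma> (Fun f ts) \<longleftrightarrow> \<Sigma> f = Some (length ts) \<and> list_all (wf_trm \<Sigma>) ts"

primrec trm_val :: "('f, 'a) algebra \<Rightarrow> ('v \<Rightarrow> 'a) \<Rightarrow> ('v, 'f) trm \<Rightarrow> 'a" where
  "trm_val A v (Var x) = v x"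
| "trm_val A v (Fun f ts) = oper A f (map (trm_val A v) ts)"

text \<open>
  Term functions are made extensional (\<open>undefined\<close> off the \<open>n\<close>-tuples over the
  universe), so that counting them counts maps from the \<open>n\<close>-th power of the universe.
\<close>

definition term_functions :: "'f signature \<Rightarrow> ('f, 'a) algebra \<Rightarrow> nat \<Rightarrow> ('a list \<Rightarrow> 'a) set" where
  "term_functions \<Sigma> A n =
     (\<lambda>t. restrict (\<lambda>xs. trm_val A (\<lambda>i. xs ! i) t) (tuples (universe A) n)) `
       {t. wf_trm \<Sigma> t \<and> trm_vars t \<subseteq> {..<n}}"

definition free_spectrum :: "'f signature \<Rightarrow> ('f, 'a) algebra \<Rightarrow> nat \<Rightarrow> nat" where
  "free_spectrum \<Sigma> A n = card (term_functions \<Sigma> A n)"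


section \<open>The congruence lattice\<close>

definition congruences :: "'f signature \<Rightarrow> ('f, 'a) algebra \<Rightarrow> ('a \<times> 'a) set set" where
  "congruences \<Sigma> A =
     {\<theta>. equiv (universe A) \<theta> \<and>
         (\<forall>f n. \<Sigma> f = Some n \<longrightarrow>
            (\<forall>xs\<in>tuples (universe A) n. \<forall>ys\<in>tuples (universe A) n.
               list_all2 (\<lambda>x y. (x, y) \<in> \<theta>) xs ys \<longrightarrow> (oper A f xs, oper A f ys) \<in> \<theta>))}"

definition equality_rel :: "('f, 'a) algebra \<Rightarrow> ('a \<times> 'a) set" where
  "equality_rel A = Id_on (universe A)"

definition total_rel :: "('f, 'a) algebra \<Rightarrow> ('a \<times> 'a) set" where
  "total_rel A = universe A \<times> universe A"

definition con_join ::
  "'f signature \<Rightarrow> ('f, 'a) algebra \<Rightarrow> ('a \<times> 'a) set \<Rightarrow> ('a \<times> 'a) set \<Rightarrow> ('a \<times> 'a) set" where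
  "con_join \<Sigma> A \<alpha> \<beta> = \<Inter>{\<theta> \<in> congruences \<Sigma> A. \<alpha> \<union> \<beta> \<subseteq> \<theta>}"

definition congruence_modular :: "'f signature \<Rightarrow> ('f, 'a) algebra \<Rightarrow> bool" where
  "congruence_modular \<Sigma> A \<longleftrightarrow>
     (\<forall>\<alpha>\<in>congruences \<Sigma> A. \<forall>\<beta>\<in>congruences \<Sigma> A. \<forall>\<gamma>\<in>congruences \<Sigma> A.
        \<alpha> \<subseteq> \<gamma> \<longrightarrow> con_join \<Sigma> A \<alpha> (\<beta> \<inter> \<gamma>) = con_join \<Sigma> A \<alpha> \<beta> \<inter> \<gamma>)"

text \<open>Meaningful only when the congruence lattice is finite, e.g. for a finite universe.\<close>

definition con_height :: "'f signature \<Rightarrow> ('f, 'a) algebra \<Rightarrow> nat" where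
  "con_height \<Sigma> A = Max (card ` {C. C \<subseteq> congruences \<Sigma> A \<and> chain\<^sub>\<subseteq> C}) - 1"


section \<open>Varieties\<close>

text \<open>
  A variety is presented by a set of identities over countably many variables, as Birkhoff's
  theorem permits.
\<close>

definition identities :: "'f signature \<Rightarrow> ((nat, 'f) trm \<times> (nat, 'f) trm) set" where
  "identities \<Sigma> = {(s, t). wf_trm \<Sigma> s \<and> wf_trm \<Sigma> t}"

definition in_variety ::
  "'f signature \<Rightarrow> ((nat, 'f) trm \<times> (nat, 'f) trm) set \<Rightarrow> ('f, 'a) algebra \<Rightarrow> bool" where
  "in_variety \<Sigma> E A \<longleftrightarrow>
     is_algebra \<Sigma> A \<and>
     (\<forall>(s, t)\<in>E. \<forall>v\<in>UNIV \<rightarrow> universe A. trm_val A v s = trm_val A v t)"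

text \<open>
  HOL cannot quantify over types inside a formula, so the members of the variety are taken with
  their universes inside the type of terms over countably many variables.  Every countably
  generated algebra has an isomorphic copy there, and a failure of modularity is already visible in
  a finitely generated subalgebra; hence the condition implies congruence modularity for members
  of the variety over every type.  This is lemma \<open>congruence_modular_varietyD\<close> below.
\<close>

definition congruence_modular_variety ::
  "'f signature \<Rightarrow> ((nat, 'f) trm \<times> (nat, 'f) trm) set \<Rightarrow> bool" where
  "congruence_modular_variety \<Sigma> E \<longleftrightarrow>
     E \<subseteq> identities \<Sigma> \<and>
     (\<forall>B :: ('f, (nat, 'f) trm) algebra. in_variety \<Sigma> E B \<longrightarrow> congruence_modular \<Sigma> B)"


section \<open>Commutator, nilpotency, supernilpotency\<close>

definition term_condition ::
  "'f signature \<Rightarrow> ('f, 'a) algebra \<Rightarrow> ('a \<times> 'a) set \<Rightarrow> ('a \<times> 'a) set \<Rightarrow> ('a \<times> 'a) set \<Rightarrow> bool"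
where
  "term_condition \<Sigma> A \<alpha> \<beta> \<delta> \<longleftrightarrow>
     (\<forall>k l. \<forall>t\<in>term_functions \<Sigma> A (k + l).
        \<forall>a\<in>tuples (universe A) k. \<forall>b\<in>tuples (universe A) k.
        \<forall>c\<in>tuples (universe A) l. \<forall>d\<in>tuples (universe A) l.
          list_all2 (\<lambda>x y. (x, y) \<in> \<alpha>) a b \<longrightarrow> list_all2 (\<lambda>x y. (x, y) \<in> \<beta>) c d \<longrightarrow>
          (t (a @ c), t (a @ d)) \<in> \<delta> \<longrightarrow> (t (b @ c), t (b @ d)) \<in> \<delta>)"

text \<open>
  That this intersection is the smallest congruence with the property is lemma
  \<open>commutator_least\<close> below.
\<close>

definition commutator ::
  "'f signature \<Rightarrow> ('f, 'a) algebra \<Rightarrow> ('a \<times> 'a) set \<Rightarrow> ('a \<times> 'a) set \<Rightarrow> ('a \<times> 'a) set" where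
  "commutator \<Sigma> A \<alpha> \<beta> = \<Inter>{\<delta> \<in> congruences \<Sigma> A. term_condition \<Sigma> A \<alpha> \<beta> \<delta>}"

text \<open>
  The index is shifted by one: \<open>lower_central \<Sigma> A k\<close> is the congruence usually written
  \<open>\<lambda>\<^sub>k\<^sub>+\<^sub>1\<close>, with \<open>\<lambda>\<^sub>1\<close> the total relation.
\<close>

primrec lower_central :: "'f signature \<Rightarrow> ('f, 'a) algebra \<Rightarrow> nat \<Rightarrow> ('a \<times> 'a) set" where
  "lower_central \<Sigma> A 0 = total_rel A"
| "lower_central \<Sigma> A (Suc k) = commutator \<Sigma> A (total_rel A) (lower_central \<Sigma> A k)"

definition k_nilpotent :: "'f signature \<Rightarrow> ('f, 'a) algebra \<Rightarrow> nat \<Rightarrow> bool" where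
  "k_nilpotent \<Sigma> A k \<longleftrightarrow> lower_central \<Sigma> A k = equality_rel A"

definition nilpotent :: "'f signature \<Rightarrow> ('f, 'a) algebra \<Rightarrow> bool" where
  "nilpotent \<Sigma> A \<longleftrightarrow> (\<exists>k\<ge>1. k_nilpotent \<Sigma> A k)"

text \<open>
  \<open>a i 1\<close> and \<open>a i 2\<close> are the two tuples of length \<open>ns i\<close> for the
  \<open>i\<close>-th block of arguments, \<open>1 \<le> i \<le> k + 1\<close>.
\<close>

definition supernilpotent :: "'f signature \<Rightarrow> ('f, 'a) algebra \<Rightarrow> nat \<Rightarrow> bool" where
  "supernilpotent \<Sigma> A k \<longleftrightarrow>
     (\<forall>(ns :: nat \<Rightarrow> nat) (a :: nat \<Rightarrow> nat \<Rightarrow> 'a list).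
        (\<forall>i\<in>{1..k+1}. \<forall>j\<in>{1, 2}. a i j \<in> tuples (universe A) (ns i)) \<longrightarrow>
        (\<forall>t\<in>term_functions \<Sigma> A (\<Sum>i=1..k+1. ns i).
           (\<forall>f\<in>{1..k} \<rightarrow> {1, 2}.
              \<not> (\<forall>i\<in>{1..k}. f i = 2) \<longrightarrow>
              t (concat (map (\<lambda>i. a i (f i)) [1..<k+1]) @ a (k+1) 1) =
              t (concat (map (\<lambda>i. a i (f i)) [1..<k+1]) @ a (k+1) 2)) \<longrightarrow>
           t (concat (map (\<lambda>i. a i 2) [1..<k+1]) @ a (k+1) 1) =
           t (concat (map (\<lambda>i. a i 2) [1..<k+1]) @ a (k+1) 2)))"


section \<open>Adequacy of the definitions\<close>

lemma congruences_Inter: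
  assumes "S \<subseteq> congruences \<Sigma> A" "S \<noteq> {}"
  shows "\<Inter>S \<in> congruences \<Sigma> A"
proof -
  have eq: "equiv (universe A) \<theta>" if "\<theta> \<in> S" for \<theta>
    using assms(1) that by (auto simp: congruences_def)
  have "equiv (universe A) (\<Inter>S)"
  proof (rule equivI)
    show "\<Inter>S \<subseteq> universe A \<times> universe A"
      using assms(2) eq by (fastforce simp: equiv_def)
    show "refl_on (universe A) (\<Inter>S)"
      using eq by (auto simp: equiv_def refl_on_def)
    show "sym (\<Inter>S)"
      using eq by (auto simp: equiv_def sym_def)
    show "trans (\<Inter>S)"
      using eq unfolding equiv_def trans_def by blast
  qed
  moreover have "(oper A f xs, oper A f ys) \<in> \<theta>"
    if "\<Sigma> f = Some n" "xs \<in> tuples (universe A) n" "ys \<in> tuples (universe A) n"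
      "list_all2 (\<lambda>x y. (x, y) \<in> \<Inter>S) xs ys" "\<theta> \<in> S" for f n xs ys \<theta>
  proof -
    have "list_all2 (\<lambda>x y. (x, y) \<in> \<theta>) xs ys"
      using that(4) by (rule list_all2_mono) (use that(5) in auto)
    then show ?thesis
      using assms(1) that by (auto simp: congruences_def)
  qed
  ultimately show ?thesis
    by (auto simp: congruences_def)
qed

lemma total_rel_congruence:
  assumes "is_algebra \<Sigma> A"
  shows "total_rel A \<in> congruences \<Sigma> A"
  using assms
  by (auto simp: congruences_def total_rel_def is_algebra_def equiv_def refl_on_def sym_def trans_def)

lemma trm_val_closed:
  assumes "is_algebra \<Sigma> A" "v \<in> trm_vars t \<rightarrow> universe A" "wf_trm \<Sigma> t"
  shows "trm_val A v t \<in> universe A"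
  using assms(2,3)
proof (induction t)
  case (Fun f ts)
  then have "map (trm_val A v) ts \<in> tuples (universe A) (length ts)"
    by (fastforce simp: tuples_def list_all_iff)
  then show ?case
    using Fun.prems assms(1) by (auto simp: is_algebra_def)
qed auto

lemma commutator_least:
  fixes A :: "('f, 'a) algebra"
  assumes "is_algebra \<Sigma> A"
  shows "commutator \<Sigma> A \<alpha> \<beta> \<in> congruences \<Sigma> A"
    and "term_condition \<Sigma> A \<alpha> \<beta> (commutator \<Sigma> A \<alpha> \<beta>)"
    and "\<delta> \<in> congruences \<Sigma> A \<Longrightarrow> term_condition \<Sigma> A \<alpha> \<beta> \<delta> \<Longrightarrow> commutator \<Sigma> A \<alpha> \<beta> \<subseteq> \<delta>"
proof -
  have closed: "t xs \<in> universe A"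
    if t: "t \<in> term_functions \<Sigma> A n" and xs: "xs \<in> tuples (universe A) n" for t xs n
  proof -
    obtain u where u: "wf_trm \<Sigma> u" "trm_vars u \<subseteq> {..<n}"
        "t = restrict (\<lambda>xs. trm_val A (\<lambda>i. xs ! i) u) (tuples (universe A) n)"
      using t unfolding term_functions_def by blast
    have "(\<lambda>i. xs ! i) \<in> trm_vars u \<rightarrow> universe A"
      using u(2) xs by (force simp: tuples_def)
    then show ?thesis
      using trm_val_closed[OF assms _ u(1)] xs u(3) by auto
  qed
  have app: "xs @ ys \<in> tuples X (k + l)" if "xs \<in> tuples X k" "ys \<in> tuples X l"
    for xs ys k l and X :: "'a set"
    using that by (auto simp: tuples_def)
  have "term_condition \<Sigma> A \<alpha> \<beta> (total_rel A)"
    unfolding term_condition_def total_rel_def by (auto intro!: closed app)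
  then show "commutator \<Sigma> A \<alpha> \<beta> \<in> congruences \<Sigma> A"
    unfolding commutator_def using total_rel_congruence[OF assms]
    by (intro congruences_Inter) auto
  show "term_condition \<Sigma> A \<alpha> \<beta> (commutator \<Sigma> A \<alpha> \<beta>)"
    unfolding commutator_def term_condition_def by blast
  show "commutator \<Sigma> A \<alpha> \<beta> \<subseteq> \<delta>" if "\<delta> \<in> congruences \<Sigma> A" "term_condition \<Sigma> A \<alpha> \<beta> \<delta>"
    using that by (auto simp: commutator_def)
qed

lemma con_join_least:
  assumes "is_algebra \<Sigma> A" "\<alpha> \<in> congruences \<Sigma> A" "\<beta> \<in> congruences \<Sigma> A"
  shows "con_join \<Sigma> A \<alpha> \<beta> \<in> congruences \<Sigma> A"
    and "\<alpha> \<subseteq> con_join \<Sigma> A \<alpha> \<beta>" and "\<beta> \<subseteq> con_join \<Sigma> A \<alpha> \<beta>"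
    and "\<theta> \<in> congruences \<Sigma> A \<Longrightarrow> \<alpha> \<subseteq> \<theta> \<Longrightarrow> \<beta> \<subseteq> \<theta> \<Longrightarrow> con_join \<Sigma> A \<alpha> \<beta> \<subseteq> \<theta>"
proof -
  have "\<alpha> \<union> \<beta> \<subseteq> total_rel A"
    using assms(2,3) by (auto simp: congruences_def equiv_def total_rel_def)
  then show "con_join \<Sigma> A \<alpha> \<beta> \<in> congruences \<Sigma> A"
    unfolding con_join_def using total_rel_congruence[OF assms(1)]
    by (intro congruences_Inter) auto
qed (auto simp: con_join_def)

lemma con_join_subset_trancl:
  assumes alg: "is_algebra \<Sigma> A"
    and \<alpha>: "\<alpha> \<in> congruences \<Sigma> A" and \<beta>: "\<beta> \<in> congruences \<Sigma> A"
  shows "con_join \<Sigma> A \<alpha> \<beta> \<subseteq> (\<alpha> \<union> \<beta>)\<^sup>+"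
proof -
  let ?T = "(\<alpha> \<union> \<beta>)\<^sup>+" and ?U = "universe A"
  have sub: "?T \<subseteq> ?U \<times> ?U"
    using \<alpha> \<beta> by (intro trancl_subset_Sigma) (auto simp: congruences_def equiv_def)
  have eq: "equiv ?U ?T"
  proof (rule equivI[OF sub])
    show "refl_on ?U ?T"
      using \<alpha> by (auto simp: congruences_def equiv_def refl_on_def)
    show "sym ?T"
      using \<alpha> \<beta> by (intro sym_trancl sym_Un) (auto simp: congruences_def equiv_def)
  qed simp
  have one: "(oper A f (ps @ u # xs), oper A f (ps @ w # xs)) \<in> \<theta>"
    if "\<theta> \<in> congruences \<Sigma> A" "(u, w) \<in> \<theta>" "\<Sigma> f = Some (length ps + Suc (length xs))"
      "set ps \<subseteq> ?U" "set xs \<subseteq> ?U" for \<theta> f ps u w xs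
  proof -
    have e: "equiv ?U \<theta>" using that(1) by (simp add: congruences_def)
    then have "u \<in> ?U" "w \<in> ?U" using that(2) by (auto simp: equiv_def)
    moreover have r: "list_all2 (\<lambda>x y. (x, y) \<in> \<theta>) zs zs" if "set zs \<subseteq> ?U" for zs
      using that e by (auto simp: list_all2_same equiv_def refl_on_def)
    moreover have "list_all2 (\<lambda>x y. (x, y) \<in> \<theta>) (ps @ u # xs) (ps @ w # xs)"
      using r that by (intro list_all2_appendI) auto
    ultimately show ?thesis
      using that by (auto simp: congruences_def tuples_def)
  qed
  have many: "(oper A f (ps @ u # xs), oper A f (ps @ w # xs)) \<in> ?T"
    if "(u, w) \<in> ?T" "\<Sigma> f = Some (length ps + Suc (length xs))"
      "set ps \<subseteq> ?U" "set xs \<subseteq> ?U" for f ps u w xs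
    using that(1)
  proof (induction rule: trancl_induct)
    case (base y)
    then show ?case using one[OF \<alpha> _ that(2-4)] one[OF \<beta> _ that(2-4)] by blast
  next
    case (step y z)
    then have "(oper A f (ps @ y # xs), oper A f (ps @ z # xs)) \<in> \<alpha> \<union> \<beta>"
      using one[OF \<alpha> _ that(2-4)] one[OF \<beta> _ that(2-4)] by blast
    with step.IH show ?case by (rule trancl_into_trancl)
  qed
  have all: "(oper A f (ps @ xs), oper A f (ps @ ys)) \<in> ?T"
    if "list_all2 (\<lambda>x y. (x, y) \<in> ?T) xs ys" "\<Sigma> f = Some (length ps + length xs)"
      "set ps \<subseteq> ?U" "set xs \<subseteq> ?U" for f ps xs ys
    using that
  proof (induction arbitrary: ps rule: list_all2_induct)
    case Nil
    then have "oper A f ps \<in> ?U"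
      using alg by (auto simp: is_algebra_def tuples_def)
    then show ?case using eq by (auto simp: equiv_def refl_on_def)
  next
    case (Cons x xs y ys)
    have "(oper A f (ps @ x # xs), oper A f (ps @ y # xs)) \<in> ?T"
      using Cons.prems Cons.hyps by (intro many) auto
    moreover have "(oper A f ((ps @ [y]) @ xs), oper A f ((ps @ [y]) @ ys)) \<in> ?T"
      using Cons.prems Cons.hyps(1) sub by (intro Cons.IH) auto
    ultimately show ?case by (auto intro: trancl_trans)
  qed
  have "?T \<in> congruences \<Sigma> A"
    using eq all[where ps = "[]"] by (auto simp: congruences_def tuples_def)
  then show ?thesis by (auto simp: con_join_def)
qed

lemma congruence_modular_varietyD:
  fixes B :: "('f, 'b) algebra"
  assumes cm: "congruence_modular_variety \<Sigma> E" and B: "in_variety \<Sigma> E B"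
  shows "congruence_modular \<Sigma> B"
proof -
  have alg: "is_algebra \<Sigma> B" using B by (simp add: in_variety_def)
  have main: "(x, y) \<in> con_join \<Sigma> B \<alpha> (\<beta> \<inter> \<gamma>)"
    if \<alpha>: "\<alpha> \<in> congruences \<Sigma> B" and \<beta>: "\<beta> \<in> congruences \<Sigma> B" and \<gamma>: "\<gamma> \<in> congruences \<Sigma> B"
      and le: "\<alpha> \<subseteq> \<gamma>" and xy: "(x, y) \<in> con_join \<Sigma> B \<alpha> \<beta>" "(x, y) \<in> \<gamma>" for \<alpha> \<beta> \<gamma> x y
  proof -
    have sub: "\<theta> \<subseteq> universe B \<times> universe B" if "\<theta> \<in> congruences \<Sigma> B" for \<theta>
      using that by (auto simp: congruences_def equiv_def)
    have "(x, y) \<in> (\<alpha> \<union> \<beta>)\<^sup>+"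
      using con_join_subset_trancl[OF alg \<alpha> \<beta>] xy(1) by auto
    then obtain N where "(x, y) \<in> (\<alpha> \<union> \<beta>) ^^ N"
      by (auto simp: trancl_power)
    then obtain p where p: "p 0 = x" "p N = y" "\<And>i. i < N \<Longrightarrow> (p i, p (Suc i)) \<in> \<alpha> \<union> \<beta>"
      by (auto simp: relpow_fun_conv)
    have xyU: "x \<in> universe B" "y \<in> universe B" using xy(2) sub[OF \<gamma>] by auto
    have pU: "p i \<in> universe B" if "i \<le> N" for i
    proof (cases "i = N")
      case False
      then have "(p i, p (Suc i)) \<in> \<alpha> \<union> \<beta>" using that p(3) by simp
      then show ?thesis using sub[OF \<alpha>] sub[OF \<beta>] by auto
    qed (use p(2) xyU in simp)
    define v :: "nat \<Rightarrow> 'b" where "v i = p (min i N)" for i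
    have vU: "v i \<in> universe B" for i by (simp add: v_def pU)
    let ?ev = "trm_val B v"
    have evU: "?ev t \<in> universe B" if "wf_trm \<Sigma> t" for t
      using trm_val_closed[OF alg _ that] vU by auto
    define rep :: "'b \<Rightarrow> (nat, 'f) trm" where "rep b = (SOME t. wf_trm \<Sigma> t \<and> ?ev t = b)" for b
    have rep: "wf_trm \<Sigma> (rep (?ev t)) \<and> ?ev (rep (?ev t)) = ?ev t" if "wf_trm \<Sigma> t" for t
      unfolding rep_def by (rule someI_ex) (use that in auto)
    define C :: "('f, (nat, 'f) trm) algebra" where
      "C = \<lparr>universe = (\<lambda>t. rep (?ev t)) ` {t. wf_trm \<Sigma> t},
            oper = (\<lambda>f ts. rep (?ev (Fun f ts)))\<rparr>"
    have CwF: "wf_trm \<Sigma> t" and Crep: "rep (?ev t) = t" if "t \<in> universe C" for t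
      using that rep by (auto simp: C_def)
    have Cop: "?ev (oper C f ts) = oper B f (map ?ev ts)" "oper C f ts \<in> universe C"
      if "\<Sigma> f = Some n" "ts \<in> tuples (universe C) n" for f n ts
    proof -
      have "wf_trm \<Sigma> (Fun f ts)"
        using that CwF by (auto simp: tuples_def list_all_iff)
      then show "?ev (oper C f ts) = oper B f (map ?ev ts)" "oper C f ts \<in> universe C"
        using rep[of "Fun f ts"] by (auto simp: C_def simp del: trm_val.simps) simp
    qed
    have algC: "is_algebra \<Sigma> C"
    proof -
      have "wf_trm \<Sigma> (Var 0)" by simp
      then have "universe C \<noteq> {}" unfolding C_def by (auto intro: exI[of _ "Var 0"])
      then show ?thesis using Cop(2) by (auto simp: is_algebra_def)
    qed
    have evC: "?ev (trm_val C w t) = trm_val B (?ev \<circ> w) t"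
      if "w \<in> UNIV \<rightarrow> universe C" "wf_trm \<Sigma> t" for w :: "nat \<Rightarrow> (nat, 'f) trm" and t
      using that(2)
    proof (induction t)
      case (Fun f ts)
      have "map (trm_val C w) ts \<in> tuples (universe C) (length ts)"
        using Fun.prems that(1)
        by (auto simp: tuples_def list_all_iff Pi_def intro!: trm_val_closed[OF algC])
      then have "?ev (trm_val C w (Fun f ts)) = oper B f (map ?ev (map (trm_val C w) ts))"
        using Cop(1) Fun.prems by simp
      also have "map ?ev (map (trm_val C w) ts) = map (trm_val B (?ev \<circ> w)) ts"
        using Fun by (auto simp: list_all_iff comp_def)
      finally show ?case by (simp add: comp_def)
    qed simp
    have "in_variety \<Sigma> E C"
      unfolding in_variety_def
    proof (intro conjI algC ballI, clarify)
      fix s t and w :: "nat \<Rightarrow> (nat, 'f) trm"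
      assume st: "(s, t) \<in> E" and w: "w \<in> UNIV \<rightarrow> universe C"
      have wf: "wf_trm \<Sigma> s" "wf_trm \<Sigma> t"
        using cm st by (auto simp: congruence_modular_variety_def identities_def)
      have "?ev \<circ> w \<in> UNIV \<rightarrow> universe B"
        using w CwF evU by (auto simp: Pi_def)
      then have "trm_val B (?ev \<circ> w) s = trm_val B (?ev \<circ> w) t"
        using B st by (auto simp: in_variety_def)
      then have "?ev (trm_val C w s) = ?ev (trm_val C w t)"
        using evC[OF w] wf by simp
      moreover have "trm_val C w s \<in> universe C" "trm_val C w t \<in> universe C"
        using w wf by (auto intro!: trm_val_closed[OF algC])
      ultimately show "trm_val C w s = trm_val C w t"
        using Crep by metis
    qed
    then have cmC: "congruence_modular \<Sigma> C"
      using cm by (simp add: congruence_modular_variety_def)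
    define pb where "pb \<theta> = {(s, t). s \<in> universe C \<and> t \<in> universe C \<and> (?ev s, ?ev t) \<in> \<theta>}" for \<theta>
    have pb: "pb \<theta> \<in> congruences \<Sigma> C" if "\<theta> \<in> congruences \<Sigma> B" for \<theta>
    proof -
      have e: "equiv (universe B) \<theta>" using that by (simp add: congruences_def)
      have "equiv (universe C) (pb \<theta>)"
      proof (rule equivI)
        show "refl_on (universe C) (pb \<theta>)"
          using e evU CwF by (auto simp: pb_def equiv_def refl_on_def)
        show "sym (pb \<theta>)" using e by (auto simp: pb_def equiv_def sym_def)
        show "trans (pb \<theta>)" using e unfolding pb_def equiv_def trans_def by blast
      qed (auto simp: pb_def)
      moreover have "(oper C f ss, oper C f ts) \<in> pb \<theta>"
        if f: "\<Sigma> f = Some n" and ss: "ss \<in> tuples (universe C) n" and ts: "ts \<in> tuples (universe C) n"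
          and r: "list_all2 (\<lambda>s t. (s, t) \<in> pb \<theta>) ss ts" for f n ss ts
      proof -
        have "list_all2 (\<lambda>x y. (x, y) \<in> \<theta>) (map ?ev ss) (map ?ev ts)"
          unfolding list.rel_map using r by (rule list_all2_mono) (auto simp: pb_def)
        moreover have "map ?ev us \<in> tuples (universe B) n" if "us \<in> tuples (universe C) n" for us
          using that evU CwF by (auto simp: tuples_def)
        ultimately have "(oper B f (map ?ev ss), oper B f (map ?ev ts)) \<in> \<theta>"
          using \<open>\<theta> \<in> congruences \<Sigma> B\<close> f ss ts by (auto simp: congruences_def)
        then show ?thesis
          using Cop[OF f] ss ts by (simp add: pb_def)
      qed
      ultimately show ?thesis by (auto simp: congruences_def)
    qed
    define q where "q i = rep (v i)" for i
    have qC: "q i \<in> universe C" and evq: "?ev (q i) = v i" for i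
    proof -
      have "wf_trm \<Sigma> (Var i :: (nat, 'f) trm)" by simp
      from rep[OF this] this show "?ev (q i) = v i" "q i \<in> universe C"
        unfolding q_def C_def by (auto intro: image_eqI[where x = "Var i"])
    qed
    have path: "(q 0, q i) \<in> \<theta>"
      if \<theta>: "\<theta> \<in> congruences \<Sigma> C" "pb \<alpha> \<union> pb \<beta> \<subseteq> \<theta>" and "i \<le> N" for \<theta> i
      using that(3)
    proof (induction i)
      case 0
      then show ?case using \<theta>(1) qC by (auto simp: congruences_def equiv_def refl_on_def)
    next
      case (Suc i)
      then have "(v i, v (Suc i)) \<in> \<alpha> \<union> \<beta>"
        using p(3)[of i] by (simp add: v_def min_def)
      then have "(q i, q (Suc i)) \<in> \<theta>"
        using \<theta>(2) qC evq by (auto simp: pb_def)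
      moreover have "trans \<theta>" using \<theta>(1) by (simp add: congruences_def equiv_def)
      ultimately show ?case using Suc by (auto dest: transD)
    qed
    have v0N: "v 0 = x" "v N = y" by (auto simp: v_def p)
    have "(q 0, q N) \<in> con_join \<Sigma> C (pb \<alpha>) (pb \<beta>)"
      using path by (auto simp: con_join_def)
    moreover have "(q 0, q N) \<in> pb \<gamma>"
      using qC evq xy(2) v0N by (simp add: pb_def)
    moreover have "pb \<alpha> \<subseteq> pb \<gamma>" using le by (auto simp: pb_def)
    ultimately have *: "(q 0, q N) \<in> con_join \<Sigma> C (pb \<alpha>) (pb \<beta> \<inter> pb \<gamma>)"
      using cmC pb[OF \<alpha>] pb[OF \<beta>] pb[OF \<gamma>] by (auto simp: congruence_modular_def)
    have **: "\<beta> \<inter> \<gamma> \<in> congruences \<Sigma> B"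
      using congruences_Inter[of "{\<beta>, \<gamma>}" \<Sigma> B] \<beta> \<gamma> by simp
    let ?J = "con_join \<Sigma> B \<alpha> (\<beta> \<inter> \<gamma>)"
    have "pb ?J \<in> congruences \<Sigma> C"
      by (intro pb con_join_least(1) alg \<alpha> **)
    moreover have "pb \<alpha> \<subseteq> pb ?J" "pb \<beta> \<inter> pb \<gamma> \<subseteq> pb ?J"
      using con_join_least(2,3)[OF alg \<alpha> **] by (auto simp: pb_def)
    ultimately have "(q 0, q N) \<in> pb ?J"
      using * by (auto simp: con_join_def)
    then show ?thesis
      using evq v0N by (simp add: pb_def)
  qed
  show ?thesis
    unfolding congruence_modular_def
  proof (intro ballI impI equalityI)
    fix \<alpha> \<beta> \<gamma>
    assume c: "\<alpha> \<in> congruences \<Sigma> B" "\<beta> \<in> congruences \<Sigma> B" "\<gamma> \<in> congruences \<Sigma> B" and le: "\<alpha> \<subseteq> \<gamma>"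
    show "con_join \<Sigma> B \<alpha> \<beta> \<inter> \<gamma> \<subseteq> con_join \<Sigma> B \<alpha> (\<beta> \<inter> \<gamma>)"
      using main[OF c le] by auto
    show "con_join \<Sigma> B \<alpha> (\<beta> \<inter> \<gamma>) \<subseteq> con_join \<Sigma> B \<alpha> \<beta> \<inter> \<gamma>"
      using c le by (auto simp: con_join_def)
  qed
qed

end

theory Submission
  imports
    Defs
    "HOL-Algebra.FiniteProduct"
    "HOL-Algebra.Generated_Groups"
    "HOL-Number_Theory.Cong"
begin

text \<open>
  Day terms, read off from modularity of the congruence lattice of an algebra of term functions,
  yield a difference term; on a finite nilpotent algebra a suitable iterate of it is a Mal'cev
  term.  If \<open>\<alpha>\<close> is a nonzero congruence, the differences of \<open>\<alpha>\<close>-related pairs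
  modulo \<open>[1, \<alpha>]\<close> form a nontrivial abelian \<open>p\<close>-group, which has a nonzero character
  into \<open>\<int>/p\<close>; the common kernel of all these characters is a strictly smaller congruence.
  Iterating this from the total relation gives a chain of length at most \<open>h\<close> down to equality.

  Along the chain the algebra is coordinatized by functions into \<open>\<int>/p\<close>: a coordinate of a
  fundamental operation is a sum of coordinates of the same level of its arguments and an arbitrary
  function of their classes modulo the previous congruence, and the latter is a polynomial of degree
  at most \<open>m (q - 1)\<close> in the earlier coordinates.  Hence every coordinate of a term function is
  a sum of functions of at most \<open>s\<close> variables each, and alternating sums over \<open>s + 1\<close>
  blocks of variables vanish, which is supernilpotency.

  For the free spectrum, the first variable serves as a zero and the Mal'cev term provides a loop
  operation.  Splitting off one variable at a time writes the number of \<open>n\<close>-ary term functions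
  as a product of powers \<open>a\<^sub>j ^ (n - 1 choose j)\<close>, where \<open>a\<^sub>j\<close> counts the
  functions that absorb \<open>j\<close> variables; by the degree bound \<open>a\<^sub>j = 1\<close> for \<open>j > s\<close>.
\<close>

section \<open>Term operations and centralizing congruences\<close>

text \<open>The bound grows by the factor m (q - 1) per level for this reason: the indicator of one
  class is a product of at most q - 1 separating coordinates, and a function of m classes is a
  combination of products of m indicators. Nesting of terms does not raise the degree, because
  coordinates of the current level enter only additively. The first level is cheaper: modulo the
  total relation there is one class, so only the degree 1 of a variable remains. This turns h into h
  - 1 in the exponent.

  A difference group need not have exponent p, so its characters into the integers modulo p may fail
  to separate its elements. The chain therefore runs through kernels of characters; these need not
  be lower covers, but strict descent is all that the height bounds. That q is a prime power enters
  through Lagrange: a Mal'cev operation that cancels makes all classes of a congruence equally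
  large, so each difference group has order dividing q.\<close>

primrec subst :: "('v \<Rightarrow> ('w, 'f) trm) \<Rightarrow> ('v, 'f) trm \<Rightarrow> ('w, 'f) trm" where
  "subst \<sigma> (Var x) = \<sigma> x"
| "subst \<sigma> (Fun f ts) = Fun f (map (subst \<sigma>) ts)"

lemma trm_val_subst: "trm_val A v (subst \<sigma> t) = trm_val A (\<lambda>x. trm_val A v (\<sigma> x)) t"
  by (induction t) (auto simp: comp_def cong: map_cong)

lemma wf_subst: "wf_trm \<Sigma> t \<Longrightarrow> (\<And>x. wf_trm \<Sigma> (\<sigma> x)) \<Longrightarrow> wf_trm \<Sigma> (subst \<sigma> t)"
  by (induction t) (auto simp: list_all_iff)

lemma trm_vars_subst: "trm_vars (subst \<sigma> t) = (\<Union>x\<in>trm_vars t. trm_vars (\<sigma> x))"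
  by (induction t) auto

lemma trm_val_cong: "(\<And>x. x \<in> trm_vars t \<Longrightarrow> v x = w x) \<Longrightarrow> trm_val A v t = trm_val A w t"
proof (induction t)
  case (Fun f ts)
  then have "map (trm_val A v) ts = map (trm_val A w) ts" by (intro map_cong) auto
  then show ?case by (simp only: trm_val.simps)
qed simp

lemma finite_trm_vars: "finite (trm_vars t)"
  by (induction t) auto

text \<open>Operations act on infinite assignments instead of tuples, so that composing and renaming
  never change an arity. Only the values on assignments into the universe are prescribed.\<close>

definition termop :: "'f signature \<Rightarrow> ('f, 'a) algebra \<Rightarrow> ((nat \<Rightarrow> 'a) \<Rightarrow> 'a) \<Rightarrow> bool" where
  "termop \<Sigma> A g \<longleftrightarrow> (\<exists>t. wf_trm \<Sigma> t \<and> (\<forall>v\<in>{v. \<forall>i. v i \<in> universe A}. g v = trm_val A v t))"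

text \<open>
  The term condition for the total relation and \<open>\<theta>\<close> modulo \<open>\<delta>\<close>, on matrices of assignments:
  \<open>u, u'\<close> is the first row and \<open>w, w'\<close> the second, and each variable is either constant along
  rows or constant along columns.
\<close>

definition centralizes ::
  "'f signature \<Rightarrow> ('f, 'a) algebra \<Rightarrow> ('a \<times> 'a) set \<Rightarrow> ('a \<times> 'a) set \<Rightarrow> bool" where
  "centralizes \<Sigma> A \<theta> \<delta> \<longleftrightarrow>
     (\<forall>g u u' w w'. termop \<Sigma> A g \<longrightarrow>
        (\<forall>i. u i \<in> universe A \<and> u' i \<in> universe A \<and> w i \<in> universe A \<and> w' i \<in> universe A) \<longrightarrow>
        (\<forall>i. u i = u' i \<and> w i = w' i \<or> u i = w i \<and> u' i = w' i \<and> (u i, u' i) \<in> \<theta>) \<longrightarrow>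
        (g u, g u') \<in> \<delta> \<longrightarrow> (g w, g w') \<in> \<delta>)"

lemma congruence_subset: "\<theta> \<in> congruences \<Sigma> A \<Longrightarrow> \<theta> \<subseteq> universe A \<times> universe A"
  by (auto simp: congruences_def equiv_def)

lemma congruence_refl: "\<theta> \<in> congruences \<Sigma> A \<Longrightarrow> x \<in> universe A \<Longrightarrow> (x, x) \<in> \<theta>"
  by (auto simp: congruences_def equiv_def refl_on_def)

lemma congruence_sym: "\<theta> \<in> congruences \<Sigma> A \<Longrightarrow> (x, y) \<in> \<theta> \<Longrightarrow> (y, x) \<in> \<theta>"
  by (auto simp: congruences_def equiv_def sym_def)

lemma congruence_trans:
  "\<theta> \<in> congruences \<Sigma> A \<Longrightarrow> (x, y) \<in> \<theta> \<Longrightarrow> (y, z) \<in> \<theta> \<Longrightarrow> (x, z) \<in> \<theta>"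
  unfolding congruences_def equiv_def trans_def by blast

lemma congruenceI:
  assumes "\<theta> \<subseteq> universe A \<times> universe A"
    and "\<And>x. x \<in> universe A \<Longrightarrow> (x, x) \<in> \<theta>"
    and "\<And>x y. (x, y) \<in> \<theta> \<Longrightarrow> (y, x) \<in> \<theta>"
    and "\<And>x y z. (x, y) \<in> \<theta> \<Longrightarrow> (y, z) \<in> \<theta> \<Longrightarrow> (x, z) \<in> \<theta>"
    and "\<And>f n xs ys. \<Sigma> f = Some n \<Longrightarrow> xs \<in> tuples (universe A) n \<Longrightarrow>
      ys \<in> tuples (universe A) n \<Longrightarrow> list_all2 (\<lambda>x y. (x, y) \<in> \<theta>) xs ys \<Longrightarrow>
      (oper A f xs, oper A f ys) \<in> \<theta>"
  shows "\<theta> \<in> congruences \<Sigma> A"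
proof -
  have "equiv (universe A) \<theta>"
    using assms(1-4) by (intro equivI refl_onI symI transI) blast+
  with assms(5) show ?thesis by (auto simp: congruences_def)
qed

lemma congruence_Int:
  "\<alpha> \<in> congruences \<Sigma> A \<Longrightarrow> \<beta> \<in> congruences \<Sigma> A \<Longrightarrow> \<alpha> \<inter> \<beta> \<in> congruences \<Sigma> A"
  using congruences_Inter[of "{\<alpha>, \<beta>}" \<Sigma> A] by simp

text \<open>Identities pass to any algebra whose points are separated by homomorphisms into A. This
  serves twice: evaluations separate term operations, and the two projections separate the pairs of
  a congruence.\<close>

lemma in_variety_subdirect:
  assumes A: "in_variety \<Sigma> E A" and E: "E \<subseteq> identities \<Sigma>" and B: "is_algebra \<Sigma> B"
    and hom: "\<And>i f n xs. i \<in> I \<Longrightarrow> \<Sigma> f = Some n \<Longrightarrow> xs \<in> tuples (universe B) n \<Longrightarrow>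
      \<pi> i (oper B f xs) = oper A f (map (\<pi> i) xs)"
    and closed: "\<And>i x. i \<in> I \<Longrightarrow> x \<in> universe B \<Longrightarrow> \<pi> i x \<in> universe A"
    and sep: "\<And>x y. x \<in> universe B \<Longrightarrow> y \<in> universe B \<Longrightarrow> (\<And>i. i \<in> I \<Longrightarrow> \<pi> i x = \<pi> i y) \<Longrightarrow> x = y"
  shows "in_variety \<Sigma> E B"
proof -
  have ev: "\<pi> i (trm_val B w t) = trm_val A (\<pi> i \<circ> w) t"
    if "i \<in> I" "w \<in> UNIV \<rightarrow> universe B" "wf_trm \<Sigma> t" for i and w :: "nat \<Rightarrow> 'c" and t
    using that(3)
  proof (induction t)
    case (Fun f ts)
    have "map (trm_val B w) ts \<in> tuples (universe B) (length ts)"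
      using Fun.prems that(2)
      by (auto simp: tuples_def list_all_iff Pi_def intro!: trm_val_closed[OF B])
    then have "\<pi> i (trm_val B w (Fun f ts)) = oper A f (map (\<pi> i) (map (trm_val B w) ts))"
      using hom[OF that(1)] Fun.prems by simp
    also have "map (\<pi> i) (map (trm_val B w) ts) = map (trm_val A (\<pi> i \<circ> w)) ts"
      using Fun by (auto simp: list_all_iff comp_def)
    finally show ?case by (simp add: comp_def)
  qed simp
  show ?thesis
    unfolding in_variety_def
  proof (intro conjI B ballI, clarify)
    fix s t and w :: "nat \<Rightarrow> 'c"
    assume st: "(s, t) \<in> E" and w: "w \<in> UNIV \<rightarrow> universe B"
    have wf: "wf_trm \<Sigma> s" "wf_trm \<Sigma> t" using st E by (auto simp: identities_def)
    show "trm_val B w s = trm_val B w t"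
    proof (rule sep)
      fix i assume "i \<in> I"
      moreover from this have "\<pi> i \<circ> w \<in> UNIV \<rightarrow> universe A" using w closed by (auto simp: Pi_iff)
      ultimately show "\<pi> i (trm_val B w s) = \<pi> i (trm_val B w t)"
        using ev[OF _ w] wf st A by (auto simp: in_variety_def)
    qed (use w wf in \<open>auto intro!: trm_val_closed[OF B]\<close>)
  qed
qed

section \<open>Term operations and centrality in a finite algebra\<close>

locale finite_algebra =
  fixes \<Sigma> :: "'f signature" and A :: "('f, 'a) algebra"
  assumes alg: "is_algebra \<Sigma> A" and fin: "finite (universe A)"
begin

abbreviation U where "U \<equiv> universe A"
abbreviation V :: "(nat \<Rightarrow> 'a) set" where "V \<equiv> {v. \<forall>i. v i \<in> U}"
abbreviation Con where "Con \<equiv> congruences \<Sigma> A"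
abbreviation tmop where "tmop \<equiv> termop \<Sigma> A"
abbreviation central where "central \<equiv> centralizes \<Sigma> A"

lemma tmop_closed: "tmop g \<Longrightarrow> v \<in> V \<Longrightarrow> g v \<in> U"
  unfolding termop_def using trm_val_closed[OF alg, of v] by (auto simp: Pi_iff)

lemma tmop_cong: "tmop g \<Longrightarrow> (\<And>v. v \<in> V \<Longrightarrow> g v = h v) \<Longrightarrow> tmop h"
  unfolding termop_def by auto

lemma tmop_var: "tmop (\<lambda>v. v i)"
  unfolding termop_def by (rule exI[of _ "Var i"]) simp

lemma tmop_trm: "wf_trm \<Sigma> t \<Longrightarrow> tmop (\<lambda>v. trm_val A v t)"
  unfolding termop_def by blast

lemma tmop_comp:
  assumes "tmop g" "\<And>i. tmop (h i)"
  shows "tmop (\<lambda>v. g (\<lambda>i. h i v))"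
proof -
  have "\<forall>i. \<exists>t. wf_trm \<Sigma> t \<and> (\<forall>v\<in>V. h i v = trm_val A v t)"
    using assms(2) unfolding termop_def by blast
  from choice[OF this] obtain s
    where s: "\<And>i. wf_trm \<Sigma> (s i)" "\<And>i v. v \<in> V \<Longrightarrow> h i v = trm_val A v (s i)"
    by blast
  from assms(1) obtain t where t: "wf_trm \<Sigma> t" "\<And>v. v \<in> V \<Longrightarrow> g v = trm_val A v t"
    unfolding termop_def by auto
  show ?thesis
    unfolding termop_def
  proof (intro exI conjI ballI)
    show "wf_trm \<Sigma> (subst s t)" using s t by (intro wf_subst)
    fix v assume v: "v \<in> V"
    then have "(\<lambda>i. h i v) \<in> V" using tmop_closed assms(2) by auto
    then show "g (\<lambda>i. h i v) = trm_val A v (subst s t)"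
      using s t v by (simp add: trm_val_subst)
  qed
qed

lemma tmop_oper:
  assumes "\<Sigma> f = Some n"
  shows "tmop (\<lambda>v. oper A f (map v [0..<n]))"
proof -
  have wf: "wf_trm \<Sigma> (Fun f (map Var [0..<n]))" using assms by (simp add: list_all_iff)
  have "trm_val A v (Fun f (map Var [0..<n])) = oper A f (map v [0..<n])" for v
    by (simp add: comp_def)
  then show ?thesis using tmop_trm[OF wf] by (simp only:)
qed

lemma tmop_congruence:
  assumes \<theta>: "\<theta> \<in> Con" and "tmop g" "v \<in> V" "w \<in> V" and vw: "\<And>i. (v i, w i) \<in> \<theta>"
  shows "(g v, g w) \<in> \<theta>"
proof -
  from assms(2) obtain t where t: "wf_trm \<Sigma> t" "\<And>v. v \<in> V \<Longrightarrow> g v = trm_val A v t"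
    unfolding termop_def by auto
  have "(trm_val A v t, trm_val A w t) \<in> \<theta>"
    using t(1)
  proof (induction t)
    case (Fun f ts)
    have "map (trm_val A v) ts \<in> tuples U (length ts)" "map (trm_val A w) ts \<in> tuples U (length ts)"
      using Fun.prems assms(3,4)
      by (auto simp: tuples_def list_all_iff Pi_def intro!: trm_val_closed[OF alg])
    moreover have "list_all2 (\<lambda>x y. (x, y) \<in> \<theta>) (map (trm_val A v) ts) (map (trm_val A w) ts)"
      using Fun by (auto simp: list.rel_map list_all_iff intro: list.rel_refl_strong)
    ultimately show ?case using \<theta> Fun.prems by (auto simp: congruences_def)
  qed (use vw in simp)
  then show ?thesis using t assms by simp
qed

lemma centralizesD:
  assumes "central \<theta> \<delta>" "tmop g" "(g u, g u') \<in> \<delta>"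
    and "u \<in> V" "u' \<in> V" "w \<in> V" "w' \<in> V"
    and "\<And>i. u i = u' i \<and> w i = w' i \<or> u i = w i \<and> u' i = w' i \<and> (u i, u' i) \<in> \<theta>"
  shows "(g w, g w') \<in> \<delta>"
  by (rule assms(1)[unfolded centralizes_def, rule_format, OF assms(2) _ _ assms(3)])
    (use assms(4-8) in auto)

lemma term_condition_centralizes:
  assumes tc: "term_condition \<Sigma> A (total_rel A) \<theta> \<delta>" and \<theta>: "\<theta> \<in> Con"
  shows "central \<theta> \<delta>"
  unfolding centralizes_def
proof (intro allI impI)
  fix g u u' w w'
  assume "tmop g" and "\<forall>i. u i \<in> U \<and> u' i \<in> U \<and> w i \<in> U \<and> w' i \<in> U"
    and mat: "\<forall>i. u i = u' i \<and> w i = w' i \<or> u i = w i \<and> u' i = w' i \<and> (u i, u' i) \<in> \<theta>"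
    and uu': "(g u, g u') \<in> \<delta>"
  then have V: "u \<in> V" "u' \<in> V" "w \<in> V" "w' \<in> V" by auto
  obtain t where t: "wf_trm \<Sigma> t" "\<And>v. v \<in> V \<Longrightarrow> g v = trm_val A v t"
    using \<open>tmop g\<close> unfolding termop_def by auto
  obtain n where n: "trm_vars t \<subseteq> {..<n}"
    using finite_trm_vars[of t] by (metis finite_nat_bounded)
  \<comment> \<open>J holds the variables that change along some row. They are renamed into a second
    block of n variables, so that the first block carries the total relation and the second one
    \<theta>.\<close>
  define J where "J = {i. \<not> (u i = u' i \<and> w i = w' i)}"
  define t' where "t' = subst (\<lambda>i. if i \<in> J then Var (n + i) else Var i) t"
  define T where "T = restrict (\<lambda>xs. trm_val A (\<lambda>i. xs ! i) t') (tuples U (n + n))"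
  have "trm_vars t' \<subseteq> {..<n + n}"
    unfolding t'_def trm_vars_subst using n by (force split: if_splits)
  moreover have "wf_trm \<Sigma> t'"
    unfolding t'_def using t by (auto intro!: wf_subst)
  ultimately have T: "T \<in> term_functions \<Sigma> A (n + n)"
    unfolding term_functions_def T_def by blast
  have val: "T (map a [0..<n] @ map c [0..<n]) = trm_val A (\<lambda>i. if i \<in> J then c i else a i) t"
    if "a \<in> V" "c \<in> V" for a c
  proof -
    have "map a [0..<n] @ map c [0..<n] \<in> tuples U (n + n)"
      using that by (auto simp: tuples_def)
    then show ?thesis
      unfolding T_def t'_def using n
      by (auto simp: trm_val_subst nth_append intro!: trm_val_cong)
  qed
  define d where "d = (\<lambda>i. if i \<in> J then u' i else u i)"
  have dV: "d \<in> V" using V by (auto simp: d_def)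
  have eqs: "(\<lambda>i. if i \<in> J then u i else u i) = u" "(\<lambda>i. if i \<in> J then d i else u i) = u'"
    "(\<lambda>i. if i \<in> J then u i else w i) = w" "(\<lambda>i. if i \<in> J then d i else w i) = w'"
    using mat by (auto simp: J_def d_def fun_eq_iff)
  have tup: "map a [0..<n] \<in> tuples U n" if "a \<in> V" for a
    using that by (auto simp: tuples_def)
  have cd: "list_all2 (\<lambda>x y. (x, y) \<in> \<theta>) (map u [0..<n]) (map d [0..<n])"
    using mat V congruence_refl[OF \<theta>]
    by (fastforce simp: list_all2_map1 list_all2_map2 J_def d_def intro!: list.rel_refl_strong)
  have ab: "list_all2 (\<lambda>x y. (x, y) \<in> total_rel A) (map u [0..<n]) (map w [0..<n])"
    using V by (auto simp: list_all2_map1 list_all2_map2 total_rel_def intro!: list.rel_refl_strong)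
  have "(T (map u [0..<n] @ map u [0..<n]), T (map u [0..<n] @ map d [0..<n])) \<in> \<delta>"
    using uu' t V by (simp only: val dV eqs)
  then have "(T (map w [0..<n] @ map u [0..<n]), T (map w [0..<n] @ map d [0..<n])) \<in> \<delta>"
    using tc[unfolded term_condition_def] T tup ab cd V dV by blast
  then show "(g w, g w') \<in> \<delta>"
    using t V by (simp only: val dV eqs)
qed

lemma centralizes_term_condition:
  assumes c: "central \<theta> \<delta>"
  shows "term_condition \<Sigma> A (total_rel A) \<theta> \<delta>"
  unfolding term_condition_def
proof (intro allI ballI impI)
  fix k l t a b c d
  assume t: "t \<in> term_functions \<Sigma> A (k + l)" and a: "a \<in> tuples U k" and b: "b \<in> tuples U k"
    and cc: "c \<in> tuples U l" and d: "d \<in> tuples U l"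
    and cd: "list_all2 (\<lambda>x y. (x, y) \<in> \<theta>) c d" and tt: "(t (a @ c), t (a @ d)) \<in> \<delta>"
  obtain o' where o: "o' \<in> U" using alg by (auto simp: is_algebra_def)
  obtain r where r: "wf_trm \<Sigma> r" "trm_vars r \<subseteq> {..<k + l}"
      "t = restrict (\<lambda>xs. trm_val A (\<lambda>i. xs ! i) r) (tuples U (k + l))"
    using t unfolding term_functions_def by blast
  define e where "e = (\<lambda>xs i. if i < k + l then xs ! i else o')"
  have app: "xs @ ys \<in> tuples U (k + l)" if "xs \<in> tuples U k" "ys \<in> tuples U l" for xs ys
    using that by (auto simp: tuples_def)
  have val: "t xs = trm_val A (e xs) r" if "xs \<in> tuples U (k + l)" for xs
    using that r by (auto simp: e_def intro!: trm_val_cong)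
  have eV: "e xs \<in> V" if "xs \<in> tuples U (k + l)" for xs
    using that o by (auto simp: e_def tuples_def subsetD[OF _ nth_mem])
  have "(trm_val A (e (b @ c)) r, trm_val A (e (b @ d)) r) \<in> \<delta>"
    using c tmop_trm[OF r(1)]
  proof (rule centralizesD[where u = "e (a @ c)" and u' = "e (a @ d)"])
    show "(trm_val A (e (a @ c)) r, trm_val A (e (a @ d)) r) \<in> \<delta>"
      using tt val app a cc d by simp
    fix i
    show "e (a @ c) i = e (a @ d) i \<and> e (b @ c) i = e (b @ d) i \<or>
      e (a @ c) i = e (b @ c) i \<and> e (a @ d) i = e (b @ d) i \<and> (e (a @ c) i, e (a @ d) i) \<in> \<theta>"
      using a b cc d cd by (auto simp: e_def tuples_def nth_append list_all2_conv_all_nth)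
  qed (use eV app a b cc d in auto)
  then show "(t (b @ c), t (b @ d)) \<in> \<delta>"
    using val app b cc d by simp
qed

section \<open>The lower central series\<close>

abbreviation L where "L k \<equiv> lower_central \<Sigma> A k"

lemma L_congruence: "L k \<in> Con"
  by (cases k) (auto simp: total_rel_congruence[OF alg] commutator_least(1)[OF alg])

lemma L_central: "central (L k) (L (Suc k))"
  using commutator_least(2)[OF alg] L_congruence by (auto intro!: term_condition_centralizes)

lemma centralizes_self:
  assumes "\<theta> \<in> Con"
  shows "central \<theta> \<theta>"
  unfolding centralizes_def
proof (intro allI impI)
  fix g and u u' w w' :: "nat \<Rightarrow> 'a"
  assume g: "tmop g" and "\<forall>i. u i \<in> U \<and> u' i \<in> U \<and> w i \<in> U \<and> w' i \<in> U"
    and mat: "\<forall>i. u i = u' i \<and> w i = w' i \<or> u i = w i \<and> u' i = w' i \<and> (u i, u' i) \<in> \<theta>"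
  then have V: "w \<in> V" "w' \<in> V" by auto
  have "(w i, w' i) \<in> \<theta>" for i
    using mat[rule_format, of i] V congruence_refl[OF assms] by auto
  then show "(g w, g w') \<in> \<theta>" using tmop_congruence[OF assms g V] by blast
qed

lemma commutator_le:
  assumes "\<theta> \<in> Con"
  shows "commutator \<Sigma> A (total_rel A) \<theta> \<subseteq> \<theta>"
  by (rule commutator_least(3)[OF alg]) (use assms centralizes_self centralizes_term_condition in auto)

lemma L_Suc_le: "L (Suc k) \<subseteq> L k"
  using commutator_le[OF L_congruence] by simp

text \<open>Centrality is inherited by smaller congruences, so [1, -] is monotone. A fixed point of
  it lies below every member of the lower central series, and that series reaches equality.\<close>

lemma commutator_less:
  assumes nil: "nilpotent \<Sigma> A" and \<alpha>: "\<alpha> \<in> Con" "\<not> \<alpha> \<subseteq> equality_rel A"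
  shows "commutator \<Sigma> A (total_rel A) \<alpha> \<noteq> \<alpha>"
proof
  assume eq: "commutator \<Sigma> A (total_rel A) \<alpha> = \<alpha>"
  have "\<alpha> \<subseteq> L k" for k
  proof (induction k)
    case 0
    then show ?case using congruence_subset[OF \<alpha>(1)] by (auto simp: total_rel_def)
  next
    case (Suc k)
    have "central \<alpha> (L (Suc k))"
      unfolding centralizes_def
    proof (intro allI impI)
      fix g u u' w w'
      assume *: "tmop g" "\<forall>i. u i \<in> U \<and> u' i \<in> U \<and> w i \<in> U \<and> w' i \<in> U"
        "\<forall>i. u i = u' i \<and> w i = w' i \<or> u i = w i \<and> u' i = w' i \<and> (u i, u' i) \<in> \<alpha>"
        "(g u, g u') \<in> L (Suc k)"
      show "(g w, g w') \<in> L (Suc k)"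
        using L_central *(1,4)
      proof (rule centralizesD)
        fix i
        show "u i = u' i \<and> w i = w' i \<or> u i = w i \<and> u' i = w' i \<and> (u i, u' i) \<in> L k"
          using *(3)[rule_format, of i] Suc by auto
      qed (use *(2) in auto)
    qed
    then have "commutator \<Sigma> A (total_rel A) \<alpha> \<subseteq> L (Suc k)"
      by (intro commutator_least(3)[OF alg] L_congruence centralizes_term_condition)
    then show ?case using eq by simp
  qed
  moreover obtain k where "L k = equality_rel A"
    using nil by (auto simp: nilpotent_def k_nilpotent_def)
  ultimately show False using \<alpha>(2) by auto
qed

end

section \<open>A Mal'cev term\<close>

text \<open>Pigeonhole on the iterates of the whole family at once. One exponent for all b is
  essential: the N-fold iterate, which inverts every F b, can then be written as a term operation in
  which b is a variable.\<close>

lemma injective_family_period: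
  assumes "finite I" "finite U" and inj: "\<And>b. b \<in> I \<Longrightarrow> inj_on (F b) U"
    and closed: "\<And>b x. b \<in> I \<Longrightarrow> x \<in> U \<Longrightarrow> F b x \<in> U"
  obtains N :: nat where "\<And>b x. b \<in> I \<Longrightarrow> x \<in> U \<Longrightarrow> (F b ^^ Suc N) x = x"
proof -
  have cl: "(F b ^^ n) x \<in> U" if "b \<in> I" "x \<in> U" for b x n
    by (induction n) (use that closed in auto)
  define h where "h n = restrict (\<lambda>(b, x). (F b ^^ n) x) (I \<times> U)" for n
  have "range h \<subseteq> I \<times> U \<rightarrow>\<^sub>E U"
    using cl unfolding h_def by (intro image_subsetI restrict_PiE_iff[THEN iffD2]) auto
  moreover have "finite (I \<times> U \<rightarrow>\<^sub>E U)"
    using assms by (intro finite_PiE) auto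
  ultimately have "\<not> inj h"
    using finite_subset finite_imageD infinite_UNIV_nat by metis
  then obtain i j where ij: "i < j" "h i = h j"
    unfolding inj_def by (metis nat_neq_iff)
  have "(F b ^^ Suc (j - i - 1)) x = x" if b: "b \<in> I" and x: "x \<in> U" for b x
  proof -
    have inj': "inj_on (F b ^^ i) U"
    proof (induction i)
      case (Suc i)
      have "inj_on (F b) ((F b ^^ i) ` U)"
        by (rule inj_on_subset[OF inj[OF b]]) (use cl[OF b] in blast)
      from comp_inj_on[OF Suc this] show ?case by (simp add: comp_def)
    qed simp
    have "(F b ^^ i) x = (F b ^^ j) x"
      using fun_cong[OF ij(2), of "(b, x)"] b x by (simp add: h_def)
    also have "(F b ^^ j) x = (F b ^^ i) ((F b ^^ (j - i)) x)"
      using ij(1) by (simp flip: funpow_add comp_apply[of "F b ^^ i"])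
    finally have "x = (F b ^^ (j - i)) x"
      using inj_onD[OF inj' _ x cl[OF b x]] by blast
    moreover have "Suc (j - i - 1) = j - i" using ij(1) by simp
    ultimately show ?thesis by metis
  qed
  then show ?thesis using that by blast
qed

lemma congruence_cong_iff:
  assumes \<delta>: "\<delta> \<in> congruences \<Sigma> A" and "(a, c) \<in> \<delta>" "(b, d) \<in> \<delta>"
  shows "(a, b) \<in> \<delta> \<longleftrightarrow> (c, d) \<in> \<delta>"
  using assms congruence_trans[OF \<delta>] congruence_sym[OF \<delta>] by metis

text \<open>The fourth value fills all later positions, so that a term operation in infinitely many
  variables becomes a four-place operation.\<close>

definition asg :: "'a \<Rightarrow> 'a \<Rightarrow> 'a \<Rightarrow> 'a \<Rightarrow> nat \<Rightarrow> 'a" where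
  "asg a b c d i = (if i = 0 then a else if i = 1 then b else if i = 2 then c else d)"

lemma asg_simps [simp]:
  "asg a b c d 0 = a" "asg a b c d 1 = b" "asg a b c d (Suc 0) = b" "asg a b c d 2 = c"
  "asg a b c d 3 = d"
  by (auto simp: asg_def)

section \<open>From Day terms to a Mal'cev term\<close>

context finite_algebra
begin

lemma asg_V: "a \<in> U \<Longrightarrow> b \<in> U \<Longrightarrow> c \<in> U \<Longrightarrow> d \<in> U \<Longrightarrow> asg a b c d \<in> V"
  by (auto simp: asg_def)

lemma tmop_asg:
  assumes "tmop g" "tmop a" "tmop b" "tmop c" "tmop d"
  shows "tmop (\<lambda>v. g (asg (a v) (b v) (c v) (d v)))"
proof -
  have "tmop (\<lambda>v. g (\<lambda>i. asg a b c d i v))"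
    by (rule tmop_comp[OF assms(1)]) (use assms in \<open>auto simp: asg_def\<close>)
  moreover have "(\<lambda>i. asg a b c d i v) = asg (a v) (b v) (c v) (d v)" for v
    by (auto simp: asg_def)
  ultimately show ?thesis by simp
qed

lemma tmop3_comp:
  assumes "tmop (\<lambda>v. D (v 0) (v 1) (v 2))" "tmop a" "tmop b" "tmop c"
  shows "tmop (\<lambda>v. D (a v) (b v) (c v))"
  using tmop_asg[OF assms assms(4)] by simp

lemma tmop_finite_support:
  assumes "tmop g"
  obtains n where "\<And>v w. v \<in> V \<Longrightarrow> w \<in> V \<Longrightarrow> (\<And>i. i < n \<Longrightarrow> v i = w i) \<Longrightarrow> g v = g w"
proof -
  obtain t where t: "\<And>v. v \<in> V \<Longrightarrow> g v = trm_val A v t"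
    using assms unfolding termop_def by auto
  obtain n where "trm_vars t \<subseteq> {..<n}"
    using finite_trm_vars[of t] by (metis finite_nat_bounded)
  then have "g v = g w" if "v \<in> V" "w \<in> V" "\<And>i. i < n \<Longrightarrow> v i = w i" for v w
    using that t by (auto intro!: trm_val_cong)
  then show ?thesis using that by blast
qed

text \<open>Mal'cev's method, with the algebra F of term operations in the role of a free algebra.
  Each of \<alpha>, \<beta>, \<gamma> identifies operations that agree under certain equations
  between variables. The path x 0, x 1, x 2, x 3 alternates \<alpha>, \<gamma>, \<alpha>, while x 0
  and x 3 are \<beta>-related and \<gamma> lies below \<beta>. The modular law puts (x 0, x 3) into
  the join of \<gamma> with \<alpha> \<inter> \<beta>, and a path witnessing this is a sequence of
  Day terms.\<close>

lemma day_terms: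
  assumes cm: "congruence_modular_variety \<Sigma> E" and A: "in_variety \<Sigma> E A"
  obtains m N where "\<And>i. tmop (m i)"
    and "\<And>v. v \<in> V \<Longrightarrow> m 0 v = v 0" and "\<And>v. v \<in> V \<Longrightarrow> m N v = v 3"
    and "\<And>i v. v \<in> V \<Longrightarrow> v 0 = v 3 \<Longrightarrow> v 1 = v 2 \<Longrightarrow> m i v = v 0"
    and "\<And>i. i < N \<Longrightarrow> (\<forall>v\<in>V. v 1 = v 2 \<longrightarrow> m i v = m (Suc i) v) \<or>
           (\<forall>v\<in>V. v 0 = v 1 \<longrightarrow> v 2 = v 3 \<longrightarrow> m i v = m (Suc i) v)"
proof -
  define F :: "('f, (nat \<Rightarrow> 'a) \<Rightarrow> 'a) algebra" where
    "F = \<lparr>universe = {g \<in> extensional V. tmop g},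
          oper = (\<lambda>f xs. restrict (\<lambda>v. oper A f (map (\<lambda>x. x v) xs)) V)\<rparr>"
  have UF: "g \<in> universe F \<longleftrightarrow> g \<in> extensional V \<and> tmop g" for g
    by (simp add: F_def)
  have opF: "oper F f xs v = oper A f (map (\<lambda>x. x v) xs)" if "v \<in> V" for f xs v
    using that by (simp add: F_def)
  have restr: "restrict g V \<in> universe F" if "tmop g" for g
    using tmop_cong[OF that, of "restrict g V"] by (simp add: UF)
  have algF: "is_algebra \<Sigma> F"
    unfolding is_algebra_def
  proof (intro conjI allI impI ballI)
    show "universe F \<noteq> {}" using restr[OF tmop_var] by blast
    fix f n xs
    assume f: "\<Sigma> f = Some n" and xs: "xs \<in> tuples (universe F) n"
    define h where "h i = (if i < n then xs ! i else (\<lambda>v. v 0))" for i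
    have "tmop (h i)" for i
      using xs UF subsetD[OF _ nth_mem, of xs "universe F" i] by (auto simp: h_def tuples_def tmop_var)
    then have "tmop (\<lambda>v. oper A f (map (\<lambda>i. h i v) [0..<n]))"
      by (rule tmop_comp[OF tmop_oper[OF f]])
    moreover have "map (\<lambda>i. h i v) [0..<n] = map (\<lambda>x. x v) xs" for v
      using xs by (auto simp: h_def tuples_def intro!: nth_equalityI)
    ultimately have "tmop (\<lambda>v. oper A f (map (\<lambda>x. x v) xs))" by simp
    from restr[OF this] show "oper F f xs \<in> universe F" by (simp add: F_def)
  qed
  have "in_variety \<Sigma> E F"
  proof (rule in_variety_subdirect[OF A _ algF, where \<pi> = "\<lambda>v g. g v" and I = V])
    show "E \<subseteq> identities \<Sigma>" using cm by (simp add: congruence_modular_variety_def)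
    show "oper F f xs v = oper A f (map (\<lambda>g. g v) xs)" if "v \<in> V" for v f xs
      using opF[OF that] .
    show "g v \<in> U" if "v \<in> V" "g \<in> universe F" for v g
      using that tmop_closed UF by blast
    show "g = h" if "g \<in> universe F" "h \<in> universe F" "\<And>v. v \<in> V \<Longrightarrow> g v = h v" for g h
      by (rule extensionalityI[of g V h]) (use that UF in auto)
  qed
  from congruence_modular_varietyD[OF cm this] have modF: "congruence_modular \<Sigma> F" .
  define ker where "ker P = {(g, h). g \<in> universe F \<and> h \<in> universe F \<and> (\<forall>v\<in>V. P v \<longrightarrow> g v = h v)}"
    for P
  have ker: "ker P \<in> congruences \<Sigma> F" for P
  proof (rule congruenceI)
    fix f n xs ys
    assume f: "\<Sigma> f = Some n" and xs: "xs \<in> tuples (universe F) n"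
      and ys: "ys \<in> tuples (universe F) n" and r: "list_all2 (\<lambda>x y. (x, y) \<in> ker P) xs ys"
    have "oper F f xs v = oper F f ys v" if "v \<in> V" "P v" for v
    proof -
      have "list_all2 (\<lambda>x y. x v = y v) xs ys"
        by (rule list_all2_mono[OF r]) (use that in \<open>auto simp: ker_def\<close>)
      then have "map (\<lambda>x. x v) xs = map (\<lambda>x. x v) ys"
        by (simp add: list.rel_map list_all2_eq flip: list.rel_eq)
      then show ?thesis using opF that(1) by metis
    qed
    then show "(oper F f xs, oper F f ys) \<in> ker P"
      using algF f xs ys by (auto simp: ker_def is_algebra_def)
  qed (auto simp: ker_def)
  define x where "x i = restrict (\<lambda>v. v i) V" for i :: nat
  have xF: "x i \<in> universe F" for i
    unfolding x_def by (rule restr[OF tmop_var])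
  have xv: "x i v = v i" if "v \<in> V" for i v using that by (simp add: x_def)
  define \<alpha> where "\<alpha> = ker (\<lambda>v. v 0 = v 1 \<and> v 2 = v 3)"
  define \<beta> where "\<beta> = ker (\<lambda>v. v 0 = v 3 \<and> v 1 = v 2)"
  define \<gamma> where "\<gamma> = ker (\<lambda>v. v 1 = v 2)"
  have con: "\<alpha> \<in> congruences \<Sigma> F" "\<beta> \<in> congruences \<Sigma> F" "\<gamma> \<in> congruences \<Sigma> F"
    by (simp_all add: \<alpha>_def \<beta>_def \<gamma>_def ker)
  have le: "\<gamma> \<subseteq> \<beta>" by (auto simp: \<gamma>_def \<beta>_def ker_def)
  have "(x 0, x 1) \<in> \<alpha>" "(x 2, x 3) \<in> \<alpha>" "(x 1, x 2) \<in> \<gamma>" "(x 0, x 3) \<in> \<beta>"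
    using xF xv by (auto simp: \<alpha>_def \<beta>_def \<gamma>_def ker_def)
  moreover have "(x 0, x 3) \<in> con_join \<Sigma> F \<gamma> \<alpha>"
  proof -
    have J: "con_join \<Sigma> F \<gamma> \<alpha> \<in> congruences \<Sigma> F" "\<gamma> \<subseteq> con_join \<Sigma> F \<gamma> \<alpha>" "\<alpha> \<subseteq> con_join \<Sigma> F \<gamma> \<alpha>"
      using con_join_least[OF algF con(3,1)] by auto
    then show ?thesis
      using calculation(1-3) congruence_trans[OF J(1)] by (meson subsetD)
  qed
  ultimately have "(x 0, x 3) \<in> con_join \<Sigma> F \<gamma> (\<alpha> \<inter> \<beta>)"
    using modF[unfolded congruence_modular_def, rule_format, OF con(3,1,2) le] by simp
  then have "(x 0, x 3) \<in> (\<gamma> \<union> \<alpha> \<inter> \<beta>)\<^sup>+"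
    using con_join_subset_trancl[OF algF con(3) congruence_Int[OF con(1,2)]] by auto
  then obtain N where "(x 0, x 3) \<in> (\<gamma> \<union> \<alpha> \<inter> \<beta>) ^^ N"
    by (auto simp: trancl_power)
  then obtain p where p: "p 0 = x 0" "p N = x 3" "\<And>i. i < N \<Longrightarrow> (p i, p (Suc i)) \<in> \<gamma> \<union> \<alpha> \<inter> \<beta>"
    by (auto simp: relpow_fun_conv)
  have p\<beta>: "(x 0, p i) \<in> \<beta>" if "i \<le> N" for i
    using that
  proof (induction i)
    case (Suc i)
    then have "(p i, p (Suc i)) \<in> \<beta>" using p(3)[of i] le by auto
    then show ?case using Suc congruence_trans[OF con(2)] by (meson Suc_leD)
  qed (use p(1) xF congruence_refl[OF con(2)] in simp)
  \<comment> \<open>Freezing the path after N makes every index obey m(x, y, y, x) = x, since the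
    whole path is \<beta>-related to x 0.\<close>
  define m where "m i = p (min i N)" for i
  have m\<beta>: "(x 0, m i) \<in> \<beta>" for i using p\<beta>[of "min i N"] by (simp add: m_def)
  show ?thesis
  proof (rule that[of m N])
    show "tmop (m i)" for i using m\<beta>[of i] UF by (auto simp: \<beta>_def ker_def)
    show "m 0 v = v 0" "m N v = v 3" if "v \<in> V" for v
      using xv[OF that] p by (auto simp: m_def)
    show "m i v = v 0" if "v \<in> V" "v 0 = v 3" "v 1 = v 2" for i v
    proof -
      have "x 0 v = m i v" using m\<beta>[of i] that unfolding \<beta>_def ker_def by auto
      then show ?thesis using xv[OF that(1)] by simp
    qed
    show "(\<forall>v\<in>V. v 1 = v 2 \<longrightarrow> m i v = m (Suc i) v) \<or>
           (\<forall>v\<in>V. v 0 = v 1 \<longrightarrow> v 2 = v 3 \<longrightarrow> m i v = m (Suc i) v)" if "i < N" for i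
    proof -
      have "min i N = i" "min (Suc i) N = Suc i" using that by auto
      then have "(m i, m (Suc i)) \<in> \<gamma> \<or> (m i, m (Suc i)) \<in> \<alpha>"
        using p(3)[OF that] by (auto simp: m_def)
      then show ?thesis unfolding \<alpha>_def \<gamma>_def ker_def by auto
    qed
  qed
qed

text \<open>
  \<open>\<Gamma>\<close> is the largest congruence of the subalgebra \<open>\<theta>\<close> of the square of \<open>A\<close> that saturates \<open>\<delta>\<close>;
  the last property is Gumm's shifting lemma applied to \<open>\<Gamma>\<close> and the two projection kernels
  modulo \<open>\<delta>\<close>.
\<close>

lemma difference_congruence:
  assumes cm: "congruence_modular_variety \<Sigma> E" and A: "in_variety \<Sigma> E A"
    and \<theta>: "\<theta> \<in> Con" and \<delta>: "\<delta> \<in> Con" and le: "\<delta> \<subseteq> \<theta>" and cent: "central \<theta> \<delta>"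
  obtains \<Gamma> where "\<And>x y. x \<in> U \<Longrightarrow> y \<in> U \<Longrightarrow> ((x, x), (y, y)) \<in> \<Gamma>"
    and "\<And>x y. (x, y) \<in> \<theta> \<Longrightarrow> ((x, y), (x, y)) \<in> \<Gamma>"
    and "\<And>p q r. (p, q) \<in> \<Gamma> \<Longrightarrow> (q, r) \<in> \<Gamma> \<Longrightarrow> (p, r) \<in> \<Gamma>"
    and "\<And>h v w v' w'. tmop h \<Longrightarrow> (\<And>i. ((v i, w i), (v' i, w' i)) \<in> \<Gamma>) \<Longrightarrow>
      ((h v, h w), (h v', h w')) \<in> \<Gamma>"
    and "\<And>a b c d. ((a, b), (c, d)) \<in> \<Gamma> \<Longrightarrow> (b, d) \<in> \<delta> \<Longrightarrow> (a, c) \<in> \<delta>"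
proof -
  note sub = congruence_subset[OF \<theta>]
  define \<Gamma> where "\<Gamma> = {((a, b), (c, d)). (a, b) \<in> \<theta> \<and> (c, d) \<in> \<theta> \<and>
     (\<forall>g v w. tmop g \<longrightarrow> (\<forall>i. (v i, w i) \<in> \<theta>) \<longrightarrow>
       (g (v(0 := a)), g (w(0 := b))) \<in> \<delta> \<longleftrightarrow> (g (v(0 := c)), g (w(0 := d))) \<in> \<delta>)}"
  have \<Gamma>\<theta>: "(a, b) \<in> \<theta>" "(c, d) \<in> \<theta>" if "((a, b), (c, d)) \<in> \<Gamma>" for a b c d
    using that by (auto simp: \<Gamma>_def)
  have \<Gamma>D: "(g (v(0 := a)), g (w(0 := b))) \<in> \<delta> \<longleftrightarrow> (g (v(0 := c)), g (w(0 := d))) \<in> \<delta>"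
    if "((a, b), (c, d)) \<in> \<Gamma>" "tmop g" "\<And>i. (v i, w i) \<in> \<theta>" for a b c d g v w
    using that unfolding \<Gamma>_def by blast
  have \<theta>V: "v \<in> V" "w \<in> V" if "\<And>i. (v i, w i) \<in> \<theta>" for v w :: "nat \<Rightarrow> 'a"
    using that sub by auto
  have refl: "((a, b), (a, b)) \<in> \<Gamma>" if "(a, b) \<in> \<theta>" for a b
    using that by (auto simp: \<Gamma>_def)
  have sym: "(q, p) \<in> \<Gamma>" if "(p, q) \<in> \<Gamma>" for p q
    using that by (auto simp: \<Gamma>_def)
  have trans: "(p, r) \<in> \<Gamma>" if "(p, q) \<in> \<Gamma>" "(q, r) \<in> \<Gamma>" for p q r
    using that by (auto simp: \<Gamma>_def)
  \<comment> \<open>Here centrality enters: position 0 is constant along rows and changes from x to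
    y, while the other positions are \<theta>-pairs that are kept.\<close>
  have diag: "((x, x), (y, y)) \<in> \<Gamma>" if xy: "x \<in> U" "y \<in> U" for x y
  proof -
    have "(g (v(0 := y)), g (w(0 := y))) \<in> \<delta>"
      if "tmop g" and vw: "\<forall>i. (v i, w i) \<in> \<theta>" and "(g (v(0 := x)), g (w(0 := x))) \<in> \<delta>"
        and xy: "x \<in> U" "y \<in> U" for g v w x y
      using cent that(1,3)
    proof (rule centralizesD)
      fix i
      show "(v(0 := x)) i = (w(0 := x)) i \<and> (v(0 := y)) i = (w(0 := y)) i \<or>
        (v(0 := x)) i = (v(0 := y)) i \<and> (w(0 := x)) i = (w(0 := y)) i \<and>
        ((v(0 := x)) i, (w(0 := x)) i) \<in> \<theta>"
        using vw by (cases "i = 0") auto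
    qed (use xy \<theta>V[of v w] vw in auto)
    then show ?thesis
      unfolding \<Gamma>_def using xy congruence_refl[OF \<theta>] by blast
  qed
  have comp: "((h v, h w), (h v', h w')) \<in> \<Gamma>"
    if h: "tmop h" and r: "\<And>i. ((v i, w i), (v' i, w' i)) \<in> \<Gamma>" for h v w v' w'
  proof -
    have r\<theta>: "(v i, w i) \<in> \<theta>" "(v' i, w' i) \<in> \<theta>" for i using \<Gamma>\<theta>[OF r] .
    have inV: "v \<in> V" "w \<in> V" "v' \<in> V" "w' \<in> V" using \<theta>V r\<theta> by blast+
    obtain n where n: "\<And>v w. v \<in> V \<Longrightarrow> w \<in> V \<Longrightarrow> (\<And>i. i < n \<Longrightarrow> v i = w i) \<Longrightarrow> h v = h w"
      using tmop_finite_support[OF h] by blast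
    \<comment> \<open>Hybrids exchange one variable at a time; as h depends on finitely many
      variables, finitely many exchanges suffice.\<close>
    define hv where "hv k i = (if i < k then v' i else v i)" for k i
    define hw where "hw k i = (if i < k then w' i else w i)" for k i
    have h\<theta>: "(hv k i, hw k i) \<in> \<theta>" for k i using r\<theta> by (simp add: hv_def hw_def)
    have hV: "hv k \<in> V" "hw k \<in> V" for k using inV by (auto simp: hv_def hw_def)
    have "((h v, h w), (h (hv k), h (hw k))) \<in> \<Gamma>" for k
    proof (induction k)
      case 0
      have "hv 0 = v" "hw 0 = w" by (auto simp: hv_def hw_def)
      then show ?case
        using refl[OF tmop_congruence[OF \<theta> h inV(1,2) r\<theta>(1)]] by simp
    next
      case (Suc k)
      have "((h (hv k), h (hw k)), (h (hv (Suc k)), h (hw (Suc k)))) \<in> \<Gamma>"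
        unfolding \<Gamma>_def
      proof (clarsimp, intro conjI allI impI)
        fix g and x y :: "nat \<Rightarrow> 'a"
        assume g: "tmop g" and xy: "\<forall>i. (x i, y i) \<in> \<theta>"
        \<comment> \<open>The polynomials g and h are merged into one whose moving variable is again
          number 0: the parameters of h sit at odd positions, those of g at even ones. Position 0 is
          free for this since g receives h there.\<close>
        define G where "G z = g (\<lambda>l. if l = 0 then h (\<lambda>i. if i = k then z 0 else z (2 * i + 1)) else z (2 * l))"
          for z :: "nat \<Rightarrow> 'a"
        have "tmop (\<lambda>z. h (\<lambda>i. if i = k then z 0 else z (2 * i + 1)))"
        proof -
          have "tmop (\<lambda>z. h (\<lambda>i. z (if i = k then 0 else 2 * i + 1)))"
            by (rule tmop_comp[OF h tmop_var])
          moreover have "(\<lambda>i. z (if i = k then 0 else 2 * i + 1)) = (\<lambda>i. if i = k then z 0 else z (2 * i + 1))"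
            for z :: "nat \<Rightarrow> 'a" by auto
          ultimately show ?thesis by simp
        qed
        then have "tmop (\<lambda>z. g (\<lambda>l. (if l = 0 then (\<lambda>z. h (\<lambda>i. if i = k then z 0 else z (2 * i + 1)))
            else (\<lambda>z. z (2 * l))) z))"
          by (intro tmop_comp[OF g]) (simp add: tmop_var)
        then have G: "tmop G" unfolding G_def by (rule tmop_cong) (auto intro!: arg_cong[where f = g])
        define mrg where "mrg a b j = (if odd j then a (j div 2) else b (j div 2))"
          for a b :: "nat \<Rightarrow> 'a" and j :: nat
        have GE: "G ((mrg a b)(0 := c)) = g (b(0 := h (a(k := c))))" for a b c
        proof -
          have 1: "((mrg a b)(0 := c)) 0 = c" "((mrg a b)(0 := c)) (2 * i + 1) = a i" for i
            by (auto simp: mrg_def)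
          have 2: "((mrg a b)(0 := c)) (2 * l) = b l" if "l \<noteq> 0" for l
            using that by (auto simp: mrg_def)
          show ?thesis
            unfolding G_def 1 fun_upd_def[of a] fun_upd_def[of b]
            by (intro arg_cong[where f = g] ext) (metis 2)
        qed
        have *: "hv (Suc k) = (hv k)(k := v' k)" "hw (Suc k) = (hw k)(k := w' k)"
          "hv k = (hv k)(k := v k)" "hw k = (hw k)(k := w k)"
          by (auto simp: hv_def hw_def fun_eq_iff)
        have "(mrg (hv k) x i, mrg (hw k) y i) \<in> \<theta>" for i
          using h\<theta> xy by (simp add: mrg_def)
        then have "(G ((mrg (hv k) x)(0 := v k)), G ((mrg (hw k) y)(0 := w k))) \<in> \<delta> \<longleftrightarrow>
            (G ((mrg (hv k) x)(0 := v' k)), G ((mrg (hw k) y)(0 := w' k))) \<in> \<delta>"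
          by (rule \<Gamma>D[OF r G])
        then
        show "((g (x(0 := h (hv k))), g (y(0 := h (hw k)))) \<in> \<delta>) =
          ((g (x(0 := h (hv (Suc k)))), g (y(0 := h (hw (Suc k))))) \<in> \<delta>)"
          unfolding GE *(1,2) *(3,4)[symmetric] .
      qed (use tmop_congruence[OF \<theta> h hV(1) hV(2) h\<theta>] in blast)+
      with Suc show ?case by (rule trans)
    qed
    from this[of n] show ?thesis
      using n[OF hV(1) inV(3), of n] n[OF hV(2) inV(4), of n] by (simp add: hv_def hw_def)
  qed
  define B :: "('f, 'a \<times> 'a) algebra" where
    "B = \<lparr>universe = \<theta>, oper = (\<lambda>f ps. (oper A f (map fst ps), oper A f (map snd ps)))\<rparr>"
  have UB: "universe B = \<theta>" by (simp add: B_def)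
  have opB: "oper B f ps = (oper A f (map fst ps), oper A f (map snd ps))" for f ps
    by (simp add: B_def)
  have tup: "map fst ps \<in> tuples U n" "map snd ps \<in> tuples U n"
    "list_all2 (\<lambda>x y. (x, y) \<in> \<theta>) (map fst ps) (map snd ps)" if "ps \<in> tuples \<theta> n" for ps n
    using that sub by (auto simp: tuples_def list.rel_map intro!: list.rel_refl_strong)
  have algB: "is_algebra \<Sigma> B"
  proof -
    obtain x where "x \<in> U" using alg by (auto simp: is_algebra_def)
    then have "(x, x) \<in> \<theta>" using congruence_refl[OF \<theta>] by blast
    moreover have "oper B f ps \<in> \<theta>" if "\<Sigma> f = Some n" "ps \<in> tuples \<theta> n" for f n ps
      using \<theta> that tup[OF that(2)] by (auto simp: congruences_def opB)
    ultimately show ?thesis by (auto simp: is_algebra_def UB)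
  qed
  have "in_variety \<Sigma> E B"
  proof (rule in_variety_subdirect[OF A _ algB, where \<pi> = "\<lambda>b. if b then fst else snd" and I = UNIV])
    show "E \<subseteq> identities \<Sigma>" using cm by (simp add: congruence_modular_variety_def)
    fix p q :: "'a \<times> 'a" assume "\<And>b. b \<in> UNIV \<Longrightarrow> (if b then fst else snd) p = (if b then fst else snd) q"
    from this[of True] this[of False] show "p = q" by (simp add: prod_eq_iff)
  qed (use sub in \<open>auto simp: UB opB\<close>)
  from congruence_modular_varietyD[OF cm this] have modB: "congruence_modular \<Sigma> B" .
  have list_split: "list_all2 (\<lambda>p q. (fst p, fst q) \<in> \<rho> \<and> (snd p, snd q) \<in> \<sigma>) ps qs \<Longrightarrow>
     list_all2 (\<lambda>x y. (x, y) \<in> \<rho>) (map fst ps) (map fst qs) \<and>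
     list_all2 (\<lambda>x y. (x, y) \<in> \<sigma>) (map snd ps) (map snd qs)" for \<rho> \<sigma> ps qs
    by (auto simp: list.rel_map elim!: list_all2_mono)
  define prj where "prj \<rho> \<sigma> = {(p, q). p \<in> \<theta> \<and> q \<in> \<theta> \<and> (fst p, fst q) \<in> \<rho> \<and> (snd p, snd q) \<in> \<sigma>}"
    for \<rho> \<sigma>
  have prj: "prj \<rho> \<sigma> \<in> congruences \<Sigma> B" if \<rho>: "\<rho> \<in> Con" and \<sigma>: "\<sigma> \<in> Con" for \<rho> \<sigma>
  proof (rule congruenceI)
    fix f n ps qs
    assume f: "\<Sigma> f = Some n" and ps: "ps \<in> tuples (universe B) n"
      and qs: "qs \<in> tuples (universe B) n" and r: "list_all2 (\<lambda>p q. (p, q) \<in> prj \<rho> \<sigma>) ps qs"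
    have "list_all2 (\<lambda>p q. (fst p, fst q) \<in> \<rho> \<and> (snd p, snd q) \<in> \<sigma>) ps qs"
      by (rule list_all2_mono[OF r]) (auto simp: prj_def)
    from list_split[OF this] show "(oper B f ps, oper B f qs) \<in> prj \<rho> \<sigma>"
      using algB f ps qs \<rho> \<sigma> tup[OF ps[unfolded UB]] tup[OF qs[unfolded UB]]
      by (auto simp: prj_def opB is_algebra_def UB congruences_def)
  next
    show "prj \<rho> \<sigma> \<subseteq> universe B \<times> universe B" by (auto simp: prj_def UB)
    show "(p, p) \<in> prj \<rho> \<sigma>" if "p \<in> universe B" for p
      using that sub congruence_refl[OF \<rho>] congruence_refl[OF \<sigma>] by (auto simp: prj_def UB)
    show "(q, p) \<in> prj \<rho> \<sigma>" if "(p, q) \<in> prj \<rho> \<sigma>" for p q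
      using that congruence_sym[OF \<rho>] congruence_sym[OF \<sigma>] by (simp add: prj_def)
    show "(p, r) \<in> prj \<rho> \<sigma>" if "(p, q) \<in> prj \<rho> \<sigma>" "(q, r) \<in> prj \<rho> \<sigma>" for p q r
      using that congruence_trans[OF \<rho>, of "fst p" "fst q" "fst r"]
        congruence_trans[OF \<sigma>, of "snd p" "snd q" "snd r"] by (simp add: prj_def)
  qed
  define \<eta>1 where "\<eta>1 = prj \<delta> (total_rel A)"
  define \<eta>2 where "\<eta>2 = prj (total_rel A) \<delta>"
  have \<Gamma>B: "\<Gamma> \<in> congruences \<Sigma> B"
  proof (rule congruenceI)
    fix f n ps qs
    assume f: "\<Sigma> f = Some n" and ps: "ps \<in> tuples (universe B) n"
      and qs: "qs \<in> tuples (universe B) n" and r: "list_all2 (\<lambda>p q. (p, q) \<in> \<Gamma>) ps qs"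
    obtain x where x: "x \<in> U" using alg by (auto simp: is_algebra_def)
    define ex where "ex ps i = (if i < n then ps ! i else (x, x))" for ps i
    have "((fst (ex ps i), snd (ex ps i)), (fst (ex qs i), snd (ex qs i))) \<in> \<Gamma>" for i
      using r ps diag[OF x x] by (auto simp: ex_def tuples_def list_all2_conv_all_nth)
    from comp[OF tmop_oper[OF f] this]
    have "((oper A f (map (\<lambda>i. fst (ex ps i)) [0..<n]), oper A f (map (\<lambda>i. snd (ex ps i)) [0..<n])),
       (oper A f (map (\<lambda>i. fst (ex qs i)) [0..<n]), oper A f (map (\<lambda>i. snd (ex qs i)) [0..<n]))) \<in> \<Gamma>" .
    moreover have "map (\<lambda>i. fst (ex ps i)) [0..<n] = map fst ps" "map (\<lambda>i. snd (ex ps i)) [0..<n] = map snd ps"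
      if "ps \<in> tuples (universe B) n" for ps
      using that by (auto simp: ex_def tuples_def intro!: nth_equalityI)
    ultimately show "(oper B f ps, oper B f qs) \<in> \<Gamma>"
      using ps qs by (simp add: opB)
  next
    show "\<Gamma> \<subseteq> universe B \<times> universe B" by (auto simp: \<Gamma>_def UB)
    show "(p, p) \<in> \<Gamma>" if "p \<in> universe B" for p
      using that refl[of "fst p" "snd p"] by (simp add: UB)
  qed (fact sym, fact trans)
  have \<eta>: "\<eta>1 \<in> congruences \<Sigma> B" "\<eta>2 \<in> congruences \<Sigma> B"
    unfolding \<eta>1_def \<eta>2_def by (intro prj \<delta> total_rel_congruence[OF alg])+
  have \<delta>\<delta>: "\<eta>1 \<inter> \<eta>2 \<subseteq> \<Gamma>"
  proof clarify
    fix a b c d assume "((a, b), (c, d)) \<in> \<eta>1" "((a, b), (c, d)) \<in> \<eta>2"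
    then have *: "(a, b) \<in> \<theta>" "(c, d) \<in> \<theta>" "(a, c) \<in> \<delta>" "(b, d) \<in> \<delta>"
      by (auto simp: \<eta>1_def \<eta>2_def prj_def)
    have "(g (v(0 := a)), g (v(0 := c))) \<in> \<delta>" "(g (w(0 := b)), g (w(0 := d))) \<in> \<delta>"
      if "tmop g" "\<forall>i. (v i, w i) \<in> \<theta>" for g v w
    proof -
      have "a \<in> U" "b \<in> U" "c \<in> U" "d \<in> U" using * sub by auto
      moreover have "v i \<in> U" "w i \<in> U" for i using that(2) sub by auto
      ultimately show "(g (v(0 := a)), g (v(0 := c))) \<in> \<delta>" "(g (w(0 := b)), g (w(0 := d))) \<in> \<delta>"
        using * congruence_refl[OF \<delta>] by (auto intro!: tmop_congruence[OF \<delta> that(1)])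
    qed
    then have "(g (v(0 := a)), g (w(0 := b))) \<in> \<delta> \<longleftrightarrow> (g (v(0 := c)), g (w(0 := d))) \<in> \<delta>"
      if "tmop g" "\<forall>i. (v i, w i) \<in> \<theta>" for g v w
      using that congruence_cong_iff[OF \<delta>] by blast
    then show "((a, b), (c, d)) \<in> \<Gamma>"
      unfolding \<Gamma>_def using *(1,2) by simp
  qed
  have shift: "(a, c) \<in> \<delta>" if abcd: "((a, b), (c, d)) \<in> \<Gamma>" and bd: "(b, d) \<in> \<delta>" for a b c d
  proof -
    note ab = \<Gamma>\<theta>(1)[OF abcd] and cd = \<Gamma>\<theta>(2)[OF abcd]
    have mem: "a \<in> U" "b \<in> U" "c \<in> U" "d \<in> U" using ab cd sub by auto
    have ac: "(a, c) \<in> \<theta>"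
      using ab cd bd le congruence_trans[OF \<theta>] congruence_sym[OF \<theta>] by blast
    have cc: "(c, c) \<in> \<theta>" using congruence_refl[OF \<theta> mem(3)] .
    have e: "((a, c), (a, b)) \<in> \<eta>1" "((c, d), (c, c)) \<in> \<eta>1" "((a, c), (c, c)) \<in> \<eta>2"
      "((a, b), (c, d)) \<in> \<Gamma> \<inter> \<eta>2"
      using ab cd ac cc bd abcd mem congruence_refl[OF \<delta>]
      by (auto simp: \<eta>1_def \<eta>2_def prj_def total_rel_def)
    have I: "\<Gamma> \<inter> \<eta>2 \<in> congruences \<Sigma> B" "\<eta>1 \<inter> \<eta>2 \<in> congruences \<Sigma> B"
      using \<Gamma>B \<eta> by (auto intro: congruence_Int)
    let ?J = "con_join \<Sigma> B (\<Gamma> \<inter> \<eta>2) \<eta>1"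
    have J: "?J \<in> congruences \<Sigma> B" "\<Gamma> \<inter> \<eta>2 \<subseteq> ?J" "\<eta>1 \<subseteq> ?J"
      using con_join_least[OF algB I(1) \<eta>(1)] by auto
    \<comment> \<open>The path goes from (a, c) by \<eta>1 to (a, b), by \<Gamma> \<inter> \<eta>2
      to (c, d), and by \<eta>1 to (c, c).\<close>
    have "((a, c), (c, c)) \<in> ?J \<inter> \<eta>2"
      using e J(2,3) congruence_trans[OF J(1)] by (meson IntI subsetD)
    also have "?J \<inter> \<eta>2 = con_join \<Sigma> B (\<Gamma> \<inter> \<eta>2) (\<eta>1 \<inter> \<eta>2)"
      using modB[unfolded congruence_modular_def, rule_format, OF I(1) \<eta>] by simp
    also have "\<dots> \<subseteq> \<Gamma>"
      using con_join_least(4)[OF algB I \<Gamma>B] \<delta>\<delta> by blast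
    finally have "((a, c), (c, c)) \<in> \<Gamma>" .
    \<comment> \<open>With the identity polynomial, saturation carries (c, c) \<in> \<delta> back to
      (a, c).\<close>
    from \<Gamma>D[OF this tmop_var[of 0], of "\<lambda>_. c" "\<lambda>_. c"] cc
    show ?thesis using congruence_refl[OF \<delta> mem(3)] by simp
  qed
  show ?thesis using that diag refl trans comp shift by blast
qed

text \<open>Induction along the Day terms keeps D x y y congruent to m i (y, y, x, x) modulo the
  next member of the series. The start is the third projection, as m 0 yields y; at the end m N
  yields x. Steps valid for v 0 = v 1, v 2 = v 3 apply to (y, y, x, x) directly; the others require
  a new D. The same D has to serve all k at once.\<close>

lemma difference_term:
  assumes cm: "congruence_modular_variety \<Sigma> E" and A: "in_variety \<Sigma> E A"
  obtains D where "tmop (\<lambda>v. D (v 0) (v 1) (v 2))"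
    and "\<And>x z. x \<in> U \<Longrightarrow> z \<in> U \<Longrightarrow> D x x z = z"
    and "\<And>k x y. (x, y) \<in> L k \<Longrightarrow> (D x y y, x) \<in> L (Suc k)"
proof -
  obtain N m where m: "\<And>i. tmop (m i)"
    and m0: "\<And>v. v \<in> V \<Longrightarrow> m 0 v = v 0" and mN: "\<And>v. v \<in> V \<Longrightarrow> m N v = v 3"
    and m\<beta>: "\<And>i v. v \<in> V \<Longrightarrow> v 0 = v 3 \<Longrightarrow> v 1 = v 2 \<Longrightarrow> m i v = v 0"
    and step: "\<And>i. i < N \<Longrightarrow> (\<forall>v\<in>V. v 1 = v 2 \<longrightarrow> m i v = m (Suc i) v) \<or>
           (\<forall>v\<in>V. v 0 = v 1 \<longrightarrow> v 2 = v 3 \<longrightarrow> m i v = m (Suc i) v)"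
    by (fact day_terms[OF cm A])
  define M where "M i a b c d = m i (asg a b c d)" for i a b c d
  have tmM: "tmop (\<lambda>v. M i (a v) (b v) (c v) (d v))" if "tmop a" "tmop b" "tmop c" "tmop d" for i a b c d
    unfolding M_def by (rule tmop_asg[OF m that])
  have MU: "M i a b c d \<in> U" if "a \<in> U" "b \<in> U" "c \<in> U" "d \<in> U" for i a b c d
    unfolding M_def by (rule tmop_closed[OF m asg_V[OF that]])
  have M\<beta>: "M i a b b a = a" if "a \<in> U" "b \<in> U" for i a b
    unfolding M_def using m\<beta>[OF asg_V[of a b b a]] that by simp
  have "\<exists>D. tmop (\<lambda>v. D (v 0) (v 1) (v 2)) \<and> (\<forall>x\<in>U. \<forall>z\<in>U. D x x z = z) \<and>
      (\<forall>k x y. (x, y) \<in> L k \<longrightarrow> (D x y y, M i y y x x) \<in> L (Suc k))" if "i \<le> N" for i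
    using that
  proof (induction i)
    case 0
    have "(y, M 0 y y x x) \<in> L (Suc k)" if "(x, y) \<in> L k" for x y k
    proof -
      have "x \<in> U" "y \<in> U" using that congruence_subset[OF L_congruence] by auto
      then have "M 0 y y x x = y" using m0[OF asg_V[of y y x x]] by (simp add: M_def)
      then show ?thesis using congruence_refl[OF L_congruence \<open>y \<in> U\<close>] by metis
    qed
    then show ?case by (intro exI[of _ "\<lambda>x y z. z"]) (auto simp: tmop_var)
  next
    case (Suc i)
    then obtain D where D: "tmop (\<lambda>v. D (v 0) (v 1) (v 2))" "\<And>x z. x \<in> U \<Longrightarrow> z \<in> U \<Longrightarrow> D x x z = z"
      and Dm: "\<And>k x y. (x, y) \<in> L k \<Longrightarrow> (D x y y, M i y y x x) \<in> L (Suc k)"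
      using Suc_leD by blast
    have DU: "D x y z \<in> U" if "x \<in> U" "y \<in> U" "z \<in> U" for x y z
      using tmop_closed[OF D(1) asg_V[OF that that(3)]] by simp
    have "i < N" using Suc.prems by simp
    from step[OF this] show ?case
    proof
      assume "\<forall>v\<in>V. v 0 = v 1 \<longrightarrow> v 2 = v 3 \<longrightarrow> m i v = m (Suc i) v"
      then have "M i y y x x = M (Suc i) y y x x" if "x \<in> U" "y \<in> U" for x y
        using asg_V[OF that(2,2,1,1)] unfolding M_def by fastforce
      then have "(D x y y, M (Suc i) y y x x) \<in> L (Suc k)" if "(x, y) \<in> L k" for k x y
        using Dm[OF that] that congruence_subset[OF L_congruence, of k] by (metis SigmaD1 SigmaD2 subsetD)
      then show ?thesis using D by blast
    next
      assume "\<forall>v\<in>V. v 1 = v 2 \<longrightarrow> m i v = m (Suc i) v"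
      then have \<gamma>: "M i y x x z = M (Suc i) y x x z" if "x \<in> U" "y \<in> U" "z \<in> U" for x y z
        using asg_V[OF that(2,1,1,3)] unfolding M_def by fastforce
      \<comment> \<open>Both corrections have the form m(q, ., ., q), which collapses to q when the
        middle arguments agree. Hence D x x z = z survives, and comparing each correction with its
        collapsed form leads to the values of m i, respectively m (Suc i), at (y, y, x, x).\<close>
      define D' where "D' x y z = M i (D x y z) x y (D x y z)" for x y z
      define D'' where "D'' x y z = M (Suc i) (D' x y z) y x (D' x y z)" for x y z
      have "tmop (\<lambda>v. D'' (v 0) (v 1) (v 2))"
        unfolding D''_def D'_def by (intro tmM D(1) tmop_var)
      moreover have "D'' x x z = z" if "x \<in> U" "z \<in> U" for x z
        using D(2)[OF that] M\<beta>[OF that(2,1)] by (simp add: D''_def D'_def)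
      moreover have "(D'' x y y, M (Suc i) y y x x) \<in> L (Suc k)" if xy: "(x, y) \<in> L k" for k x y
      proof -
        obtain \<Gamma> where diag: "\<And>x y. x \<in> U \<Longrightarrow> y \<in> U \<Longrightarrow> ((x, x), (y, y)) \<in> \<Gamma>"
          and refl: "\<And>x y. (x, y) \<in> L k \<Longrightarrow> ((x, y), (x, y)) \<in> \<Gamma>"
          and trans: "\<And>p q r. (p, q) \<in> \<Gamma> \<Longrightarrow> (q, r) \<in> \<Gamma> \<Longrightarrow> (p, r) \<in> \<Gamma>"
          and comp: "\<And>h v w v' w'. tmop h \<Longrightarrow> (\<And>i. ((v i, w i), (v' i, w' i)) \<in> \<Gamma>) \<Longrightarrow>
              ((h v, h w), (h v', h w')) \<in> \<Gamma>"
          and shift: "\<And>a b c d. ((a, b), (c, d)) \<in> \<Gamma> \<Longrightarrow> (b, d) \<in> L (Suc k) \<Longrightarrow> (a, c) \<in> L (Suc k)"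
          by (fact difference_congruence[OF cm A L_congruence L_congruence L_Suc_le L_central])
        have MM: "((M i a b c d, M i a' b' c' d'), (M i e f g h, M i e' f' g' h')) \<in> \<Gamma>"
          if "((a, a'), (e, e')) \<in> \<Gamma>" "((b, b'), (f, f')) \<in> \<Gamma>" "((c, c'), (g, g')) \<in> \<Gamma>" "((d, d'), (h, h')) \<in> \<Gamma>"
          for i a b c d e f g h a' b' c' d' e' f' g' h'
          unfolding M_def by (rule comp[OF m]) (use that in \<open>simp add: asg_def\<close>)
        have U: "x \<in> U" "y \<in> U" using xy congruence_subset[OF L_congruence] by auto
        note yx = congruence_sym[OF L_congruence xy]
        let ?q = "D x y y" let ?q' = "D' x y y"
        have qU: "?q \<in> U" "?q' \<in> U" using DU MU U by (auto simp: D'_def)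
        \<comment> \<open>Under \<Gamma> any equal pair may be traded for another equal pair while
          (x, y) is kept. The second components start at q and end at m i (y, y, x, x), which are
          congruent by induction, so \<open>shift\<close> relates the first components.\<close>
        have "((M i ?q x y ?q, M i ?q y y ?q), (M i y x y x, M i y y y x)) \<in> \<Gamma>"
          by (intro MM diag refl xy U qU)
        moreover have "((M i y x y x, M i y y y x), (M i y x x x, M i y y x x)) \<in> \<Gamma>"
          by (intro MM diag refl xy U qU)
        ultimately have "((M i ?q x y ?q, M i ?q y y ?q), (M i y x x x, M i y y x x)) \<in> \<Gamma>"
          by (rule trans)
        then have "(?q', M (Suc i) y x x x) \<in> L (Suc k)"
          using shift Dm[OF xy] M\<beta>[OF qU(1) U(2)] \<gamma>[OF U(1,2,1)] unfolding D'_def by metis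
        moreover have "((M (Suc i) ?q' y x ?q', M (Suc i) ?q' x x ?q'),
            (M (Suc i) y y x x, M (Suc i) y x x x)) \<in> \<Gamma>"
          by (intro MM diag refl yx U qU)
        ultimately show ?thesis
          using shift M\<beta>[OF qU(2) U(1)] unfolding D''_def by metis
      qed
      ultimately show ?thesis by blast
    qed
  qed
  from this[OF order.refl] obtain D where D: "tmop (\<lambda>v. D (v 0) (v 1) (v 2))"
    "\<And>x z. x \<in> U \<Longrightarrow> z \<in> U \<Longrightarrow> D x x z = z"
    "\<And>k x y. (x, y) \<in> L k \<Longrightarrow> (D x y y, M N y y x x) \<in> L (Suc k)" by blast
  have "M N y y x x = x" if "x \<in> U" "y \<in> U" for x y
    using mN[OF asg_V[OF that(2,2,1,1)]] by (simp add: M_def)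
  then have "(D x y y, x) \<in> L (Suc k)" if "(x, y) \<in> L k" for k x y
    using D(3)[OF that] that congruence_subset[OF L_congruence, of k] by (metis SigmaD1 SigmaD2 subsetD)
  then show ?thesis using that D by blast
qed

text \<open>The difference term satisfies D x y y = x only modulo the next member of the series. By
  nilpotency this still makes D(-, y, y) injective, hence a permutation of the finite universe, and
  iterating it up to its period repairs the identity.\<close>

lemma malcev_term:
  assumes cm: "congruence_modular_variety \<Sigma> E" and A: "in_variety \<Sigma> E A" and nil: "nilpotent \<Sigma> A"
  obtains d where "tmop (\<lambda>v. d (v 0) (v 1) (v 2))"
    and "\<And>x y. x \<in> U \<Longrightarrow> y \<in> U \<Longrightarrow> d x x y = y"
    and "\<And>x y. x \<in> U \<Longrightarrow> y \<in> U \<Longrightarrow> d x y y = x"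
proof -
  obtain D where D: "tmop (\<lambda>v. D (v 0) (v 1) (v 2))"
    and D1: "\<And>x z. x \<in> U \<Longrightarrow> z \<in> U \<Longrightarrow> D x x z = z"
    and D2: "\<And>k x y. (x, y) \<in> L k \<Longrightarrow> (D x y y, x) \<in> L (Suc k)"
    by (fact difference_term[OF cm A])
  have DU: "D x y z \<in> U" if "x \<in> U" "y \<in> U" "z \<in> U" for x y z
    using tmop_closed[OF D asg_V[OF that that(3)]] by simp
  have inj: "inj_on (\<lambda>x. D x y y) U" if y: "y \<in> U" for y
  proof (rule inj_onI)
    fix x x' assume x: "x \<in> U" "x' \<in> U" and eq: "D x y y = D x' y y"
    have "(x', x) \<in> L k" for k
    proof (induction k)
      case 0
      then show ?case using x by (simp add: total_rel_def)
    next
      case (Suc k)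
      have "(D x' y y, D x y y) \<in> L (Suc k)"
        using eq DU[OF x(1) y y] congruence_refl[OF L_congruence] by metis
      \<comment> \<open>The term condition replaces both y by x in D x' y y = D x y y. Then D x' x x
        is congruent to x' by the weak identity, and D x x x equals x.\<close>
      have "(D (asg x' x x x 0) (asg x' x x x 1) (asg x' x x x 2),
          D (asg x x x x 0) (asg x x x x 1) (asg x x x x 2)) \<in> L (Suc k)"
        using L_central D
      proof (rule centralizesD[where u = "asg x' y y y" and u' = "asg x y y y"])
        fix i
        show "asg x' y y y i = asg x y y y i \<and> asg x' x x x i = asg x x x x i \<or>
          asg x' y y y i = asg x' x x x i \<and> asg x y y y i = asg x x x x i \<and>
          (asg x' y y y i, asg x y y y i) \<in> L k"
          using Suc by (auto simp: asg_def)
      qed (use x y \<open>(D x' y y, D x y y) \<in> L (Suc k)\<close> in \<open>auto simp: asg_def\<close>)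
      then have "(D x' x x, D x x x) \<in> L (Suc k)" by simp
      then show ?case
        using D2[OF Suc] D1[OF x(1,1)] congruence_trans[OF L_congruence] congruence_sym[OF L_congruence]
        by metis
    qed
    moreover obtain k where "L k = equality_rel A"
      using nil by (auto simp: nilpotent_def k_nilpotent_def)
    ultimately have "(x', x) \<in> Id_on U" by (metis equality_rel_def)
    then show "x = x'" by auto
  qed
  obtain N where N: "\<And>y x. y \<in> U \<Longrightarrow> x \<in> U \<Longrightarrow> ((\<lambda>x. D x y y) ^^ Suc N) x = x"
    using injective_family_period[OF fin fin, of "\<lambda>y x. D x y y"] inj DU by metis
  \<comment> \<open>When y = z, the inner D is already one application of D(-, z, z), so N further
    ones complete the period \<open>Suc N\<close>.\<close>
  define d where "d x y z = ((\<lambda>x. D x z z) ^^ N) (D x y z)" for x y z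
  have "tmop (\<lambda>v. ((\<lambda>x. D x (v 2) (v 2)) ^^ n) (D (v 0) (v 1) (v 2)))" for n
  proof (induction n)
    case (Suc n)
    from tmop3_comp[OF D Suc tmop_var tmop_var, of 2 2] show ?case by simp
  qed (use D in simp)
  then have "tmop (\<lambda>v. d (v 0) (v 1) (v 2))" by (simp add: d_def)
  moreover have "d x x y = y" if "x \<in> U" "y \<in> U" for x y
  proof -
    have "((\<lambda>x. D x y y) ^^ n) y = y" for n by (induction n) (auto simp: D1 that)
    then show ?thesis using D1[OF that] by (simp add: d_def)
  qed
  moreover have "d x y y = x" if "x \<in> U" "y \<in> U" for x y
    using N[OF that(2,1)] by (simp add: d_def funpow_Suc_right del: funpow.simps)
  ultimately show ?thesis using that by blast
qed

end

section \<open>Central congruences and their difference groups\<close>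

text \<open>A maximal proper subgroup M of a finite abelian p-group has index p. The character is
  the exponent of a fixed g outside M in the coset of x, which avoids forming the quotient
  group.\<close>

lemma finite_p_group_character:
  fixes G (structure) and p r :: nat
  assumes G: "comm_group G" and fin: "finite (carrier G)" and p: "prime p"
    and ord: "order G dvd p ^ r" and x0: "x0 \<in> carrier G" "x0 \<noteq> \<one>"
  obtains g and \<chi> :: "'g \<Rightarrow> int" where "g \<in> carrier G" "\<not> [\<chi> g = 0] (mod int p)"
    and "\<And>x y. x \<in> carrier G \<Longrightarrow> y \<in> carrier G \<Longrightarrow> [\<chi> (x \<otimes> y) = \<chi> x + \<chi> y] (mod int p)"
proof -
  interpret comm_group G by fact
  let ?S = "{H. subgroup H G \<and> H \<noteq> carrier G}"
  have "finite ?S"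
    by (rule finite_subset[of _ "Pow (carrier G)"]) (use fin subgroup.subset in auto)
  moreover have "{\<one>} \<in> ?S" using x0 triv_subgroup by auto
  ultimately obtain M where M: "subgroup M G" "M \<noteq> carrier G"
    and max: "\<And>H. subgroup H G \<Longrightarrow> H \<noteq> carrier G \<Longrightarrow> M \<subseteq> H \<Longrightarrow> M = H"
    using finite_has_maximal[of ?S] by blast
  have Mc: "x \<in> carrier G" if "x \<in> M" for x using subgroup.subset[OF M(1)] that by auto
  obtain g where g: "g \<in> carrier G" "g \<notin> M" using M(2) Mc by blast
  \<comment> \<open>The subgroup generated by M and h; by maximality it is everything once h is
    outside M.\<close>
  define K where "K h = {m \<otimes> h [^] i | m (i :: int). m \<in> M}" for h
  have K: "K h = carrier G" if h: "h \<in> carrier G" "h \<notin> M" for h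
  proof (rule ccontr)
    assume ne: "K h \<noteq> carrier G"
    have "subgroup (K h) G"
    proof (rule subgroupI)
      show "K h \<subseteq> carrier G" using Mc h by (auto simp: K_def)
      show "K h \<noteq> {}" using subgroup.one_closed[OF M(1)] by (auto simp: K_def)
      fix a assume "a \<in> K h"
      then obtain m i where a: "a = m \<otimes> h [^] (i :: int)" "m \<in> M" by (auto simp: K_def)
      have "inv a = inv m \<otimes> h [^] (- i)"
        using a Mc h by (simp add: inv_mult int_pow_neg)
      then show "inv a \<in> K h" using subgroup.m_inv_closed[OF M(1) a(2)] by (auto simp: K_def)
      fix b assume "b \<in> K h"
      then obtain n j where b: "b = n \<otimes> h [^] (j :: int)" "n \<in> M" by (auto simp: K_def)
      have "a \<otimes> b = (m \<otimes> n) \<otimes> h [^] (i + j)"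
        using a b Mc h by (simp add: int_pow_mult m_ac)
      then show "a \<otimes> b \<in> K h" using subgroup.m_closed[OF M(1) a(2) b(2)] by (auto simp: K_def)
    qed
    moreover have "m \<in> K h" if "m \<in> M" for m
      unfolding K_def using Mc that by (auto intro!: exI[of _ m] exI[of _ "0 :: int"])
    moreover have "h \<in> K h"
      unfolding K_def using subgroup.one_closed[OF M(1)] h
      by (auto intro!: exI[of _ \<one>] exI[of _ "1 :: int"])
    ultimately show False using max[of "K h"] ne h(2) by blast
  qed
  have M_pow: "x [^] (i :: int) \<in> M" if "x \<in> M" for x i
    using subgroup_int_pow_closed[OF M(1) that] .
  have not_coprime: False if ij: "g [^] (i :: int) \<in> M" "g [^] (j :: int) \<in> M" "coprime i j" for i j
  proof -
    obtain a b where ab: "a * i + b * j = 1" using ij(3) by (metis bezout_int coprime_imp_gcd_eq_1)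
    have "g = g [^] (i * a + j * b)" using ab g by (simp add: mult.commute)
    also have "\<dots> = (g [^] i) [^] a \<otimes> (g [^] j) [^] b" using g by (simp add: int_pow_mult int_pow_pow)
    also have "\<dots> \<in> M" by (intro subgroup.m_closed[OF M(1)] M_pow ij(1,2))
    finally show False using g by blast
  qed
  have pow_p: "g [^] (int p ^ r) \<in> M"
  proof -
    obtain k where k: "p ^ r = order G * k" using ord by blast
    have "g [^] (int p ^ r) = (g [^] order G) [^] k"
      using g k by (metis int_pow_int nat_pow_pow of_nat_power)
    then show ?thesis
      using g fin subgroup.one_closed[OF M(1)] by (simp add: power_order_eq_one order_def)
  qed
  \<comment> \<open>Otherwise M and g^p generate g, which puts some g^(1 - p i) into M. Its exponent
    is coprime to p^r, and g^(p^r) lies in M, so g would too.\<close>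
  have gp: "g [^] int p \<in> M"
  proof (rule ccontr)
    assume "g [^] int p \<notin> M"
    then have "g \<in> K (g [^] int p)" using K[of "g [^] int p"] g by simp
    then obtain m i where m: "m \<in> M" "g = m \<otimes> (g [^] int p) [^] (i :: int)" by (auto simp: K_def)
    have "g [^] (1 - int p * i) = g \<otimes> inv ((g [^] int p) [^] i)"
      using g by (simp add: int_pow_diff int_pow_pow)
    also have "\<dots> = m" using g Mc[OF m(1)] m(2) by (metis int_pow_closed inv_solve_right)
    finally have "g [^] (1 - int p * i) \<in> M" using m(1) by simp
    moreover have "coprime (1 - int p * i) (int p ^ r)"
    proof -
      have "gcd (1 - int p * i) (int p) = 1"
        using gcd_add_mult[of "int p" "- i" 1] by (simp add: algebra_simps gcd.commute)
      then have "coprime (1 - int p * i) (int p)" by (simp only: coprime_iff_gcd_eq_1)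
      then show ?thesis by simp
    qed
    ultimately show False using not_coprime pow_p by blast
  qed
  have dvd: "int p dvd i" if "g [^] (i :: int) \<in> M" for i
    using not_coprime[OF gp that] prime_imp_coprime[of "int p" i] p by auto
  \<comment> \<open>The exponent is determined only modulo p, so additivity can hold only as a
    congruence.\<close>
  define \<chi> where "\<chi> x = (SOME i. \<exists>m\<in>M. x = m \<otimes> g [^] (i :: int))" for x
  have \<chi>: "\<exists>m\<in>M. x = m \<otimes> g [^] \<chi> x" if "x \<in> carrier G" for x
  proof -
    have "x \<in> K g" using K[OF g] that by simp
    then have "\<exists>i. \<exists>m\<in>M. x = m \<otimes> g [^] (i :: int)" unfolding K_def by blast
    then show ?thesis unfolding \<chi>_def by (rule someI_ex)
  qed
  have uniq: "[i = j] (mod int p)"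
    if "m \<in> M" "n \<in> M" and eq: "m \<otimes> g [^] (i :: int) = n \<otimes> g [^] j" for m n i j
  proof -
    have mc: "m \<in> carrier G" "n \<in> carrier G" using that Mc by auto
    have "g [^] (i - j) = g [^] i \<otimes> inv (g [^] j)" using g by (simp add: int_pow_diff)
    also have "\<dots> = inv m \<otimes> (m \<otimes> g [^] i) \<otimes> inv (g [^] j)"
      using g mc by (simp flip: m_assoc)
    also have "\<dots> = inv m \<otimes> n" unfolding eq using g mc by (simp add: m_assoc)
    also have "\<dots> \<in> M" using that subgroup.m_closed[OF M(1)] subgroup.m_inv_closed[OF M(1)] by blast
    finally show ?thesis using dvd by (simp add: cong_iff_dvd_diff)
  qed
  show ?thesis
  proof (rule that[of g \<chi>])
    show "g \<in> carrier G" by fact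
    obtain m where m: "m \<in> M" "g = m \<otimes> g [^] \<chi> g" using \<chi>[OF g(1)] by blast
    have "[\<chi> g = 1] (mod int p)"
      by (rule uniq[OF m(1) subgroup.one_closed[OF M(1)]]) (use m g in simp)
    moreover have "\<not> [1 = 0] (mod int p)"
      using prime_gt_1_nat[OF p] by (simp add: cong_def)
    ultimately show "\<not> [\<chi> g = 0] (mod int p)" using cong_trans cong_sym by blast
    fix x y assume x: "x \<in> carrier G" and y: "y \<in> carrier G"
    obtain m where m: "m \<in> M" "x = m \<otimes> g [^] \<chi> x" using \<chi>[OF x] by blast
    obtain n where n: "n \<in> M" "y = n \<otimes> g [^] \<chi> y" using \<chi>[OF y] by blast
    obtain k where k: "k \<in> M" "x \<otimes> y = k \<otimes> g [^] \<chi> (x \<otimes> y)" using \<chi>[of "x \<otimes> y"] x y by auto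
    have "x \<otimes> y = (m \<otimes> g [^] \<chi> x) \<otimes> (n \<otimes> g [^] \<chi> y)" using m n by simp
    also have "\<dots> = (m \<otimes> n) \<otimes> g [^] (\<chi> x + \<chi> y)"
      using Mc[OF m(1)] Mc[OF n(1)] g by (simp add: int_pow_mult m_ac)
    finally have "k \<otimes> g [^] \<chi> (x \<otimes> y) = (m \<otimes> n) \<otimes> g [^] (\<chi> x + \<chi> y)" using k by simp
    then show "[\<chi> (x \<otimes> y) = \<chi> x + \<chi> y] (mod int p)"
      by (rule uniq[OF k(1) subgroup.m_closed[OF M(1) m(1) n(1)]])
  qed
qed

text \<open>Quotients are replaced by chosen representatives: the choice depends on the class alone,
  so a function of classes stays a function on the universe.\<close>

definition class_rep :: "('a \<times> 'a) set \<Rightarrow> 'a \<Rightarrow> 'a" where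
  "class_rep \<delta> x = (SOME y. (x, y) \<in> \<delta>)"

lemma class_rep: "\<delta> \<in> congruences \<Sigma> A \<Longrightarrow> x \<in> universe A \<Longrightarrow> (x, class_rep \<delta> x) \<in> \<delta>"
  unfolding class_rep_def by (rule someI_ex) (auto intro: congruence_refl)

lemma class_rep_eq:
  assumes \<delta>: "\<delta> \<in> congruences \<Sigma> A" and "(x, y) \<in> \<delta>"
  shows "class_rep \<delta> x = class_rep \<delta> y"
proof -
  have "(x, z) \<in> \<delta> \<longleftrightarrow> (y, z) \<in> \<delta>" for z
    using assms congruence_trans[OF \<delta>] congruence_sym[OF \<delta>] by metis
  then show ?thesis by (simp add: class_rep_def)
qed

lemma class_rep_eq_iff:
  assumes "\<delta> \<in> congruences \<Sigma> A" "x \<in> universe A" "y \<in> universe A"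
  shows "class_rep \<delta> x = class_rep \<delta> y \<longleftrightarrow> (x, y) \<in> \<delta>"
  using class_rep[OF assms(1,2)] class_rep[OF assms(1,3)] class_rep_eq[OF assms(1)]
    congruence_trans[OF assms(1)] congruence_sym[OF assms(1)] by metis

section \<open>Cancellation in nilpotent algebras with a Mal'cev operation\<close>

locale nilpotent_malcev = finite_algebra \<Sigma> A
  for \<Sigma> :: "'f signature" and A :: "('f, 'a) algebra" +
  fixes d :: "'a \<Rightarrow> 'a \<Rightarrow> 'a \<Rightarrow> 'a"
  assumes nil: "nilpotent \<Sigma> A"
    and tmop_d: "tmop (\<lambda>v. d (v 0) (v 1) (v 2))"
    and d_left: "x \<in> U \<Longrightarrow> y \<in> U \<Longrightarrow> d x x y = y"
    and d_right: "x \<in> U \<Longrightarrow> y \<in> U \<Longrightarrow> d x y y = x"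
begin

lemma tm_d: "tmop a \<Longrightarrow> tmop b \<Longrightarrow> tmop c \<Longrightarrow> tmop (\<lambda>v. d (a v) (b v) (c v))"
  by (rule tmop3_comp[OF tmop_d])

lemma d_closed: "x \<in> U \<Longrightarrow> y \<in> U \<Longrightarrow> z \<in> U \<Longrightarrow> d x y z \<in> U"
  using tmop_closed[OF tmop_d asg_V[of x y z z]] by simp

lemma d_cong:
  assumes \<delta>: "\<delta> \<in> Con" and "(a, a') \<in> \<delta>" "(b, b') \<in> \<delta>" "(c, c') \<in> \<delta>"
  shows "(d a b c, d a' b' c') \<in> \<delta>"
proof -
  have "(d (asg a b c c 0) (asg a b c c 1) (asg a b c c 2),
      d (asg a' b' c' c' 0) (asg a' b' c' c' 1) (asg a' b' c' c' 2)) \<in> \<delta>"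
    by (rule tmop_congruence[OF \<delta> tmop_d])
      (use assms congruence_subset[OF \<delta>] in \<open>auto simp: asg_def\<close>)
  then show ?thesis by simp
qed

text \<open>Two operations that agree modulo \<delta> at three corners of a rectangle agree at the
  fourth. The term condition is applied to d(F, G, e) with e = G w: this is e modulo \<delta>
  wherever F and G agree, and it is F w at the fourth corner. The constant e occupies variable 0,
  whence the index shift.\<close>

lemma central_eq:
  assumes cent: "central \<theta> \<delta>" and \<delta>: "\<delta> \<in> Con" and F: "tmop F" and G: "tmop G"
    and V: "u \<in> V" "u' \<in> V" "w \<in> V" "w' \<in> V"
    and mat: "\<And>i. u i = u' i \<and> w i = w' i \<or> u i = w i \<and> u' i = w' i \<and> (u i, u' i) \<in> \<theta>"
    and eq: "(F u, G u) \<in> \<delta>" "(F u', G u') \<in> \<delta>" "(F w', G w') \<in> \<delta>"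
  shows "(F w, G w) \<in> \<delta>"
proof -
  define e where "e = G w"
  have eU: "e \<in> U" unfolding e_def by (rule tmop_closed[OF G V(3)])
  define H where "H = (\<lambda>v. d (F (\<lambda>i. v (Suc i))) (G (\<lambda>i. v (Suc i))) (v 0))"
  have H: "tmop H"
    unfolding H_def by (intro tm_d tmop_var tmop_comp[OF F] tmop_comp[OF G])
  have red: "(H (case_nat e v), e) \<in> \<delta>" if "(F v, G v) \<in> \<delta>" "v \<in> V" for v
  proof -
    have "(d (F v) (G v) e, d (G v) (G v) e) \<in> \<delta>"
      by (intro d_cong \<delta> that(1) congruence_refl[OF \<delta>] eU tmop_closed[OF G that(2)])
    then show ?thesis using d_left[OF tmop_closed[OF G that(2)] eU] by (simp add: H_def)
  qed
  note \<delta>s = congruence_trans[OF \<delta>] congruence_sym[OF \<delta>]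
  have "(H (case_nat e w), H (case_nat e w')) \<in> \<delta>"
    using cent H
  proof (rule centralizesD)
    show "(H (case_nat e u), H (case_nat e u')) \<in> \<delta>"
      using red[OF eq(1) V(1)] red[OF eq(2) V(2)] \<delta>s by blast
    fix i
    show "case_nat e u i = case_nat e u' i \<and> case_nat e w i = case_nat e w' i \<or>
      case_nat e u i = case_nat e w i \<and> case_nat e u' i = case_nat e w' i \<and>
      (case_nat e u i, case_nat e u' i) \<in> \<theta>"
      using mat by (cases i) auto
  qed (use V eU in \<open>auto split: nat.splits\<close>)
  then have "(H (case_nat e w), e) \<in> \<delta>"
    using red[OF eq(3) V(4)] \<delta>s by blast
  then show ?thesis
    using d_right[OF tmop_closed[OF F V(3)] tmop_closed[OF G V(3)]] by (simp add: H_def e_def)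
qed

text \<open>The term condition changes the common arguments a, b into a, a, where the Mal'cev
  identity returns x and y themselves.\<close>

lemma d_cancel_left:
  assumes cent: "central \<theta> \<delta>" and xy: "(x, y) \<in> \<theta>" "x \<in> U" "y \<in> U" and ab: "a \<in> U" "b \<in> U"
    and eq: "(d x a b, d y a b) \<in> \<delta>"
  shows "(x, y) \<in> \<delta>"
proof -
  have "(d (asg x a a a 0) (asg x a a a 1) (asg x a a a 2),
      d (asg y a a a 0) (asg y a a a 1) (asg y a a a 2)) \<in> \<delta>"
    using cent tmop_d
    by (rule centralizesD[where u = "asg x a b b" and u' = "asg y a b b"])
      (use assms in \<open>auto simp: asg_def\<close>)
  then show ?thesis using xy ab d_right by simp
qed

lemma d_cancel_right:
  assumes cent: "central \<theta> \<delta>" and xy: "(x, y) \<in> \<theta>" "x \<in> U" "y \<in> U" and ab: "a \<in> U" "b \<in> U"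
    and eq: "(d a b x, d a b y) \<in> \<delta>"
  shows "(x, y) \<in> \<delta>"
proof -
  have "(d (asg a a x x 0) (asg a a x x 1) (asg a a x x 2),
      d (asg a a y y 0) (asg a a y y 1) (asg a a y y 2)) \<in> \<delta>"
    using cent tmop_d
    by (rule centralizesD[where u = "asg a b x x" and u' = "asg a b y y"])
      (use assms in \<open>auto simp: asg_def\<close>)
  then show ?thesis using xy ab d_left by simp
qed

lemma L_eqI:
  assumes "x \<in> U" "y \<in> U" and step: "\<And>k. (x, y) \<in> L k \<Longrightarrow> (x, y) \<in> L (Suc k)"
  shows "x = y"
proof -
  have "(x, y) \<in> L k" for k
    by (induction k) (use assms in \<open>auto simp: total_rel_def simp del: lower_central.simps(2)\<close>)
  moreover obtain k where "L k = equality_rel A"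
    using nil by (auto simp: nilpotent_def k_nilpotent_def)
  ultimately have "(x, y) \<in> Id_on U" by (metis equality_rel_def)
  then show ?thesis by auto
qed

lemma inj_d_left: "a \<in> U \<Longrightarrow> b \<in> U \<Longrightarrow> inj_on (\<lambda>x. d x a b) U"
proof (rule inj_onI, rule L_eqI)
  fix x y k assume *: "a \<in> U" "b \<in> U" "x \<in> U" "y \<in> U" "d x a b = d y a b" "(x, y) \<in> L k"
  have "(d x a b, d y a b) \<in> L (Suc k)"
    using * congruence_refl[OF L_congruence] d_closed by metis
  then show "(x, y) \<in> L (Suc k)" by (rule d_cancel_left[OF L_central *(6,3,4,1,2)])
qed

lemma inj_d_right: "a \<in> U \<Longrightarrow> b \<in> U \<Longrightarrow> inj_on (\<lambda>x. d a b x) U"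
proof (rule inj_onI, rule L_eqI)
  fix x y k assume *: "a \<in> U" "b \<in> U" "x \<in> U" "y \<in> U" "d a b x = d a b y" "(x, y) \<in> L k"
  have "(d a b x, d a b y) \<in> L (Suc k)"
    using * congruence_refl[OF L_congruence] d_closed by metis
  then show "(x, y) \<in> L (Suc k)" by (rule d_cancel_right[OF L_central *(6,3,4,1,2)])
qed

lemma finite_class: "\<alpha> \<in> Con \<Longrightarrow> finite (\<alpha> `` {a})"
  using congruence_subset fin by (metis Image_mono Image_subset finite_subset order_refl)

text \<open>The injection x to d x a b sends a to b, hence the class of a into the class of b.
  Exchanging a and b shows that all classes are equally large.\<close>

lemma card_class_le:
  assumes \<alpha>: "\<alpha> \<in> Con" and ab: "a \<in> U" "b \<in> U"
  shows "card (\<alpha> `` {a}) \<le> card (\<alpha> `` {b})"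
proof (rule card_inj_on_le)
  show "inj_on (\<lambda>x. d x a b) (\<alpha> `` {a})"
    by (rule inj_on_subset[OF inj_d_left[OF ab]]) (use congruence_subset[OF \<alpha>] in auto)
  show "(\<lambda>x. d x a b) ` (\<alpha> `` {a}) \<subseteq> \<alpha> `` {b}"
  proof clarsimp
    fix x assume "(a, x) \<in> \<alpha>"
    then have "(d a a b, d x a b) \<in> \<alpha>"
      by (intro d_cong \<alpha> congruence_refl[OF \<alpha>] ab)
    then show "(b, d x a b) \<in> \<alpha>" using d_left[OF ab] by simp
  qed
qed (rule finite_class[OF \<alpha>])

text \<open>Lagrange's theorem for classes. Applied to the total relation over \<alpha> and to
  \<alpha> over \<delta>, it makes the order of the difference group divide the size of the
  algebra.\<close>

lemma card_class:
  assumes \<alpha>: "\<alpha> \<in> Con" and \<delta>: "\<delta> \<in> Con" and le: "\<delta> \<subseteq> \<alpha>" and o: "o' \<in> U"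
  shows "card (\<alpha> `` {o'}) = card (class_rep \<delta> ` (\<alpha> `` {o'})) * card (\<delta> `` {o'})"
proof -
  let ?S = "\<alpha> `` {o'}"
  have SU: "x \<in> U" if "x \<in> ?S" for x using that congruence_subset[OF \<alpha>] by auto
  have "card ?S = (\<Sum>y\<in>class_rep \<delta> ` ?S. card {x \<in> ?S. class_rep \<delta> x = y})"
    using sum.image_gen[OF finite_class[OF \<alpha>], of "\<lambda>_. 1 :: nat" o' "class_rep \<delta>"] by simp
  also have "\<dots> = (\<Sum>y\<in>class_rep \<delta> ` ?S. card (\<delta> `` {o'}))"
  proof (rule sum.cong[OF refl])
    fix y assume "y \<in> class_rep \<delta> ` ?S"
    then obtain x where x: "x \<in> ?S" "y = class_rep \<delta> x" by blast
    have "{z \<in> ?S. class_rep \<delta> z = y} = \<delta> `` {x}"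
    proof (intro equalityI subsetI)
      fix z assume "z \<in> {z \<in> ?S. class_rep \<delta> z = y}"
      then show "z \<in> \<delta> `` {x}"
        using class_rep_eq_iff[OF \<delta> SU[OF x(1)], of z] x(2) SU[of z] by auto
    next
      fix z assume "z \<in> \<delta> `` {x}"
      then have z: "(x, z) \<in> \<delta>" by simp
      then have "z \<in> ?S" using x(1) le congruence_trans[OF \<alpha>] by blast
      then show "z \<in> {z \<in> ?S. class_rep \<delta> z = y}" using class_rep_eq[OF \<delta> z] x by simp
    qed
    moreover have "card (\<delta> `` {x}) = card (\<delta> `` {o'})"
      using card_class_le[OF \<delta>] o SU[OF x(1)] by (metis le_antisym)
    ultimately show "card {z \<in> ?S. class_rep \<delta> z = y} = card (\<delta> `` {o'})" by simp
  qed
  finally show ?thesis by simp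
qed

end

section \<open>Characters of a congruence\<close>

context finite_algebra
begin

text \<open>
  A character is a homomorphism from the group of \<open>\<alpha>\<close>-differences to \<open>\<int>/p\<close>, written as an
  integer-valued function of pairs and read modulo \<open>p\<close>; the second condition says that applying a
  term operation in one variable to a pair changes its difference in a way that does not depend on
  the remaining arguments.
\<close>

definition characters :: "nat \<Rightarrow> ('a \<times> 'a) set \<Rightarrow> ('a \<Rightarrow> 'a \<Rightarrow> int) set" where
  "characters p \<alpha> = {\<chi>.
     (\<forall>a b c. (a, b) \<in> \<alpha> \<longrightarrow> (b, c) \<in> \<alpha> \<longrightarrow> [\<chi> a c = \<chi> a b + \<chi> b c] (mod int p)) \<and>
     (\<forall>g v w i a b. tmop g \<longrightarrow> v \<in> V \<longrightarrow> w \<in> V \<longrightarrow> (a, b) \<in> \<alpha> \<longrightarrow>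
       [\<chi> (g (v(i := a))) (g (v(i := b))) = \<chi> (g (w(i := a))) (g (w(i := b)))] (mod int p))}"

definition character_kernel :: "nat \<Rightarrow> ('a \<times> 'a) set \<Rightarrow> ('a \<times> 'a) set" where
  "character_kernel p \<alpha> = {(a, b) \<in> \<alpha>. \<forall>\<chi>\<in>characters p \<alpha>. [\<chi> a b = 0] (mod int p)}"

lemma character_add:
  "\<chi> \<in> characters p \<alpha> \<Longrightarrow> (a, b) \<in> \<alpha> \<Longrightarrow> (b, c) \<in> \<alpha> \<Longrightarrow> [\<chi> a c = \<chi> a b + \<chi> b c] (mod int p)"
  by (simp add: characters_def)

lemma character_shift:
  assumes "\<chi> \<in> characters p \<alpha>" "tmop g" "v \<in> V" "w \<in> V" "(a, b) \<in> \<alpha>"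
  shows "[\<chi> (g (v(i := a))) (g (v(i := b))) = \<chi> (g (w(i := a))) (g (w(i := b)))] (mod int p)"
  using assms unfolding characters_def by blast

lemma character_same: "\<chi> \<in> characters p \<alpha> \<Longrightarrow> (a, a) \<in> \<alpha> \<Longrightarrow> [\<chi> a a = 0] (mod int p)"
  using character_add[of \<chi> p \<alpha> a a a] by (simp add: cong_iff_dvd_diff)

lemma update_related:
  assumes \<alpha>: "\<alpha> \<in> Con" and "tmop g" "v \<in> V" "(a, b) \<in> \<alpha>"
  shows "(g (v(i := a)), g (v(i := b))) \<in> \<alpha>"
  using assms congruence_refl[OF \<alpha>] congruence_subset[OF \<alpha>]
  by (intro tmop_congruence[OF \<alpha> assms(2)]) auto

text \<open>Characters may be pulled back along unary polynomials. An operation thus turns one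
  character of its value into characters of its arguments.\<close>

lemma character_comp:
  assumes \<alpha>: "\<alpha> \<in> Con" and \<chi>: "\<chi> \<in> characters p \<alpha>" and g: "tmop g" and z: "z \<in> V"
  shows "(\<lambda>a b. \<chi> (g (z(i := a))) (g (z(i := b)))) \<in> characters p \<alpha>"
  unfolding characters_def
proof (intro CollectI conjI allI impI)
  fix a b c assume "(a, b) \<in> \<alpha>" "(b, c) \<in> \<alpha>"
  then show "[\<chi> (g (z(i := a))) (g (z(i := c))) =
      \<chi> (g (z(i := a))) (g (z(i := b))) + \<chi> (g (z(i := b))) (g (z(i := c)))] (mod int p)"
    by (intro character_add[OF \<chi>] update_related[OF \<alpha> g z])
next
  fix h v w j a b
  assume h: "tmop h" and v: "v \<in> V" and w: "w \<in> V" and ab: "(a, b) \<in> \<alpha>"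
  \<comment> \<open>Even positions feed h and odd ones hold the parameters of g, so that g with h
    plugged into place i is a single term operation.\<close>
  define G where "G y = g (\<lambda>l. if l = i then h (\<lambda>r. y (2 * r)) else y (2 * l + 1))"
    for y :: "nat \<Rightarrow> 'a"
  have "tmop (\<lambda>y. g (\<lambda>l. (if l = i then (\<lambda>y. h (\<lambda>r. y (2 * r))) else (\<lambda>y. y (2 * l + 1))) y))"
    by (rule tmop_comp[OF g]) (auto intro: tmop_comp[OF h] tmop_var)
  then have G: "tmop G"
    unfolding G_def by (rule tmop_cong) (auto intro!: arg_cong[where f = g])
  define mrg where "mrg v j = (if even j then v (j div 2) else z (j div 2))"
    for v :: "nat \<Rightarrow> 'a" and j :: nat
  have GE: "G ((mrg v)(2 * j := c)) = g (z(i := h (v(j := c))))" for v c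
  proof -
    have 1: "(\<lambda>r. ((mrg v)(2 * j := c)) (2 * r)) = v(j := c)" by (auto simp: mrg_def)
    have 2: "((mrg v)(2 * j := c)) (2 * l + 1) = z l" for l
    proof -
      have "2 * l + 1 \<noteq> 2 * j" by presburger
      then show ?thesis by (simp add: mrg_def)
    qed
    show ?thesis unfolding G_def 1 2 by (auto intro!: arg_cong[where f = g])
  qed
  have "mrg v \<in> V" "mrg w \<in> V" using v w z by (auto simp: mrg_def)
  from character_shift[OF \<chi> G this ab, of "2 * j"]
  show "[\<chi> (g (z(i := h (v(j := a))))) (g (z(i := h (v(j := b))))) =
      \<chi> (g (z(i := h (w(j := a))))) (g (z(i := h (w(j := b)))))] (mod int p)"
    unfolding GE .
qed

text \<open>The arguments are changed one at a time, and by \<open>character_shift\<close> each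
  difference may be taken over the same base z. So \<chi> of an operation is additive in the
  differences of its arguments.\<close>

lemma character_telescope:
  assumes \<alpha>: "\<alpha> \<in> Con" and \<chi>: "\<chi> \<in> characters p \<alpha>" and g: "tmop g"
    and z: "z \<in> V" and v: "v \<in> V" and w: "w \<in> V" and vw: "\<And>i. i < n \<Longrightarrow> (v i, w i) \<in> \<alpha>"
  shows "[\<chi> (g v) (g (\<lambda>i. if i < n then w i else v i)) =
    (\<Sum>i<n. \<chi> (g (z(i := v i))) (g (z(i := w i))))] (mod int p)"
  using vw
proof (induction n)
  case 0
  then show ?case
    using character_same[OF \<chi> congruence_refl[OF \<alpha> tmop_closed[OF g v]]] by simp
next
  case (Suc n)
  let ?h = "\<lambda>i. if i < n then w i else v i" and ?h' = "\<lambda>i. if i < Suc n then w i else v i"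
  have h: "?h \<in> V" "?h' \<in> V" using v w by auto
  have eq: "?h(n := v n) = ?h" "?h(n := w n) = ?h'" by (auto simp: fun_eq_iff)
  have 1: "(g v, g ?h) \<in> \<alpha>"
    by (rule tmop_congruence[OF \<alpha> g v h(1)]) (use Suc.prems congruence_refl[OF \<alpha>] v in auto)
  have 2: "(g ?h, g ?h') \<in> \<alpha>"
    using update_related[OF \<alpha> g h(1) Suc.prems[of n], of n] unfolding eq by simp
  have "[\<chi> (g ?h) (g ?h') = \<chi> (g (z(n := v n))) (g (z(n := w n)))] (mod int p)"
    using character_shift[OF \<chi> g h(1) z Suc.prems[of n], of n] unfolding eq by simp
  moreover have "[\<chi> (g v) (g ?h) = (\<Sum>i<n. \<chi> (g (z(i := v i))) (g (z(i := w i))))] (mod int p)"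
    by (rule Suc.IH) (use Suc.prems in simp)
  ultimately have "[\<chi> (g v) (g ?h) + \<chi> (g ?h) (g ?h') =
      (\<Sum>i<Suc n. \<chi> (g (z(i := v i))) (g (z(i := w i))))] (mod int p)"
    by (simp add: cong_add)
  with character_add[OF \<chi> 1 2] show ?case by (rule cong_trans)
qed

text \<open>Compatibility with an operation: telescoping writes \<chi> of the two values as a sum of
  pulled-back characters of the arguments. These are characters as well, so they vanish on the
  kernel.\<close>

lemma character_kernel_congruence:
  assumes \<alpha>: "\<alpha> \<in> Con"
  shows "character_kernel p \<alpha> \<in> Con"
proof (rule congruenceI)
  show "character_kernel p \<alpha> \<subseteq> U \<times> U"
    using congruence_subset[OF \<alpha>] by (auto simp: character_kernel_def)
  show "(x, x) \<in> character_kernel p \<alpha>" if "x \<in> U" for x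
    using congruence_refl[OF \<alpha> that] character_same by (auto simp: character_kernel_def)
  show "(y, x) \<in> character_kernel p \<alpha>" if "(x, y) \<in> character_kernel p \<alpha>" for x y
  proof -
    have xy: "(x, y) \<in> \<alpha>" using that by (auto simp: character_kernel_def)
    note yx = congruence_sym[OF \<alpha> xy]
    have "[\<chi> y x = 0] (mod int p)" if \<chi>: "\<chi> \<in> characters p \<alpha>" for \<chi>
    proof -
      have "[\<chi> x y = 0] (mod int p)"
        using \<chi> \<open>(x, y) \<in> character_kernel p \<alpha>\<close> by (auto simp: character_kernel_def)
      moreover have "[\<chi> x x = 0] (mod int p)"
        using character_same[OF \<chi> congruence_trans[OF \<alpha> xy yx]] .
      ultimately show ?thesis
        using character_add[OF \<chi> xy yx] by (metis cong_add_lcancel_0 cong_add_rcancel cong_sym cong_trans add_0)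
    qed
    then show ?thesis using yx by (auto simp: character_kernel_def)
  qed
  show "(x, z) \<in> character_kernel p \<alpha>"
    if "(x, y) \<in> character_kernel p \<alpha>" "(y, z) \<in> character_kernel p \<alpha>" for x y z
  proof -
    have xy: "(x, y) \<in> \<alpha>" and yz: "(y, z) \<in> \<alpha>" using that by (auto simp: character_kernel_def)
    have "[\<chi> x z = 0] (mod int p)" if \<chi>: "\<chi> \<in> characters p \<alpha>" for \<chi>
    proof -
      have "[\<chi> x y + \<chi> y z = 0 + 0] (mod int p)"
        using \<chi> \<open>(x, y) \<in> character_kernel p \<alpha>\<close> \<open>(y, z) \<in> character_kernel p \<alpha>\<close>
        by (intro cong_add) (auto simp: character_kernel_def)
      then show ?thesis using character_add[OF \<chi> xy yz] cong_trans by fastforce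
    qed
    then show ?thesis using congruence_trans[OF \<alpha> xy yz] by (auto simp: character_kernel_def)
  qed
  fix f n xs ys
  assume f: "\<Sigma> f = Some n" and xs: "xs \<in> tuples U n" and ys: "ys \<in> tuples U n"
    and r: "list_all2 (\<lambda>x y. (x, y) \<in> character_kernel p \<alpha>) xs ys"
  obtain o' where o: "o' \<in> U" using alg by (auto simp: is_algebra_def)
  define v where "v zs i = (if i < n then zs ! i else o')" for zs i
  have vV: "v zs \<in> V" if "zs \<in> tuples U n" for zs
    using that o subsetD[OF _ nth_mem, of zs U] by (auto simp: v_def tuples_def)
  have map: "map (v zs) [0..<n] = zs" if "zs \<in> tuples U n" for zs
    using that by (auto simp: v_def tuples_def intro!: nth_equalityI)
  have k: "(v xs i, v ys i) \<in> character_kernel p \<alpha>" if "i < n" for i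
    using r that xs by (auto simp: v_def tuples_def list_all2_conv_all_nth)
  then have k\<alpha>: "(v xs i, v ys i) \<in> \<alpha>" if "i < n" for i
    using that by (auto simp: character_kernel_def)
  have hyb: "(\<lambda>i. if i < n then v ys i else v xs i) = v ys"
    by (auto simp: v_def)
  let ?g = "\<lambda>v. oper A f (map v [0..<n])"
  have oV: "(\<lambda>_. o') \<in> V" using o by simp
  have "[\<chi> (oper A f xs) (oper A f ys) = 0] (mod int p)" if \<chi>: "\<chi> \<in> characters p \<alpha>" for \<chi>
  proof -
    have "[\<chi> (?g (v xs)) (?g (v ys)) =
        (\<Sum>i<n. \<chi> (?g ((\<lambda>_. o')(i := v xs i))) (?g ((\<lambda>_. o')(i := v ys i))))] (mod int p)"
      using character_telescope[OF \<alpha> \<chi> tmop_oper[OF f] oV vV[OF xs] vV[OF ys], where n = n, OF k\<alpha>]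
      unfolding hyb .
    also have "[(\<Sum>i<n. \<chi> (?g ((\<lambda>_. o')(i := v xs i))) (?g ((\<lambda>_. o')(i := v ys i)))) =
        (\<Sum>i<n. 0)] (mod int p)"
    proof (rule cong_sum)
      fix i assume "i \<in> {..<n}"
      then have "\<forall>\<chi>\<in>characters p \<alpha>. [\<chi> (v xs i) (v ys i) = 0] (mod int p)"
        using k[of i] by (simp add: character_kernel_def)
      from bspec[OF this character_comp[OF \<alpha> \<chi> tmop_oper[OF f] oV, of i]]
      show "[\<chi> (?g ((\<lambda>_. o')(i := v xs i))) (?g ((\<lambda>_. o')(i := v ys i))) = 0] (mod int p)" .
    qed
    finally show ?thesis using map xs ys by simp
  qed
  moreover have "(?g (v xs), ?g (v ys)) \<in> \<alpha>"
    by (rule tmop_congruence[OF \<alpha> tmop_oper[OF f] vV[OF xs] vV[OF ys]])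
      (metis k\<alpha> v_def congruence_refl[OF \<alpha> o])
  ultimately show "(oper A f xs, oper A f ys) \<in> character_kernel p \<alpha>"
    using map xs ys by (auto simp: character_kernel_def)
qed

end

context nilpotent_malcev
begin

text \<open>The four-variable form of \<open>central_eq\<close>. The sixteen elements list the
  corners u, u', w, w' of the rectangle in this order; the third one, (i, j, k, l), is where
  equality is concluded.\<close>

lemma central_eq_asg:
  assumes "central \<theta> \<delta>" "\<delta> \<in> Con" "tmop F" "tmop G"
    and "a \<in> U" "b \<in> U" "c \<in> U" "z \<in> U" and "a' \<in> U" "b' \<in> U" "c' \<in> U" "z' \<in> U"
    and "i \<in> U" "j \<in> U" "k \<in> U" "l \<in> U" and "i' \<in> U" "j' \<in> U" "k' \<in> U" "l' \<in> U"
    and "a = a' \<and> i = i' \<or> a = i \<and> a' = i' \<and> (a, a') \<in> \<theta>"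
    and "b = b' \<and> j = j' \<or> b = j \<and> b' = j' \<and> (b, b') \<in> \<theta>"
    and "c = c' \<and> k = k' \<or> c = k \<and> c' = k' \<and> (c, c') \<in> \<theta>"
    and "z = z' \<and> l = l' \<or> z = l \<and> z' = l' \<and> (z, z') \<in> \<theta>"
    and "(F (asg a b c z), G (asg a b c z)) \<in> \<delta>" "(F (asg a' b' c' z'), G (asg a' b' c' z')) \<in> \<delta>"
    and "(F (asg i' j' k' l'), G (asg i' j' k' l')) \<in> \<delta>"
  shows "(F (asg i j k l), G (asg i j k l)) \<in> \<delta>"
proof (rule central_eq[OF assms(1-4)])
  fix n
  show "asg a b c z n = asg a' b' c' z' n \<and> asg i j k l n = asg i' j' k' l' n \<or>
    asg a b c z n = asg i j k l n \<and> asg a' b' c' z' n = asg i' j' k' l' n \<and>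
    (asg a b c z n, asg a' b' c' z' n) \<in> \<theta>"
    using assms(21-24) by (simp add: asg_def)
qed (intro asg_V assms)+

text \<open>With \<delta> = [1, \<alpha>], the \<alpha>-class of e becomes modulo \<delta> an
  abelian group under x + y = d x e y, realised on representatives. The difference of a pair (a, b)
  is d b a e, and a nonzero group character of differences is a character of \<alpha> with smaller
  kernel. Nilpotency gives \<delta> \<noteq> \<alpha>, so the group is nontrivial.\<close>

lemma character_kernel_less:
  assumes \<alpha>: "\<alpha> \<in> Con" "\<not> \<alpha> \<subseteq> equality_rel A" and p: "prime p" and q: "card U = p ^ r"
  shows "character_kernel p \<alpha> \<noteq> \<alpha>"
proof -
  define \<delta> where "\<delta> = commutator \<Sigma> A (total_rel A) \<alpha>"
  have \<delta>: "\<delta> \<in> Con" unfolding \<delta>_def by (rule commutator_least(1)[OF alg])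
  have le: "\<delta> \<subseteq> \<alpha>" unfolding \<delta>_def by (rule commutator_le[OF \<alpha>(1)])
  have cent: "central \<alpha> \<delta>"
    unfolding \<delta>_def by (intro term_condition_centralizes commutator_least(2)[OF alg] \<alpha>(1))
  have "\<delta> \<noteq> \<alpha>" unfolding \<delta>_def by (rule commutator_less[OF nil \<alpha>])
  with le obtain s t where st: "(s, t) \<in> \<alpha>" "(s, t) \<notin> \<delta>" by auto
  have stU: "s \<in> U" "t \<in> U" using st congruence_subset[OF \<alpha>(1)] by auto
  obtain e where e: "e \<in> U" using alg by (auto simp: is_algebra_def)
  define C where "C = \<alpha> `` {e}"
  have CU: "x \<in> U" if "x \<in> C" for x using that congruence_subset[OF \<alpha>(1)] by (auto simp: C_def)
  have C\<alpha>: "(e, x) \<in> \<alpha>" "(x, e) \<in> \<alpha>" if "x \<in> C" for x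
    using that congruence_sym[OF \<alpha>(1)] by (auto simp: C_def)
  have eC: "e \<in> C" using congruence_refl[OF \<alpha>(1) e] by (simp add: C_def)
  note \<delta>r = congruence_refl[OF \<delta>] and \<delta>t = congruence_trans[OF \<delta>] and \<delta>s = congruence_sym[OF \<delta>]
  have dC: "d b a e \<in> C" if "(a, b) \<in> \<alpha>" for a b
  proof -
    have U: "a \<in> U" "b \<in> U" using that congruence_subset[OF \<alpha>(1)] by auto
    have "(d a a e, d b a e) \<in> \<alpha>"
      by (intro d_cong[OF \<alpha>(1)] congruence_refl[OF \<alpha>(1)] that U e)
    then show ?thesis using d_left U e by (simp add: C_def)
  qed
  have sC: "d x e y \<in> C" if "x \<in> C" "y \<in> C" for x y
  proof -
    have "(d e e e, d x e y) \<in> \<alpha>"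
      by (intro d_cong[OF \<alpha>(1)] congruence_refl[OF \<alpha>(1)] C\<alpha> that e)
    then show ?thesis using d_left e by (simp add: C_def)
  qed
  \<comment> \<open>Each group law compares two term operations on a rectangle. At the three other
    corners enough arguments equal e for both sides to reduce by the Mal'cev identities.\<close>
  have comm: "(d x e y, d y e x) \<in> \<delta>" if "x \<in> C" "y \<in> C" for x y
  proof -
    let ?F = "\<lambda>v. d (v 1) (v 0) (v 2)" and ?G = "\<lambda>v. d (v 2) (v 0) (v 1)"
    have tm: "tmop ?F" "tmop ?G" by (intro tm_d tmop_var)+
    have "(?F (asg e x y e), ?G (asg e x y e)) \<in> \<delta>"
      using central_eq_asg[OF cent \<delta> tm, of e e y e e e e e e x y e e x e e] that CU e C\<alpha> d_left d_right d_closed \<delta>r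
      by simp
    then show ?thesis by simp
  qed
  have assoc: "(d (d x e y) e z, d x e (d y e z)) \<in> \<delta>" if "x \<in> C" "y \<in> C" "z \<in> C" for x y z
  proof -
    let ?F = "\<lambda>v. d (d (v 1) (v 0) (v 2)) (v 0) (v 3)"
    let ?G = "\<lambda>v. d (v 1) (v 0) (d (v 2) (v 0) (v 3))"
    have tm: "tmop ?F" "tmop ?G" by (intro tm_d tmop_var)+
    have "(?F (asg e x y z), ?G (asg e x y z)) \<in> \<delta>"
      using central_eq_asg[OF cent \<delta> tm, of e e y z e e y e e x y z e x y e] that CU e C\<alpha> d_left d_right d_closed \<delta>r
      by simp
    then show ?thesis by simp
  qed
  \<comment> \<open>The comparison is with d(v 0, v 1, v 2) rather than with the constant e: that
    one matches at the three corners, and at the target it is d e x x = e.\<close>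
  have neg: "(d (d e x e) e x, e) \<in> \<delta>" if "x \<in> C" for x
  proof -
    let ?F = "\<lambda>v. d (d (v 0) (v 1) (v 0)) (v 0) (v 2)" and ?G = "\<lambda>v. d (v 0) (v 1) (v 2)"
    have tm: "tmop ?F" "tmop ?G" by (intro tm_d tmop_var)+
    have "(?F (asg e x x e), ?G (asg e x x e)) \<in> \<delta>"
      using central_eq_asg[OF cent \<delta> tm, of e e x e e e e e e x x e e x e e] that CU e C\<alpha> d_left d_right d_closed \<delta>r
      by simp
    then show ?thesis using that CU e d_right by simp
  qed
  \<comment> \<open>The rectangle moves a to b in one direction and c to b in the other; at the
    three corners at least one of the two summands is d b b e = e.\<close>
  have cocycle: "(d c a e, d (d b a e) e (d c b e)) \<in> \<delta>" if "(a, b) \<in> \<alpha>" "(b, c) \<in> \<alpha>" for a b c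
  proof -
    have U: "a \<in> U" "b \<in> U" "c \<in> U" using that congruence_subset[OF \<alpha>(1)] by auto
    let ?F = "\<lambda>v. d (v 2) (v 0) (v 3)"
    let ?G = "\<lambda>v. d (d (v 1) (v 0) (v 3)) (v 3) (d (v 2) (v 1) (v 3))"
    have tm: "tmop ?F" "tmop ?G" by (intro tm_d tmop_var)+
    have "(?F (asg a b c e), ?G (asg a b c e)) \<in> \<delta>"
      using central_eq_asg[OF cent \<delta> tm, of b b c e b b b e a b c e a b b e] that U e congruence_sym[OF \<alpha>(1)] d_left d_right d_closed \<delta>r
      by simp
    then show ?thesis by simp
  qed
  have shift: "(d (g (v(i := b))) (g (v(i := a))) e, d (g (w(i := b))) (g (w(i := a))) e) \<in> \<delta>"
    if g: "tmop g" and v: "v \<in> V" and w: "w \<in> V" and ab: "(a, b) \<in> \<alpha>" for g v w i a b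
  proof -
    have U: "a \<in> U" "b \<in> U" using ab congruence_subset[OF \<alpha>(1)] by auto
    \<comment> \<open>One assignment holds the pair, the constant e and both parameter lists: v at
      odd positions from 3, w at even positions from 4. For v = w both sides coincide, and for b = a
      both are e.\<close>
    define Y where "Y b v w j = (if j = 0 then b else if j = 1 then a else if j = 2 then e
        else if odd j then v ((j - 3) div 2) else w ((j - 4) div 2))"
      for b v w and j :: nat
    define P where "P k c y = g (\<lambda>l. y (if l = i then c else k + 2 * l))"
      for k c :: nat and y :: "nat \<Rightarrow> 'a"
    have P: "tmop (P k c)" for k c
      unfolding P_def by (rule tmop_comp[OF g tmop_var])
    have YV: "Y b v w \<in> V" if "b \<in> U" "v \<in> V" "w \<in> V" for b v w
      using that U e by (auto simp: Y_def)
    have Y: "Y b v w 0 = b" "Y b v w 1 = a" "Y b v w 2 = e"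
      "Y b v w (3 + 2 * l) = v l" "Y b v w (4 + 2 * l) = w l" for b v w l
      by (auto simp: Y_def)
    have PE: "P 3 0 (Y b v w) = g (v(i := b))" "P 3 1 (Y b v w) = g (v(i := a))"
      "P 4 0 (Y b v w) = g (w(i := b))" "P 4 1 (Y b v w) = g (w(i := a))" for b v w
      unfolding P_def by (intro arg_cong[where f = g] ext; simp add: Y[simplified])+
    have gU: "g (v(i := a)) \<in> U" if "v \<in> V" for v
      using that U by (intro tmop_closed[OF g]) auto
    have gU': "g (v(i := b)) \<in> U" if "v \<in> V" for v
      using that U by (intro tmop_closed[OF g]) auto
    let ?F = "\<lambda>y. d (P 3 0 y) (P 3 1 y) (y 2)" and ?G = "\<lambda>y. d (P 4 0 y) (P 4 1 y) (y 2)"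
    have tm: "tmop ?F" "tmop ?G" by (intro tm_d P tmop_var)+
    have "(?F (Y b v w), ?G (Y b v w)) \<in> \<delta>"
    proof (rule central_eq[OF cent \<delta> tm, where u = "Y b w w" and u' = "Y a w w" and
          w = "Y b v w" and w' = "Y a v w"])
      show "Y b w w j = Y a w w j \<and> Y b v w j = Y a v w j \<or>
        Y b w w j = Y b v w j \<and> Y a w w j = Y a v w j \<and> (Y b w w j, Y a w w j) \<in> \<alpha>" for j
        using congruence_sym[OF \<alpha>(1) ab] by (auto simp: Y_def)
      show "(?F (Y b w w), ?G (Y b w w)) \<in> \<delta>" "(?F (Y a w w), ?G (Y a w w)) \<in> \<delta>"
        unfolding PE Y by (intro \<delta>r d_closed gU gU' w e)+
      show "(?F (Y a v w), ?G (Y a v w)) \<in> \<delta>"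
        unfolding PE Y using d_left gU v w e \<delta>r by simp
    qed (intro YV U v w)+
    then show ?thesis unfolding PE Y .
  qed
  define R where "R = class_rep \<delta>"
  have R: "(x, R x) \<in> \<delta>" "(R x, x) \<in> \<delta>" if "x \<in> U" for x
    using class_rep[OF \<delta> that] \<delta>s by (auto simp: R_def)
  have Req: "R x = R y" if "(x, y) \<in> \<delta>" for x y
    using class_rep_eq[OF \<delta> that] by (simp add: R_def)
  have RC: "R x \<in> C" if "x \<in> C" for x
    using R(1)[OF CU[OF that]] le C\<alpha>(1)[OF that] congruence_trans[OF \<alpha>(1)] by (auto simp: C_def)
  define G where "G = \<lparr>carrier = R ` C, mult = (\<lambda>x y. R (d x e y)), one = R e\<rparr>"
  have car: "carrier G = R ` C" and mul: "x \<otimes>\<^bsub>G\<^esub> y = R (d x e y)" and one: "\<one>\<^bsub>G\<^esub> = R e" for x y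
    by (simp_all add: G_def)
  have carD: "x \<in> C" "x \<in> U" "R x = x" if "x \<in> carrier G" for x
    using that RC CU Req[OF R(2)] by (auto simp: car)
  have R_sum: "R (d (R x) e (R y)) = R (d x e y)" if "x \<in> U" "y \<in> U" for x y
    by (intro Req d_cong[OF \<delta>] R that \<delta>r e)
  have G: "comm_group G"
  proof (rule comm_groupI)
    show "x \<otimes>\<^bsub>G\<^esub> y \<in> carrier G" if "x \<in> carrier G" "y \<in> carrier G" for x y
      unfolding mul car using sC carD that by blast
    show "\<one>\<^bsub>G\<^esub> \<in> carrier G" unfolding one car using eC by blast
    show "(x \<otimes>\<^bsub>G\<^esub> y) \<otimes>\<^bsub>G\<^esub> z = x \<otimes>\<^bsub>G\<^esub> (y \<otimes>\<^bsub>G\<^esub> z)"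
      if "x \<in> carrier G" "y \<in> carrier G" "z \<in> carrier G" for x y z
    proof -
      note c = carD[OF that(1)] carD[OF that(2)] carD[OF that(3)]
      have "R (d (R (d x e y)) e z) = R (d (d x e y) e z)"
        using R_sum[of "d x e y" z] c d_closed e by simp
      also have "\<dots> = R (d x e (d y e z))" using assoc c by (intro Req) auto
      also have "\<dots> = R (d x e (R (d y e z)))"
        using R_sum[of x "d y e z"] c d_closed e by simp
      finally show ?thesis by (simp add: mul)
    qed
    show "x \<otimes>\<^bsub>G\<^esub> y = y \<otimes>\<^bsub>G\<^esub> x" if "x \<in> carrier G" "y \<in> carrier G" for x y
      unfolding mul using comm carD that by (intro Req) auto
    show "\<one>\<^bsub>G\<^esub> \<otimes>\<^bsub>G\<^esub> x = x" if "x \<in> carrier G" for x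
      unfolding mul one using R_sum[of e x] carD[OF that] e d_left by simp
    show "\<exists>y\<in>carrier G. y \<otimes>\<^bsub>G\<^esub> x = \<one>\<^bsub>G\<^esub>" if "x \<in> carrier G" for x
    proof
      have c: "d e x e \<in> C" by (rule dC[OF C\<alpha>(2)[OF carD(1)[OF that]]])
      then show "R (d e x e) \<in> carrier G" by (simp add: car)
      show "R (d e x e) \<otimes>\<^bsub>G\<^esub> x = \<one>\<^bsub>G\<^esub>"
        unfolding mul one using R_sum[of "d e x e" x] carD[OF that] CU[OF c] Req[OF neg] by simp
    qed
  qed
  have fG: "finite (carrier G)" unfolding car C_def by (intro finite_imageI finite_class \<alpha>(1))
  have ord: "order G dvd p ^ r"
  proof -
    have T: "total_rel A \<in> Con" by (rule total_rel_congruence[OF alg])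
    have "\<alpha> \<subseteq> total_rel A" using congruence_subset[OF \<alpha>(1)] by (simp add: total_rel_def)
    from card_class[OF T \<alpha>(1) this e] have "card C dvd card (total_rel A `` {e})"
      by (simp add: C_def)
    moreover have "total_rel A `` {e} = U" using e by (auto simp: total_rel_def)
    moreover have "order G dvd card C"
      using card_class[OF \<alpha>(1) \<delta> le e] by (simp add: order_def car C_def R_def)
    ultimately show ?thesis using q by (metis dvd_trans)
  qed
  have nontriv: "R (d t s e) \<in> carrier G" "R (d t s e) \<noteq> \<one>\<^bsub>G\<^esub>"
  proof -
    show "R (d t s e) \<in> carrier G" using dC[OF st(1)] by (simp add: car)
    show "R (d t s e) \<noteq> \<one>\<^bsub>G\<^esub>"
    proof
      assume "R (d t s e) = \<one>\<^bsub>G\<^esub>"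
      then have "(d t s e, d s s e) \<in> \<delta>"
        using class_rep_eq_iff[OF \<delta> d_closed[OF stU(2,1) e] e] d_left stU e by (simp add: one R_def)
      from d_cancel_left[OF cent congruence_sym[OF \<alpha>(1) st(1)] stU(2,1,1) e this]
      show False using st(2) \<delta>s by blast
    qed
  qed
  obtain \<chi> g where g: "g \<in> carrier G" "\<not> [\<chi> g = 0] (mod int p)"
    and \<chi>: "\<And>x y. x \<in> carrier G \<Longrightarrow> y \<in> carrier G \<Longrightarrow> [\<chi> (x \<otimes>\<^bsub>G\<^esub> y) = \<chi> x + \<chi> y] (mod int p)"
    by (fact finite_p_group_character[OF G fG p ord nontriv])
  have mem: "(\<lambda>a b. \<chi> (R (d b a e))) \<in> characters p \<alpha>"
    unfolding characters_def
  proof (intro CollectI conjI allI impI)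
    fix a b c assume abc: "(a, b) \<in> \<alpha>" "(b, c) \<in> \<alpha>"
    note C = dC[OF abc(1)] dC[OF abc(2)]
    have "R (d c a e) = R (d b a e) \<otimes>\<^bsub>G\<^esub> R (d c b e)"
      using Req[OF cocycle[OF abc]] R_sum[OF CU[OF C(1)] CU[OF C(2)]] by (simp add: mul)
    then show "[\<chi> (R (d c a e)) = \<chi> (R (d b a e)) + \<chi> (R (d c b e))] (mod int p)"
      using \<chi> C by (simp add: car)
  next
    fix g v w i a b
    assume "tmop g" "v \<in> V" "w \<in> V" "(a, b) \<in> \<alpha>"
    from Req[OF shift[OF this]]
    show "[\<chi> (R (d (g (v(i := b))) (g (v(i := a))) e)) = \<chi> (R (d (g (w(i := b))) (g (w(i := a))) e))]
      (mod int p)" by simp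
  qed
  have "R (d g e e) = g" using d_right[OF carD(2)[OF g(1)] e] carD(3)[OF g(1)] by simp
  then have "(e, g) \<notin> character_kernel p \<alpha>"
    using bspec[OF _ mem, of "\<lambda>\<chi>. [\<chi> e g = 0] (mod int p)"] g(2)
    by (auto simp: character_kernel_def)
  moreover have "(e, g) \<in> \<alpha>" using C\<alpha>(1)[OF carD(1)[OF g(1)]] .
  ultimately show ?thesis by blast
qed

end

section \<open>The degree of the term operations\<close>

text \<open>
  \<open>bounded_degree U p D F\<close>: modulo \<open>p\<close>, and on assignments into \<open>U\<close>, the function \<open>F\<close> is a sum of
  functions each of which depends on at most \<open>D\<close> variables.
\<close>

inductive bounded_degree :: "'a set \<Rightarrow> nat \<Rightarrow> nat \<Rightarrow> ((nat \<Rightarrow> 'a) \<Rightarrow> int) \<Rightarrow> bool"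
  for U p D where
  few_variables: "finite S \<Longrightarrow> card S \<le> D \<Longrightarrow>
    (\<And>v w. \<forall>i. v i \<in> U \<Longrightarrow> \<forall>i. w i \<in> U \<Longrightarrow> \<forall>i\<in>S. v i = w i \<Longrightarrow> [F v = F w] (mod int p)) \<Longrightarrow>
    bounded_degree U p D F"
| add: "bounded_degree U p D F \<Longrightarrow> bounded_degree U p D G \<Longrightarrow>
    (\<And>v. \<forall>i. v i \<in> U \<Longrightarrow> [H v = F v + G v] (mod int p)) \<Longrightarrow> bounded_degree U p D H"

lemma bounded_degree_mono:
  assumes "bounded_degree U p D F" "D \<le> D'"
  shows "bounded_degree U p D' F"
  using assms(1)
proof induction
  case (few_variables S F)
  then show ?case using assms(2) by (intro bounded_degree.few_variables[of S]) auto
qed (rule bounded_degree.add)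

lemma bounded_degree_const: "bounded_degree U p D (\<lambda>_. c)"
  by (rule bounded_degree.few_variables[of "{}"]) auto

lemma bounded_degree_cong:
  assumes "bounded_degree U p D F" and "\<And>v. \<forall>i. v i \<in> U \<Longrightarrow> [G v = F v] (mod int p)"
  shows "bounded_degree U p D G"
  by (rule bounded_degree.add[OF assms(1) bounded_degree_const[of _ _ _ 0]]) (use assms(2) in simp)

lemma bounded_degree_add:
  "bounded_degree U p D F \<Longrightarrow> bounded_degree U p D G \<Longrightarrow> bounded_degree U p D (\<lambda>v. F v + G v)"
  by (erule bounded_degree.add) auto

lemma bounded_degree_sum:
  "(\<And>i. i \<in> I \<Longrightarrow> bounded_degree U p D (F i)) \<Longrightarrow> bounded_degree U p D (\<lambda>v. \<Sum>i\<in>I. F i v)"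
  by (induction I rule: infinite_finite_induct) (auto intro: bounded_degree_const bounded_degree_add)

lemma bounded_degree_mult:
  assumes "bounded_degree U p D F" "bounded_degree U p E G"
  shows "bounded_degree U p (D + E) (\<lambda>v. F v * G v)"
  using assms(1)
proof induction
  case (few_variables S F)
  note F = this
  from assms(2) show ?case
  proof induction
    case (few_variables S' G)
    show ?case
    proof (rule bounded_degree.few_variables[of "S \<union> S'"])
      show "card (S \<union> S') \<le> D + E"
        using card_Un_le[of S S'] F(2) few_variables(2) by linarith
      show "[F v * G v = F w * G w] (mod int p)"
        if "\<forall>i. v i \<in> U" "\<forall>i. w i \<in> U" "\<forall>i\<in>S \<union> S'. v i = w i" for v w
        using that by (intro cong_mult F(3) few_variables(3)) auto
    qed (use F few_variables in auto)
  next
    case (add G G' H)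
    show ?case
    proof (rule bounded_degree.add[OF add.IH])
      fix v :: "nat \<Rightarrow> 'a" assume "\<forall>i. v i \<in> U"
      from cong_scalar_left[OF add.hyps(3)[OF this], of "F v"]
      show "[F v * H v = F v * G v + F v * G' v] (mod int p)" by (simp add: algebra_simps)
    qed
  qed
next
  case (add F F' H)
  show ?case
  proof (rule bounded_degree.add[OF add.IH])
    fix v :: "nat \<Rightarrow> 'a" assume "\<forall>i. v i \<in> U"
    from cong_scalar_right[OF add.hyps(3)[OF this], of "G v"]
    show "[H v * G v = F v * G v + F' v * G v] (mod int p)" by (simp add: algebra_simps)
  qed
qed

lemma bounded_degree_prod:
  assumes "finite I" "\<And>i. i \<in> I \<Longrightarrow> bounded_degree U p D (F i)"
  shows "bounded_degree U p (card I * D) (\<lambda>v. \<Prod>i\<in>I. F i v)"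
  using assms
proof (induction I)
  case (insert i I)
  then have "bounded_degree U p (D + card I * D) (\<lambda>v. F i v * (\<Prod>i\<in>I. F i v))"
    by (intro bounded_degree_mult) auto
  then show ?case using insert by simp
qed (simp add: bounded_degree_const)

context finite_algebra
begin

text \<open>This stands for a coordinatization of A/\<alpha> over the integers modulo p: coordinates
  factor through A/\<alpha>, they separate its points, and they have degree at most D along every
  term operation.\<close>

definition separated :: "nat \<Rightarrow> nat \<Rightarrow> ('a \<times> 'a) set \<Rightarrow> bool" where
  "separated p D \<alpha> \<longleftrightarrow> (\<forall>a\<in>U. \<forall>b\<in>U. (a, b) \<notin> \<alpha> \<longrightarrow>
     (\<exists>\<kappa> :: 'a \<Rightarrow> int. (\<forall>x y. (x, y) \<in> \<alpha> \<longrightarrow> [\<kappa> x = \<kappa> y] (mod int p)) \<and>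
        (\<forall>t. tmop t \<longrightarrow> bounded_degree U p D (\<lambda>v. \<kappa> (t v))) \<and> \<not> [\<kappa> a = \<kappa> b] (mod int p)))"

lemma separated_mono:
  assumes sep: "separated p D \<alpha>" and le: "D \<le> D'"
  shows "separated p D' \<alpha>"
  unfolding separated_def
proof (intro ballI impI)
  fix a b assume "a \<in> U" "b \<in> U" "(a, b) \<notin> \<alpha>"
  then obtain \<kappa> :: "'a \<Rightarrow> int"
    where \<kappa>: "\<forall>x y. (x, y) \<in> \<alpha> \<longrightarrow> [\<kappa> x = \<kappa> y] (mod int p)"
      "\<And>t. tmop t \<Longrightarrow> bounded_degree U p D (\<lambda>v. \<kappa> (t v))" "\<not> [\<kappa> a = \<kappa> b] (mod int p)"
    using sep unfolding separated_def by blast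
  have "\<forall>t. tmop t \<longrightarrow> bounded_degree U p D' (\<lambda>v. \<kappa> (t v))"
    using bounded_degree_mono[OF \<kappa>(2) le] by blast
  with \<kappa>(1,3) show "\<exists>\<kappa> :: 'a \<Rightarrow> int. (\<forall>x y. (x, y) \<in> \<alpha> \<longrightarrow> [\<kappa> x = \<kappa> y] (mod int p)) \<and>
      (\<forall>t. tmop t \<longrightarrow> bounded_degree U p D' (\<lambda>v. \<kappa> (t v))) \<and> \<not> [\<kappa> a = \<kappa> b] (mod int p)"
    by blast
qed

text \<open>A Lagrange interpolation product. Each other class contributes one factor that is 1 at
  \<xi> and 0 on that class; there are at most \<open>card U - 1\<close> of them, each of degree at
  most D.\<close>

lemma class_indicator:
  assumes sep: "separated p D \<alpha>" and \<alpha>: "\<alpha> \<in> Con" and p: "prime p" and \<xi>: "\<xi> \<in> U"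
  obtains ind :: "'a \<Rightarrow> int"
    where "\<And>x. x \<in> U \<Longrightarrow> [ind x = (if (\<xi>, x) \<in> \<alpha> then 1 else 0)] (mod int p)"
      and "\<And>t. tmop t \<Longrightarrow> bounded_degree U p ((card U - 1) * D) (\<lambda>v. ind (t v))"
proof -
  let ?u = "class_rep \<alpha>"
  define R where "R = ?u ` U - {?u \<xi>}"
  have uU: "?u x \<in> U" if "x \<in> U" for x
    using class_rep[OF \<alpha> that] congruence_subset[OF \<alpha>] by auto
  have uu: "?u (?u x) = ?u x" if "x \<in> U" for x
    using class_rep_eq[OF \<alpha> class_rep[OF \<alpha> that]] by simp
  have RU: "\<eta> \<in> U" if "\<eta> \<in> R" for \<eta> using that uU by (auto simp: R_def)
  have R\<xi>: "(\<xi>, \<eta>) \<notin> \<alpha>" if "\<eta> \<in> R" for \<eta>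
    using that class_rep_eq[OF \<alpha>, of \<xi> \<eta>] uu by (auto simp: R_def)
  have "\<exists>\<kappa> :: 'a \<Rightarrow> int. (\<forall>x y. (x, y) \<in> \<alpha> \<longrightarrow> [\<kappa> x = \<kappa> y] (mod int p)) \<and>
      (\<forall>t. tmop t \<longrightarrow> bounded_degree U p D (\<lambda>v. \<kappa> (t v))) \<and>
      [\<kappa> \<xi> = 1] (mod int p) \<and> [\<kappa> \<eta> = 0] (mod int p)" if \<eta>: "\<eta> \<in> R" for \<eta>
  proof -
    obtain \<kappa> :: "'a \<Rightarrow> int" where \<kappa>: "\<And>x y. (x, y) \<in> \<alpha> \<Longrightarrow> [\<kappa> x = \<kappa> y] (mod int p)"
        "\<And>t. tmop t \<Longrightarrow> bounded_degree U p D (\<lambda>v. \<kappa> (t v))" "\<not> [\<kappa> \<xi> = \<kappa> \<eta>] (mod int p)"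
      using sep \<xi> RU[OF \<eta>] R\<xi>[OF \<eta>] unfolding separated_def by blast
    have "coprime (\<kappa> \<xi> - \<kappa> \<eta>) (int p)"
    proof -
      have "\<not> int p dvd \<kappa> \<xi> - \<kappa> \<eta>" using \<kappa>(3) by (simp add: cong_iff_dvd_diff)
      moreover have "prime (int p)" using p by simp
      ultimately show ?thesis using prime_imp_coprime coprime_commute by blast
    qed
    then obtain c where c: "[(\<kappa> \<xi> - \<kappa> \<eta>) * c = 1] (mod int p)"
      using cong_solve_coprime_int by blast
    \<comment> \<open>An affine normalisation; the inverse c exists because p is prime.\<close>
    let ?\<kappa> = "\<lambda>x. (\<kappa> x - \<kappa> \<eta>) * c"
    have "[?\<kappa> x = ?\<kappa> y] (mod int p)" if "(x, y) \<in> \<alpha>" for x y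
      by (intro cong_mult cong_diff \<kappa>(1) that cong_refl)
    moreover have "bounded_degree U p D (\<lambda>v. ?\<kappa> (t v))" if "tmop t" for t
      using bounded_degree_mult[OF bounded_degree_add[OF \<kappa>(2)[OF that]
            bounded_degree_const[of _ _ _ "- \<kappa> \<eta>"]] bounded_degree_const[of _ _ 0 c]] by simp
    ultimately show ?thesis using c by (intro exI[of _ ?\<kappa>]) auto
  qed
  then obtain \<kappa> :: "'a \<Rightarrow> 'a \<Rightarrow> int"
    where \<kappa>: "\<And>\<eta> x y. \<eta> \<in> R \<Longrightarrow> (x, y) \<in> \<alpha> \<Longrightarrow> [\<kappa> \<eta> x = \<kappa> \<eta> y] (mod int p)"
      "\<And>\<eta> t. \<eta> \<in> R \<Longrightarrow> tmop t \<Longrightarrow> bounded_degree U p D (\<lambda>v. \<kappa> \<eta> (t v))"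
      "\<And>\<eta>. \<eta> \<in> R \<Longrightarrow> [\<kappa> \<eta> \<xi> = 1] (mod int p)" "\<And>\<eta>. \<eta> \<in> R \<Longrightarrow> [\<kappa> \<eta> \<eta> = 0] (mod int p)"
    by metis
  have fR: "finite R" using fin by (simp add: R_def)
  have cR: "card R \<le> card U - 1"
    using card_image_le[OF fin, of ?u] \<xi> fin by (simp add: R_def)
  show ?thesis
  proof (rule that[of "\<lambda>x. \<Prod>\<eta>\<in>R. \<kappa> \<eta> x"])
    fix x assume x: "x \<in> U"
    show "[(\<Prod>\<eta>\<in>R. \<kappa> \<eta> x) = (if (\<xi>, x) \<in> \<alpha> then 1 else 0)] (mod int p)"
    proof (cases "(\<xi>, x) \<in> \<alpha>")
      case True
      have "[(\<Prod>\<eta>\<in>R. \<kappa> \<eta> x) = (\<Prod>\<eta>\<in>R. 1)] (mod int p)"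
        by (rule cong_prod) (use \<kappa>(1)[OF _ congruence_sym[OF \<alpha> True]] \<kappa>(3) cong_trans in blast)
      then show ?thesis using True by simp
    next
      case False
      then have uR: "?u x \<in> R"
        using class_rep_eq_iff[OF \<alpha> \<xi> x] x by (auto simp: R_def)
      have "[\<kappa> (?u x) x = 0] (mod int p)"
        using \<kappa>(1)[OF uR class_rep[OF \<alpha> x]] \<kappa>(4)[OF uR] cong_trans by blast
      then have "int p dvd (\<Prod>\<eta>\<in>R. \<kappa> \<eta> x)"
        using fR uR by (metis cong_0_iff dvd_prodI dvd_trans)
      then show ?thesis using False by (simp add: cong_0_iff)
    qed
  next
    fix t assume "tmop t"
    then have "bounded_degree U p (card R * D) (\<lambda>v. \<Prod>\<eta>\<in>R. \<kappa> \<eta> (t v))"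
      by (intro bounded_degree_prod fR \<kappa>(2))
    then show "bounded_degree U p ((card U - 1) * D) (\<lambda>v. \<Prod>\<eta>\<in>R. \<kappa> \<eta> (t v))"
      by (rule bounded_degree_mono) (use cR in simp)
  qed
qed

text \<open>Interpolation in one argument at a time: \<Phi> is the sum over the representatives
  \<xi> of the indicator of \<xi> times \<Phi> with \<xi> inserted. Each argument costs the degree
  of one indicator.\<close>

lemma bounded_degree_class_function:
  assumes sep: "separated p D \<alpha>" and \<alpha>: "\<alpha> \<in> Con" and p: "prime p"
    and ts: "\<And>t. t \<in> set ts \<Longrightarrow> tmop t"
  shows "bounded_degree U p (length ts * ((card U - 1) * D))
    (\<lambda>v. \<Phi> (map (\<lambda>t. class_rep \<alpha> (t v)) ts))"
  using ts
proof (induction ts arbitrary: \<Phi>)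
  case (Cons t ts)
  let ?u = "class_rep \<alpha>" and ?B = "(card U - 1) * D"
  have t: "tmop t" using Cons.prems by simp
  have uU: "?u x \<in> U" if "x \<in> U" for x
    using class_rep[OF \<alpha> that] congruence_subset[OF \<alpha>] by auto
  have "\<forall>\<xi>\<in>U. \<exists>ind. (\<forall>x\<in>U. [ind x = (if (\<xi>, x) \<in> \<alpha> then 1 else 0)] (mod int p)) \<and>
      (\<forall>t. tmop t \<longrightarrow> bounded_degree U p ?B (\<lambda>v. ind (t v)))"
    using class_indicator[OF sep \<alpha> p] by metis
  from bchoice[OF this] obtain ind
    where ind: "\<And>\<xi> x. \<xi> \<in> U \<Longrightarrow> x \<in> U \<Longrightarrow> [ind \<xi> x = (if (\<xi>, x) \<in> \<alpha> then 1 else 0)] (mod int p)"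
      "\<And>\<xi> t. \<xi> \<in> U \<Longrightarrow> tmop t \<Longrightarrow> bounded_degree U p ?B (\<lambda>v. ind \<xi> (t v))"
    by blast
  let ?R = "?u ` U"
  let ?F = "\<lambda>v. \<Sum>\<xi>\<in>?R. ind \<xi> (t v) * \<Phi> (\<xi> # map (\<lambda>t. ?u (t v)) ts)"
  have "bounded_degree U p (?B + length ts * ?B) ?F"
  proof (rule bounded_degree_sum)
    fix \<xi> assume "\<xi> \<in> ?R"
    then have "\<xi> \<in> U" using uU by auto
    then show "bounded_degree U p (?B + length ts * ?B)
        (\<lambda>v. ind \<xi> (t v) * \<Phi> (\<xi> # map (\<lambda>t. ?u (t v)) ts))"
      using Cons.prems by (intro bounded_degree_mult ind(2) t Cons.IH[of "\<lambda>xs. \<Phi> (\<xi> # xs)"]) auto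
  qed
  moreover have "[\<Phi> (map (\<lambda>t. ?u (t v)) (t # ts)) = ?F v] (mod int p)" if v: "\<forall>i. v i \<in> U" for v
  proof -
    let ?c = "\<lambda>\<xi>. \<Phi> (\<xi> # map (\<lambda>t. ?u (t v)) ts)"
    have tv: "t v \<in> U" using tmop_closed[OF t] v by simp
    have "[?F v = (\<Sum>\<xi>\<in>?R. (if \<xi> = ?u (t v) then 1 else 0) * ?c \<xi>)] (mod int p)"
    proof (intro cong_sum cong_mult cong_refl)
      fix \<xi> assume "\<xi> \<in> ?R"
      then obtain x where x: "x \<in> U" "\<xi> = ?u x" by blast
      have "(\<xi>, t v) \<in> \<alpha> \<longleftrightarrow> \<xi> = ?u (t v)"
        using class_rep_eq_iff[OF \<alpha> uU[OF x(1)] tv] class_rep_eq[OF \<alpha> class_rep[OF \<alpha> x(1)]] x(2)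
        by simp
      then show "[ind \<xi> (t v) = (if \<xi> = ?u (t v) then 1 else 0)] (mod int p)"
        using ind(1)[OF uU[OF x(1)] tv] x(2) by simp
    qed
    also have "(\<Sum>\<xi>\<in>?R. (if \<xi> = ?u (t v) then 1 else 0) * ?c \<xi>) =
        (\<Sum>\<xi>\<in>?R. if \<xi> = ?u (t v) then ?c \<xi> else 0)"
      by (intro sum.cong) auto
    also have "\<dots> = ?c (?u (t v))"
      using fin tv by (subst sum.delta) auto
    finally show ?thesis by (simp add: cong_sym)
  qed
  ultimately show ?case by (auto intro: bounded_degree_cong)
qed (simp add: bounded_degree_const)

text \<open>Compare the arguments X of an operation g with the representatives Y of their
  \<alpha>-classes. The coordinate of g X is that of g Y plus \<chi> (g Y) (g X). The former is a
  function of classes and obeys the interpolation bound; the latter telescopes into coordinates of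
  the arguments, to which induction applies. A sum does not raise the degree.\<close>

lemma separated_character_kernel:
  assumes sep: "separated p D \<alpha>" and \<alpha>: "\<alpha> \<in> Con" and p: "prime p"
    and m: "m \<ge> 1" "\<And>f n. \<Sigma> f = Some n \<Longrightarrow> n \<le> m" and q: "card U > 1"
  shows "separated p (max 1 (m * (card U - 1) * D)) (character_kernel p \<alpha>)"
proof -
  let ?u = "class_rep \<alpha>"
  \<comment> \<open>The 1 is the degree of a variable; it takes over when D = 0, as happens at the
    total relation.\<close>
  define E where "E = max 1 (m * (card U - 1) * D)"
  have "1 \<le> m * (card U - 1)" using m(1) q by simp
  from mult_le_mono1[OF this, of D] have "D \<le> m * (card U - 1) * D" by simp
  then have DE: "D \<le> E" unfolding E_def by linarith
  have uU: "?u x \<in> U" "(?u x, x) \<in> \<alpha>" "?u (?u x) = ?u x" if "x \<in> U" for x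
    using class_rep[OF \<alpha> that] congruence_subset[OF \<alpha>] congruence_sym[OF \<alpha>]
      class_rep_eq[OF \<alpha> class_rep[OF \<alpha> that]] by auto
  obtain e where e: "e \<in> U" using alg by (auto simp: is_algebra_def)
  \<comment> \<open>The induction ranges over all characters, since the i-th argument is measured by
    another character \<psi> i.\<close>
  have main: "bounded_degree U p E (\<lambda>v. \<chi> (?u (trm_val A v t)) (trm_val A v t))"
    if "wf_trm \<Sigma> t" "\<chi> \<in> characters p \<alpha>" for t :: "(nat, 'f) trm" and \<chi>
    using that
  proof (induction t arbitrary: \<chi>)
    case (Var i)
    show ?case by (rule bounded_degree.few_variables[of "{i}"]) (auto simp: E_def)
  next
    case (Fun f ts)
    let ?n = "length ts"
    have f: "\<Sigma> f = Some ?n" using Fun.prems by simp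
    have wf: "wf_trm \<Sigma> t" if "t \<in> set ts" for t using Fun.prems that by (simp add: list_all_iff)
    define g where "g = (\<lambda>v. oper A f (map v [0..<?n]))"
    have g: "tmop g" unfolding g_def by (rule tmop_oper[OF f])
    have eV: "(\<lambda>_. e) \<in> V" using e by simp
    \<comment> \<open>\<chi> seen through the i-th place of f; by \<open>character_shift\<close> its
      values modulo p do not depend on the filler e.\<close>
    define \<psi> where "\<psi> i = (\<lambda>a b. \<chi> (g ((\<lambda>_. e)(i := a))) (g ((\<lambda>_. e)(i := b))))" for i :: nat
    have \<psi>: "\<psi> i \<in> characters p \<alpha>" for i
      unfolding \<psi>_def by (rule character_comp[OF \<alpha> Fun.prems(2) g eV])
    define \<Phi> where "\<Phi> zs = \<chi> (?u (oper A f zs)) (oper A f zs)" for zs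
    let ?T = "map (\<lambda>t v. trm_val A v t) ts"
    have "bounded_degree U p (length ?T * ((card U - 1) * D)) (\<lambda>v. \<Phi> (map (\<lambda>t. ?u (t v)) ?T))"
      by (rule bounded_degree_class_function[OF sep \<alpha> p]) (use wf tmop_trm in auto)
    moreover have "length ?T * ((card U - 1) * D) \<le> E"
      using m(2)[OF f] by (auto simp: E_def le_max_iff_disj)
    ultimately have 1: "bounded_degree U p E (\<lambda>v. \<Phi> (map (\<lambda>t. ?u (t v)) ?T))"
      by (rule bounded_degree_mono)
    have 2: "bounded_degree U p E
        (\<lambda>v. \<Sum>i<?n. \<psi> i (?u (trm_val A v (ts ! i))) (trm_val A v (ts ! i)))"
      by (rule bounded_degree_sum) (use Fun.IH wf \<psi> in auto)
    show ?case
    proof (rule bounded_degree.add[OF 1 2])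
      fix v :: "nat \<Rightarrow> 'a" assume v: "\<forall>i. v i \<in> U"
      let ?y = "\<lambda>i. trm_val A v (ts ! i)"
      have yU: "?y i \<in> U" if "i < ?n" for i
        using tmop_closed[OF tmop_trm[OF wf[OF nth_mem[OF that]]]] v by simp
      define X where "X i = (if i < ?n then ?y i else e)" for i
      define Y where "Y i = (if i < ?n then ?u (?y i) else e)" for i
      have XV: "X \<in> V" "Y \<in> V" using yU uU e by (auto simp: X_def Y_def)
      have XY: "(Y i, X i) \<in> \<alpha>" for i
        using uU yU congruence_refl[OF \<alpha> e] by (simp add: X_def Y_def)
      have tel: "[\<chi> (g Y) (g X) = (\<Sum>i<?n. \<psi> i (Y i) (X i))] (mod int p)"
      proof -
        have "(\<lambda>i. if i < ?n then X i else Y i) = X" by (auto simp: X_def Y_def)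
        then show ?thesis
          using character_telescope[OF \<alpha> Fun.prems(2) g eV XV(2,1), where n = ?n, OF XY]
          by (simp add: \<psi>_def)
      qed
      have gg: "(g Y, g X) \<in> \<alpha>" by (rule tmop_congruence[OF \<alpha> g XV(2,1) XY])
      have gU: "g X \<in> U" "g Y \<in> U" by (rule tmop_closed[OF g XV(1)], rule tmop_closed[OF g XV(2)])
      have "?u (g X) = ?u (g Y)" using class_rep_eq[OF \<alpha> gg] by simp
      then have "[\<chi> (?u (g X)) (g X) = \<chi> (?u (g Y)) (g Y) + \<chi> (g Y) (g X)] (mod int p)"
        using character_add[OF Fun.prems(2) uU(2)[OF gU(2)] gg] by simp
      from cong_trans[OF this cong_add[OF cong_refl tel]]
      have "[\<chi> (?u (g X)) (g X) = \<chi> (?u (g Y)) (g Y) + (\<Sum>i<?n. \<psi> i (Y i) (X i))] (mod int p)" .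
      moreover have "map X [0..<?n] = map (trm_val A v) ts" "map Y [0..<?n] = map (\<lambda>t. ?u (t v)) ?T"
        unfolding X_def Y_def by (auto intro!: nth_equalityI)
      then have "g X = trm_val A v (Fun f ts)" "g Y = oper A f (map (\<lambda>t. ?u (t v)) ?T)"
        unfolding g_def trm_val.simps by (simp_all only:)
      moreover have "(\<Sum>i<?n. \<psi> i (Y i) (X i)) = (\<Sum>i<?n. \<psi> i (?u (?y i)) (?y i))"
        by (intro sum.cong) (auto simp: X_def Y_def)
      ultimately show "[\<chi> (?u (trm_val A v (Fun f ts))) (trm_val A v (Fun f ts)) =
          \<Phi> (map (\<lambda>t. ?u (t v)) ?T) + (\<Sum>i<?n. \<psi> i (?u (?y i)) (?y i))] (mod int p)"
        unfolding \<Phi>_def by (simp only:)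
    qed
  qed
  show ?thesis
    unfolding separated_def E_def[symmetric]
  proof (intro ballI impI)
    fix a b assume ab: "a \<in> U" "b \<in> U" "(a, b) \<notin> character_kernel p \<alpha>"
    show "\<exists>\<kappa> :: 'a \<Rightarrow> int. (\<forall>x y. (x, y) \<in> character_kernel p \<alpha> \<longrightarrow> [\<kappa> x = \<kappa> y] (mod int p)) \<and>
        (\<forall>t. tmop t \<longrightarrow> bounded_degree U p E (\<lambda>v. \<kappa> (t v))) \<and> \<not> [\<kappa> a = \<kappa> b] (mod int p)"
    proof (cases "(a, b) \<in> \<alpha>")
      case False
      then obtain \<kappa> :: "'a \<Rightarrow> int" where \<kappa>: "\<forall>x y. (x, y) \<in> \<alpha> \<longrightarrow> [\<kappa> x = \<kappa> y] (mod int p)"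
        "\<forall>t. tmop t \<longrightarrow> bounded_degree U p D (\<lambda>v. \<kappa> (t v))" "\<not> [\<kappa> a = \<kappa> b] (mod int p)"
        using sep ab unfolding separated_def by blast
      have "(x, y) \<in> \<alpha>" if "(x, y) \<in> character_kernel p \<alpha>" for x y
        using that by (auto simp: character_kernel_def)
      then show ?thesis using \<kappa> DE bounded_degree_mono by blast
    next
      case True
      then obtain \<chi> where \<chi>: "\<chi> \<in> characters p \<alpha>" "\<not> [\<chi> a b = 0] (mod int p)"
        using ab(3) by (auto simp: character_kernel_def)
      \<comment> \<open>The displacement of x from its class representative: it refines \<alpha> by
        the value of \<chi>, yet stays constant modulo p on classes of the kernel.\<close>
      let ?\<kappa> = "\<lambda>x. \<chi> (?u x) x"
      have add: "[?\<kappa> y = ?\<kappa> x + \<chi> x y] (mod int p)" if "(x, y) \<in> \<alpha>" for x y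
      proof -
        have "x \<in> U" using that congruence_subset[OF \<alpha>] by auto
        then show ?thesis
          using character_add[OF \<chi>(1) uU(2) that] class_rep_eq[OF \<alpha> that] by simp
      qed
      have "[?\<kappa> x = ?\<kappa> y] (mod int p)" if "(x, y) \<in> character_kernel p \<alpha>" for x y
      proof -
        have "(x, y) \<in> \<alpha>" "[\<chi> x y = 0] (mod int p)"
          using that \<chi>(1) by (auto simp: character_kernel_def)
        then have "[?\<kappa> y = ?\<kappa> x + 0] (mod int p)"
          using add cong_add[OF cong_refl] cong_trans by blast
        then show ?thesis by (simp add: cong_sym)
      qed
      moreover have "bounded_degree U p E (\<lambda>v. ?\<kappa> (t v))" if t: "tmop t" for t
      proof -
        obtain s where s: "wf_trm \<Sigma> s" "\<And>v. v \<in> V \<Longrightarrow> t v = trm_val A v s"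
          using t unfolding termop_def by auto
        show ?thesis by (rule bounded_degree_cong[OF main[OF s(1) \<chi>(1)]]) (simp add: s(2))
      qed
      moreover have "\<not> [?\<kappa> a = ?\<kappa> b] (mod int p)"
      proof
        assume "[?\<kappa> a = ?\<kappa> b] (mod int p)"
        with add[OF True] have "[?\<kappa> a = ?\<kappa> a + \<chi> a b] (mod int p)" by (blast intro: cong_trans)
        then show False using \<chi>(2) by (simp add: cong_iff_dvd_diff)
      qed
      ultimately show ?thesis by (intro exI[of _ ?\<kappa>] conjI allI impI) blast+
    qed
  qed
qed

section \<open>The descending chain and the height\<close>

lemma finite_congruences: "finite Con"
  by (rule finite_subset[of _ "Pow (U \<times> U)"]) (use congruence_subset fin in auto)

lemma card_chain_le_height:
  assumes "C \<subseteq> Con" "chain\<^sub>\<subseteq> C"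
  shows "card C \<le> con_height \<Sigma> A + 1"
proof -
  have "finite (card ` {C. C \<subseteq> Con \<and> chain\<^sub>\<subseteq> C})"
    using finite_congruences by (auto intro!: finite_imageI)
  then have "card C \<le> Max (card ` {C. C \<subseteq> Con \<and> chain\<^sub>\<subseteq> C})"
    using assms by (intro Max_ge) auto
  then show ?thesis unfolding con_height_def by linarith
qed

end

context nilpotent_malcev
begin

text \<open>The chain C records the congruences passed so far. Each strict step adds a member, so
  after i steps C has i + 1 elements and i is at most the height.\<close>

lemma separated_equality:
  assumes p: "prime p" and q: "card U = p ^ r" "card U > 1"
    and m: "m \<ge> 1" "\<And>f n. \<Sigma> f = Some n \<Longrightarrow> n \<le> m"
  shows "\<exists>\<alpha>. separated p ((m * (card U - 1)) ^ (con_height \<Sigma> A - 1)) \<alpha> \<and> \<alpha> \<subseteq> equality_rel A"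
proof -
  define k where "k = m * (card U - 1)"
  \<comment> \<open>The degree after i steps is 0, 1, k, k^2, and so on: the first step only reaches
    1, so h steps give k^(h - 1).\<close>
  define D where "D i = (if i = 0 then 0 else k ^ (i - 1))" for i :: nat
  have k: "k \<ge> 1" using m(1) q(2) by (simp add: k_def)
  have DS: "max 1 (m * (card U - 1) * D i) = D (Suc i)" for i
    unfolding k_def[symmetric] using k by (cases i) (auto simp: D_def max_def)
  have "\<exists>\<alpha> i. i \<le> con_height \<Sigma> A \<and> separated p (D i) \<alpha> \<and> \<alpha> \<subseteq> equality_rel A"
    if "\<alpha> \<in> Con" "C \<subseteq> Con" "chain\<^sub>\<subseteq> C" "card C = Suc i" "\<forall>\<gamma>\<in>C. \<alpha> \<subseteq> \<gamma>" "\<alpha> \<in> C"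
      "separated p (D i) \<alpha>" for \<alpha> C i
    using that
  proof (induction "card \<alpha>" arbitrary: \<alpha> C i rule: less_induct)
    case less
    show ?case
    proof (cases "\<alpha> \<subseteq> equality_rel A")
      case True
      then show ?thesis using less.prems card_chain_le_height[of C] by force
    next
      case False
      let ?\<beta> = "character_kernel p \<alpha>"
      have \<beta>: "?\<beta> \<in> Con" by (rule character_kernel_congruence[OF less.prems(1)])
      have lt: "?\<beta> \<subset> \<alpha>"
        using character_kernel_less[OF less.prems(1) False p q(1)] by (auto simp: character_kernel_def)
      have "finite \<alpha>"
        using congruence_subset[OF less.prems(1)] fin by (meson finite_SigmaI finite_subset)
      then have "card ?\<beta> < card \<alpha>" using lt by (rule psubset_card_mono)
      moreover have "?\<beta> \<notin> C" using lt less.prems(5) by auto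
      moreover have "finite C" using less.prems(2) finite_congruences finite_subset by blast
      moreover have "?\<beta> \<subseteq> \<gamma>" if "\<gamma> \<in> insert ?\<beta> C" for \<gamma>
        using that lt less.prems(5) by blast
      moreover from this have "chain\<^sub>\<subseteq> (insert ?\<beta> C)"
        using less.prems(3) unfolding chain_subset_def by blast
      moreover have "separated p (D (Suc i)) ?\<beta>"
        using separated_character_kernel[OF less.prems(7,1) p m(1) _ q(2)] m(2) unfolding DS by blast
      ultimately show ?thesis
        using less.prems(2,4) \<beta> by (intro less.hyps[of ?\<beta> "insert ?\<beta> C" "Suc i"]) auto
    qed
  qed
  \<comment> \<open>No pair lies outside the total relation, so degree 0 is vacuous at the
    start.\<close>
  from this[of "total_rel A" "{total_rel A}" 0]
  obtain \<alpha> i where i: "i \<le> con_height \<Sigma> A" "separated p (D i) \<alpha>" "\<alpha> \<subseteq> equality_rel A"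
    using total_rel_congruence[OF alg] by (auto simp: separated_def total_rel_def chain_subset_def)
  have "D i \<le> k ^ (con_height \<Sigma> A - 1)"
    using i(1) k by (auto simp: D_def intro: power_increasing)
  then have "separated p (k ^ (con_height \<Sigma> A - 1)) \<alpha>"
    by (rule separated_mono[OF i(2)])
  then show ?thesis using i(3) by (auto simp: k_def)
qed

end

section \<open>Supernilpotency\<close>

lemma sum_Pow_insert:
  assumes "finite K" "b \<notin> K"
  shows "(\<Sum>T\<in>Pow (insert b K). f T) = (\<Sum>T\<in>Pow K. f T + f (insert b T))"
proof -
  have "inj_on (insert b) (Pow K)"
    using assms(2) by (intro inj_onI) (metis Diff_insert_absorb PowD subsetD)
  then have "(\<Sum>T\<in>insert b ` Pow K. f T) = (\<Sum>T\<in>Pow K. f (insert b T))"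
    by (simp add: sum.reindex)
  moreover have "Pow K \<inter> insert b ` Pow K = {}" using assms(2) by auto
  ultimately show ?thesis
    using assms(1) by (simp add: Pow_insert sum.union_disjoint sum.distrib)
qed

text \<open>Here b assigns each variable to a block. A summand with at most D variables misses some
  block k of K, since K has more than D members, and then the terms for T and
  \<open>insert k T\<close> cancel.\<close>

lemma bounded_degree_alternating_sum:
  assumes "bounded_degree U p D F" and K: "finite K" "D < card K"
    and v: "\<forall>i. v i \<in> U" and w: "\<forall>i. w i \<in> U"
  shows "[(\<Sum>T\<in>Pow K. (-1) ^ card T * F (\<lambda>i. if b i \<in> T then w i else v i)) = 0] (mod int p)"
  using assms(1)
proof induction
  case (few_variables S F)
  let ?v = "\<lambda>T i. if b i \<in> T then w i else v i"
  have "\<not> K \<subseteq> b ` S"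
    using card_image_le[OF few_variables(1), of b] few_variables(1,2) K(2) card_mono[of "b ` S" K] by fastforce
  then obtain k where k: "k \<in> K" "k \<notin> b ` S" by blast
  define K' where "K' = K - {k}"
  have K': "K = insert k K'" "k \<notin> K'" "finite K'" using k(1) K(1) by (auto simp: K'_def)
  have V: "\<forall>i. ?v T i \<in> U" for T using v w by simp
  have "[(\<Sum>T\<in>Pow K'. (-1) ^ card T * F (?v T) + (-1) ^ card (insert k T) * F (?v (insert k T))) =
      (\<Sum>T\<in>Pow K'. 0)] (mod int p)"
  proof (rule cong_sum)
    fix T assume "T \<in> Pow K'"
    then have "finite T" "k \<notin> T" using K' finite_subset[of T K'] by auto
    then have "card (insert k T) = Suc (card T)" by simp
    moreover have "[F (?v T) = F (?v (insert k T))] (mod int p)"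
      by (rule few_variables(3)[OF V V]) (use k(2) in auto)
    then have "[(-1) ^ card T * (F (?v T) - F (?v (insert k T))) = (-1) ^ card T * 0] (mod int p)"
      by (intro cong_mult cong_refl) (simp add: cong_iff_dvd_diff)
    ultimately show "[(-1) ^ card T * F (?v T) + (-1) ^ card (insert k T) * F (?v (insert k T)) = 0]
        (mod int p)"
      by (simp add: algebra_simps)
  qed
  then show ?case unfolding K'(1) sum_Pow_insert[OF K'(3,2)] by simp
next
  case (add F G H)
  let ?v = "\<lambda>T i. if b i \<in> T then w i else v i"
  have "[(\<Sum>T\<in>Pow K. (-1) ^ card T * H (?v T)) =
      (\<Sum>T\<in>Pow K. (-1) ^ card T * (F (?v T) + G (?v T)))] (mod int p)"
    by (intro cong_sum cong_mult cong_refl add.hyps) (use v w in simp)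
  also have "(\<Sum>T\<in>Pow K. (-1) ^ card T * (F (?v T) + G (?v T))) =
      (\<Sum>T\<in>Pow K. (-1) ^ card T * F (?v T)) + (\<Sum>T\<in>Pow K. (-1) ^ card T * G (?v T))"
    by (simp add: distrib_left sum.distrib)
  also have "[\<dots> = 0 + 0] (mod int p)" by (intro cong_add add.IH)
  finally show ?case by simp
qed

text \<open>The list of replicated indices records the block of each position. It turns a blockwise
  choice between tuples into the positionwise hybrids of the alternating sums.\<close>

lemma concat_map_choice:
  assumes "\<And>i j. i \<in> set is \<Longrightarrow> j \<in> {1, 2} \<Longrightarrow> length (a i j) = ns i" and "f \<in> set is \<rightarrow> {1, 2 :: nat}"
    and "j < length (concat (map (\<lambda>i. replicate (ns i) i) is))"
  shows "concat (map (\<lambda>i. a i (f i)) is) ! j =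
    (if f (concat (map (\<lambda>i. replicate (ns i) i) is) ! j) = 2 then concat (map (\<lambda>i. a i 2) is) ! j
     else concat (map (\<lambda>i. a i 1) is) ! j)"
  using assms
proof (induction "is" arbitrary: j)
  case (Cons i "is")
  have len: "length (a i (f i)) = ns i" "length (a i 1) = ns i" "length (a i 2) = ns i"
    using Cons.prems(1,2) by (auto simp: Pi_iff)
  show ?case
  proof (cases "j < ns i")
    case True
    have "f i = 1 \<or> f i = 2" using Cons.prems(2) by auto
    then show ?thesis using True len by (auto simp: nth_append)
  next
    case False
    then have "j - ns i < length (concat (map (\<lambda>i. replicate (ns i) i) is))"
      using Cons.prems(3) by simp
    from Cons.IH[OF _ _ this] Cons.prems(1,2) False len show ?thesis
      by (simp add: nth_append Pi_iff)
  qed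
qed simp

context finite_algebra
begin

text \<open>In the alternating sum over the s + 1 blocks, pair T with
  \<open>insert (Suc s) T\<close>. The hypothesis cancels every pair except that of the full set
  {1..s}, so a separating coordinate cannot distinguish the last two values.\<close>

lemma separated_last_block:
  assumes sep: "separated p s \<alpha>" and \<alpha>: "\<alpha> \<subseteq> equality_rel A" and g: "tmop g"
    and v: "v \<in> V" and w: "w \<in> V"
    and eq: "\<And>T. T \<subset> {1..s} \<Longrightarrow> g (\<lambda>i. if b i \<in> T then w i else v i) =
      g (\<lambda>i. if b i \<in> insert (Suc s) T then w i else v i)"
  shows "g (\<lambda>i. if b i \<in> {1..s} then w i else v i) = g (\<lambda>i. if b i \<in> {1..Suc s} then w i else v i)"
proof (rule ccontr)
  let ?v = "\<lambda>T i. if b i \<in> T then w i else v i"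
  assume ne: "g (?v {1..s}) \<noteq> g (?v {1..Suc s})"
  have V: "?v T \<in> V" for T using v w by simp
  have "(g (?v {1..s}), g (?v {1..Suc s})) \<notin> \<alpha>" using ne \<alpha> by (auto simp: equality_rel_def)
  moreover have "g (?v T) \<in> U" for T by (rule tmop_closed[OF g V])
  ultimately obtain \<kappa> :: "'a \<Rightarrow> int"
    where \<kappa>: "bounded_degree U p s (\<lambda>v. \<kappa> (g v))" "\<not> [\<kappa> (g (?v {1..s})) = \<kappa> (g (?v {1..Suc s}))] (mod int p)"
    using sep g unfolding separated_def by blast
  have ins: "insert (Suc s) {1..s} = {1..Suc s}" by auto
  have card: "card (insert (Suc s) T) = Suc (card T)" if "T \<in> Pow {1..s}" for T
  proof -
    have "finite T" "Suc s \<notin> T" using that finite_subset[of T "{1..s}"] by auto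
    then show ?thesis by simp
  qed
  have "[(\<Sum>T\<in>Pow (insert (Suc s) {1..s}). (-1) ^ card T * \<kappa> (g (?v T))) = 0] (mod int p)"
    by (rule bounded_degree_alternating_sum[OF \<kappa>(1)]) (use v w in auto)
  also have "(\<Sum>T\<in>Pow (insert (Suc s) {1..s}). (-1) ^ card T * \<kappa> (g (?v T))) =
      (\<Sum>T\<in>Pow {1..s}. (-1) ^ card T * (\<kappa> (g (?v T)) - \<kappa> (g (?v (insert (Suc s) T)))))"
    by (subst sum_Pow_insert) (auto intro!: sum.cong simp: card algebra_simps)
  also have "\<dots> = (\<Sum>T\<in>{{1..s}}. (-1) ^ card T * (\<kappa> (g (?v T)) - \<kappa> (g (?v (insert (Suc s) T)))))"
  proof (rule sum.mono_neutral_right)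
    show "\<forall>T\<in>Pow {1..s} - {{1..s}}.
        (-1) ^ card T * (\<kappa> (g (?v T)) - \<kappa> (g (?v (insert (Suc s) T)))) = 0"
    proof
      fix T assume "T \<in> Pow {1..s} - {{1..s}}"
      then have "T \<subset> {1..s}" by blast
      from eq[OF this] show "(-1) ^ card T * (\<kappa> (g (?v T)) - \<kappa> (g (?v (insert (Suc s) T)))) = 0"
        by (simp only: diff_self mult_zero_right)
    qed
  qed auto
  also have "\<dots> = (-1) ^ s * (\<kappa> (g (?v {1..s})) - \<kappa> (g (?v {1..Suc s})))"
    using ins by simp
  finally have "int p dvd (-1) ^ s * (\<kappa> (g (?v {1..s})) - \<kappa> (g (?v {1..Suc s})))"
    by (simp only: cong_0_iff)
  then have "int p dvd \<kappa> (g (?v {1..s})) - \<kappa> (g (?v {1..Suc s}))"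
    unfolding minus_one_power_iff by (cases "even s") (simp_all only: if_True if_False mult_1 mult_minus1 dvd_minus_iff)
  then show False using \<kappa>(2) by (simp add: cong_iff_dvd_diff)
qed

lemma separated_supernilpotent:
  assumes sep: "separated p s \<alpha>" and \<alpha>: "\<alpha> \<subseteq> equality_rel A"
  shows "supernilpotent \<Sigma> A s"
  unfolding supernilpotent_def
proof (intro allI impI ballI)
  fix ns :: "nat \<Rightarrow> nat" and a :: "nat \<Rightarrow> nat \<Rightarrow> 'a list" and t
  assume a: "\<forall>i\<in>{1..s+1}. \<forall>j\<in>{1, 2}. a i j \<in> tuples U (ns i)"
    and t: "t \<in> term_functions \<Sigma> A (\<Sum>i=1..s+1. ns i)"
    and eq: "\<forall>f\<in>{1..s} \<rightarrow> {1, 2}. \<not> (\<forall>i\<in>{1..s}. f i = 2) \<longrightarrow>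
      t (concat (map (\<lambda>i. a i (f i)) [1..<s+1]) @ a (s+1) 1) =
      t (concat (map (\<lambda>i. a i (f i)) [1..<s+1]) @ a (s+1) 2)"
  obtain e where e: "e \<in> U" using alg by (auto simp: is_algebra_def)
  define N where "N = (\<Sum>i=1..s+1. ns i)"
  define J where "J = [1..<s+2]"
  have J: "set J = {1..s+1}" "J = [1..<s+1] @ [s+1]" by (auto simp: J_def)
  obtain r where r: "wf_trm \<Sigma> r" "trm_vars r \<subseteq> {..<N}"
      "t = restrict (\<lambda>xs. trm_val A (\<lambda>i. xs ! i) r) (tuples U N)"
    using t unfolding term_functions_def N_def by blast
  define g where "g = (\<lambda>v. trm_val A v r)"
  have g: "tmop g" unfolding g_def by (rule tmop_trm[OF r(1)])
  define ex where "ex xs i = (if i < N then xs ! i else e)" for xs i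
  have exV: "ex xs \<in> V" if "xs \<in> tuples U N" for xs
    using that e subsetD[OF _ nth_mem, of xs U] by (auto simp: ex_def tuples_def)
  have tg: "t xs = g (ex xs)" if "xs \<in> tuples U N" for xs
    using that r by (auto simp: g_def ex_def intro!: trm_val_cong)
  have len: "length (a i j) = ns i" "set (a i j) \<subseteq> U" if "i \<in> {1..s+1}" "j \<in> {1, 2}" for i j
    using a that unfolding tuples_def by blast+
  define Lst where "Lst f = concat (map (\<lambda>i. a i (f i)) J)" for f
  define B where "B = concat (map (\<lambda>i. replicate (ns i) i) J)"
  have lenN: "sum_list (map ns J) = N"
  proof -
    have "sum_list (map ns J) = sum ns (set J)" by (rule sum_list_distinct_conv_sum_set) (simp add: J_def)
    then show ?thesis by (simp only: J(1) N_def)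
  qed
  have BN: "length B = N" using lenN by (simp add: B_def length_concat comp_def)
  have LN: "Lst f \<in> tuples U N" if "f \<in> {1..s+1} \<rightarrow> {1, 2}" for f
  proof -
    have f: "f i \<in> {1, 2}" if "i \<in> {1..s+1}" for i using \<open>f \<in> _\<close> that by auto
    have "map (length \<circ> (\<lambda>i. a i (f i))) J = map ns J"
      using len f J(1) by (intro map_cong) auto
    then have "length (Lst f) = N" unfolding Lst_def length_concat map_map lenN[symmetric] by (rule arg_cong)
    moreover have "set (Lst f) \<subseteq> U" using len(2) f J(1) unfolding Lst_def by fastforce
    ultimately show ?thesis by (simp add: tuples_def)
  qed
  define c where "c T i = (if i \<in> T then 2 else 1 :: nat)" for T and i :: nat
  have c: "c T \<in> X \<rightarrow> {1, 2}" for T X by (auto simp: c_def)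
  define v where "v = ex (Lst (c {}))"
  define w where "w = ex (Lst (\<lambda>_. 2))"
  \<comment> \<open>Positions beyond N get block 0, which lies in no T; there both assignments equal
    e.\<close>
  define b where "b i = (if i < N then B ! i else 0)" for i
  have v: "v \<in> V" and w: "w \<in> V" unfolding v_def w_def by (intro exV LN c; simp)+
  have hyb: "(\<lambda>i. if b i \<in> T then w i else v i) = ex (Lst (c T))" if "T \<subseteq> {1..s+1}" for T
  proof
    fix i
    show "(if b i \<in> T then w i else v i) = ex (Lst (c T)) i"
    proof (cases "i < N")
      case True
      have "Lst (c T) ! i = (if c T (B ! i) = 2 then Lst (\<lambda>_. 2) ! i else Lst (\<lambda>_. 1) ! i)"
        unfolding Lst_def B_def
        by (rule concat_map_choice[where ns = ns]) (use len J(1) c True BN in \<open>auto simp: B_def\<close>)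
      moreover have "c {} = (\<lambda>_. 1)" by (auto simp: c_def)
      ultimately show ?thesis using True by (simp add: b_def v_def w_def ex_def c_def)
    qed (use that in \<open>auto simp: b_def v_def w_def ex_def\<close>)
  qed
  have split: "Lst (c T) = concat (map (\<lambda>i. a i (c T i)) [1..<s+1]) @ a (s+1) (c T (s+1))" for T
    by (simp add: Lst_def J(2))
  have cong: "concat (map (\<lambda>i. a i (c (insert (Suc s) T) i)) [1..<s+1]) =
      concat (map (\<lambda>i. a i (c T i)) [1..<s+1])" for T
    by (intro arg_cong[where f = concat] map_cong) (auto simp: c_def)
  have "g (\<lambda>i. if b i \<in> {1..s} then w i else v i) = g (\<lambda>i. if b i \<in> {1..Suc s} then w i else v i)"
  proof (rule separated_last_block[OF sep \<alpha> g v w])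
    fix T assume T: "T \<subset> {1..s}"
    then have T': "T \<subseteq> {1..s+1}" "insert (Suc s) T \<subseteq> {1..s+1}" "Suc s \<notin> T" by auto
    have "\<not> (\<forall>i\<in>{1..s}. c T i = 2)" using T by (auto simp: c_def)
    then have "t (Lst (c T)) = t (Lst (c (insert (Suc s) T)))"
      using eq[rule_format, OF c[of T]] T'(3) unfolding split cong by (simp add: c_def)
    then show "g (\<lambda>i. if b i \<in> T then w i else v i) =
        g (\<lambda>i. if b i \<in> insert (Suc s) T then w i else v i)"
      using tg[OF LN[OF c]] hyb[OF T'(1)] hyb[OF T'(2)] by simp
  qed
  then have "t (Lst (c {1..s})) = t (Lst (c {1..s+1}))"
    using tg[OF LN[OF c]] hyb[of "{1..s}"] hyb[of "{1..s+1}"] by simp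
  moreover have two: "concat (map (\<lambda>i. a i (c T i)) [1..<s+1]) = concat (map (\<lambda>i. a i 2) [1..<s+1])"
    if "{1..s} \<subseteq> T" for T
    by (intro arg_cong[where f = concat] map_cong) (use that in \<open>auto simp: c_def subset_iff\<close>)
  have "Lst (c {1..s}) = concat (map (\<lambda>i. a i 2) [1..<s+1]) @ a (s+1) 1"
    unfolding split two[OF order.refl] by (simp only: c_def) simp
  moreover have "Lst (c {1..s+1}) = concat (map (\<lambda>i. a i 2) [1..<s+1]) @ a (s+1) 2"
  proof -
    have "{1..s} \<subseteq> {1..s+1}" "c {1..s+1} (s+1) = 2" by (auto simp: c_def)
    then show ?thesis unfolding split by (simp only: two)
  qed
  ultimately show "t (concat (map (\<lambda>i. a i 2) [1..<s+1]) @ a (s+1) 1) =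
      t (concat (map (\<lambda>i. a i 2) [1..<s+1]) @ a (s+1) 2)"
    by (simp only:)
qed

end

section \<open>The free spectrum\<close>

text \<open>Newton's forward difference formula: G (Suc k) is the forward difference of G k, and the
  differences beyond s vanish.\<close>

lemma choose_transform:
  fixes G :: "nat \<Rightarrow> nat \<Rightarrow> real"
  assumes rec: "\<And>k n. G k (Suc n) = G k n + G (Suc k) n" and zero: "\<And>k n. k > s \<Longrightarrow> G k n = 0"
  shows "G k n = (\<Sum>j\<le>s. real (n choose j) * G (k + j) 0)"
proof (induction n arbitrary: k)
  case 0
  have "(\<Sum>j\<le>s. real (0 choose j) * G (k + j) 0) = (\<Sum>j\<in>{0}. real (0 choose j) * G (k + j) 0)"
    by (rule sum.mono_neutral_right) (auto simp: binomial_eq_0)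
  then show ?case by simp
next
  case (Suc n)
  let ?a = "\<lambda>j. G (k + j) 0"
  \<comment> \<open>The added term j = Suc s is zero because k + Suc s exceeds s; it allows Pascal's
    rule to be applied after an index shift.\<close>
  have "(\<Sum>j\<le>s. real (Suc n choose j) * ?a j) = (\<Sum>j\<le>Suc s. real (Suc n choose j) * ?a j)"
    using zero by simp
  also have "\<dots> = ?a 0 + (\<Sum>j\<le>s. real (n choose Suc j) * ?a (Suc j)) + (\<Sum>j\<le>s. real (n choose j) * ?a (Suc j))"
    unfolding sum.atMost_Suc_shift by (simp add: algebra_simps sum.distrib)
  also have "?a 0 + (\<Sum>j\<le>s. real (n choose Suc j) * ?a (Suc j)) = (\<Sum>j\<le>Suc s. real (n choose j) * ?a j)"
    unfolding sum.atMost_Suc_shift by simp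
  also have "\<dots> = (\<Sum>j\<le>s. real (n choose j) * ?a j)"
    using zero by simp
  finally show ?case using Suc[of k] Suc[of "Suc k"] rec by simp
qed

lemma binomial_sum_poly:
  obtains P :: "real poly" where "degree P \<le> s"
    and "\<And>n. poly P (real n) = (\<Sum>j\<le>s. real (n choose j) * c j)"
proof -
  define B :: "nat \<Rightarrow> real poly" where "B j = smult (1 / fact j) (\<Prod>i<j. [:- real i, 1:])" for j
  have B: "poly (B j) (real n) = real (n choose j)" for j n
    by (simp add: B_def poly_prod binomial_gbinomial gbinomial_prod_rev atLeast0LessThan)
  have degB: "degree (B j) \<le> j" for j
  proof -
    have "degree (\<Prod>i<j. [:- real i, 1:]) \<le> j"
      using degree_prod_sum_le[of "{..<j}" "\<lambda>i. [:- real i, 1:]"] by (simp add: comp_def)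
    then show ?thesis unfolding B_def by (rule order_trans[OF degree_smult_le])
  qed
  show ?thesis
  proof (rule that[of "\<Sum>j\<le>s. smult (c j) (B j)"])
    show "degree (\<Sum>j\<le>s. smult (c j) (B j)) \<le> s"
    proof (rule degree_sum_le)
      show "degree (smult (c j) (B j)) \<le> s" if "j \<in> {..s}" for j
        using that degB[of j] degree_smult_le[of "c j" "B j"] by simp
    qed simp
    show "poly (\<Sum>j\<le>s. smult (c j) (B j)) (real n) = (\<Sum>j\<le>s. real (n choose j) * c j)" for n
      by (simp add: poly_sum B mult.commute)
  qed
qed

section \<open>Term functions of fixed arity and absorption\<close>

context finite_algebra
begin

text \<open>Later variables are read from position 0. On terms this is a substitution of variable 0,
  so arity n \<ge> 1 is respected without a default element.\<close>

definition asgn :: "nat \<Rightarrow> 'a list \<Rightarrow> nat \<Rightarrow> 'a" where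
  "asgn n xs i = xs ! (if i < n then i else 0)"

definition represented :: "nat \<Rightarrow> ('a list \<Rightarrow> 'a) \<Rightarrow> bool" where
  "represented n F \<longleftrightarrow> (\<exists>g. tmop g \<and> (\<forall>xs\<in>tuples U n. F xs = g (asgn n xs)))"

lemma asgn_V: "n \<ge> 1 \<Longrightarrow> xs \<in> tuples U n \<Longrightarrow> asgn n xs \<in> V"
  using subsetD[OF _ nth_mem, of xs U] by (auto simp: asgn_def tuples_def)

lemma term_functions_represented:
  assumes "f \<in> term_functions \<Sigma> A n"
  shows "represented n f"
proof -
  obtain t where t: "wf_trm \<Sigma> t" "trm_vars t \<subseteq> {..<n}"
      "f = restrict (\<lambda>xs. trm_val A (\<lambda>i. xs ! i) t) (tuples U n)"
    using assms unfolding term_functions_def by blast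
  then have "f xs = trm_val A (asgn n xs) t" if "xs \<in> tuples U n" for xs
    using that by (auto simp: asgn_def intro!: trm_val_cong)
  then show ?thesis unfolding represented_def using tmop_trm[OF t(1)] by blast
qed

lemma represented_term_functions:
  assumes "represented n F" "n \<ge> 1"
  shows "restrict F (tuples U n) \<in> term_functions \<Sigma> A n"
proof -
  obtain g where g: "tmop g" "\<And>xs. xs \<in> tuples U n \<Longrightarrow> F xs = g (asgn n xs)"
    using assms(1) unfolding represented_def by blast
  obtain t where t: "wf_trm \<Sigma> t" "\<And>v. v \<in> V \<Longrightarrow> g v = trm_val A v t"
    using g(1) unfolding termop_def by auto
  define t' where "t' = subst (\<lambda>i. Var (if i < n then i else 0)) t"
  have "trm_vars t' \<subseteq> {..<n}" "wf_trm \<Sigma> t'"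
    unfolding t'_def trm_vars_subst using assms(2) t(1) by (auto intro!: wf_subst)
  moreover have "restrict F (tuples U n) = restrict (\<lambda>xs. trm_val A (\<lambda>i. xs ! i) t') (tuples U n)"
  proof (rule restrict_ext)
    fix xs assume xs: "xs \<in> tuples U n"
    have "(\<lambda>i. xs ! (if i < n then i else 0)) = asgn n xs" by (simp add: asgn_def fun_eq_iff)
    then show "F xs = trm_val A (\<lambda>i. xs ! i) t'"
      using g(2)[OF xs] t(2)[OF asgn_V[OF assms(2) xs]] by (simp add: t'_def trm_val_subst)
  qed
  ultimately show ?thesis unfolding term_functions_def by blast
qed

lemma term_functions_extensional: "f \<in> term_functions \<Sigma> A n \<Longrightarrow> f \<in> extensional (tuples U n)"
  unfolding term_functions_def by auto

lemma represented_closed: "represented n F \<Longrightarrow> n \<ge> 1 \<Longrightarrow> xs \<in> tuples U n \<Longrightarrow> F xs \<in> U"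
  unfolding represented_def using tmop_closed asgn_V by metis

lemma represented_nth: "represented n (\<lambda>xs. xs ! i)" if "i < n"
  unfolding represented_def using that tmop_var[of i] by (intro exI[of _ "\<lambda>v. v i"]) (simp add: asgn_def)

lemma represented_reindex:
  assumes F: "represented m F" and m: "m \<ge> 1" and \<rho>: "\<And>i. i < m \<Longrightarrow> \<rho> i < n"
  shows "represented n (\<lambda>xs. F (map (\<lambda>i. xs ! \<rho> i) [0..<m]))"
proof -
  obtain g where g: "tmop g" "\<And>xs. xs \<in> tuples U m \<Longrightarrow> F xs = g (asgn m xs)"
    using F unfolding represented_def by blast
  define \<sigma> where "\<sigma> i = \<rho> (if i < m then i else 0)" for i
  have "F (map (\<lambda>i. xs ! \<rho> i) [0..<m]) = g (\<lambda>i. asgn n xs (\<sigma> i))" if xs: "xs \<in> tuples U n" for xs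
  proof -
    have "map (\<lambda>i. xs ! \<rho> i) [0..<m] \<in> tuples U m"
      using xs \<rho> subsetD[OF _ nth_mem, of xs U] by (auto simp: tuples_def)
    moreover have "asgn m (map (\<lambda>i. xs ! \<rho> i) [0..<m]) = (\<lambda>i. asgn n xs (\<sigma> i))"
      using m \<rho> by (auto simp: asgn_def \<sigma>_def fun_eq_iff)
    ultimately show ?thesis using g(2) by metis
  qed
  moreover have "tmop (\<lambda>v. g (\<lambda>i. v (\<sigma> i)))" by (rule tmop_comp[OF g(1) tmop_var])
  ultimately show ?thesis unfolding represented_def by blast
qed

lemma represented_comp3:
  assumes D: "tmop (\<lambda>v. D (v 0) (v 1) (v 2))" and "represented n F" "represented n G" "represented n H"
  shows "represented n (\<lambda>xs. D (F xs) (G xs) (H xs))"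
proof -
  obtain f g h where fgh: "tmop f" "tmop g" "tmop h"
    "\<And>xs. xs \<in> tuples U n \<Longrightarrow> F xs = f (asgn n xs)" "\<And>xs. xs \<in> tuples U n \<Longrightarrow> G xs = g (asgn n xs)"
    "\<And>xs. xs \<in> tuples U n \<Longrightarrow> H xs = h (asgn n xs)"
    using assms(2-4) unfolding represented_def by metis
  show ?thesis
    unfolding represented_def
    by (rule exI[of _ "\<lambda>v. D (f v) (g v) (h v)"]) (use fgh tmop3_comp[OF D fgh(1-3)] in simp)
qed

text \<open>
  The term functions in a base variable \<open>0\<close>, absorbing variables \<open>1, \<dots>, k\<close> and \<open>n\<close> free variables:
  the value is that of the base variable as soon as one absorbing variable agrees with it.
\<close>

definition absorbing :: "nat \<Rightarrow> nat \<Rightarrow> ('a list \<Rightarrow> 'a) set" where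
  "absorbing k n = {f \<in> term_functions \<Sigma> A (Suc (k + n)).
     \<forall>xs\<in>tuples U (Suc (k + n)). (\<exists>i\<in>{1..k}. xs ! i = xs ! 0) \<longrightarrow> f xs = xs ! 0}"

lemma finite_absorbing: "finite (absorbing k n)"
proof -
  let ?N = "Suc (k + n)"
  have "tuples U ?N = {xs. set xs \<subseteq> U \<and> length xs = ?N}" by (auto simp: tuples_def)
  then have fT: "finite (tuples U ?N)" using finite_lists_length_eq[OF fin] by simp
  have "f \<in> tuples U ?N \<rightarrow>\<^sub>E U" if "f \<in> absorbing k n" for f
    using that term_functions_represented[of f ?N] represented_closed[of ?N f]
      term_functions_extensional[of f ?N] by (auto simp: absorbing_def PiE_iff)
  then have "absorbing k n \<subseteq> tuples U ?N \<rightarrow>\<^sub>E U" by blast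
  moreover have "finite (tuples U ?N \<rightarrow>\<^sub>E U)" by (rule finite_PiE[OF fT]) (rule fin)
  ultimately show ?thesis by (rule finite_subset)
qed

lemma projection_absorbing:
  "restrict (\<lambda>xs. xs ! 0) (tuples U (Suc (k + n))) \<in> absorbing k n"
  using represented_term_functions[OF represented_nth[of 0 "Suc (k + n)"]] by (simp add: absorbing_def)

lemma absorbing_trivial:
  assumes sep: "separated p s \<alpha>" and \<alpha>: "\<alpha> \<subseteq> equality_rel A" and k: "k > s"
  shows "card (absorbing k n) = 1"
proof -
  let ?N = "Suc (k + n)"
  have "f = restrict (\<lambda>xs. xs ! 0) (tuples U ?N)" if f: "f \<in> absorbing k n" for f
  proof (rule extensionalityI[of _ "tuples U ?N"])
    show "f \<in> extensional (tuples U ?N)"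
      using f term_functions_extensional by (auto simp: absorbing_def)
    fix xs assume xs: "xs \<in> tuples U ?N"
    obtain g where g: "tmop g" "\<And>xs. xs \<in> tuples U ?N \<Longrightarrow> f xs = g (asgn ?N xs)"
      using f term_functions_represented unfolding absorbing_def represented_def by blast
    define w where "w = asgn ?N xs"
    define v where "v i = (if i \<in> {1..Suc s} then xs ! 0 else w i)" for i
    have w: "w \<in> V" unfolding w_def by (rule asgn_V[OF _ xs]) simp
    have w0: "w i = xs ! 0" if "i = 0 \<or> i \<ge> ?N" for i using that by (auto simp: w_def asgn_def)
    have "w 0 \<in> U" using w by simp
    then have v: "v \<in> V" using w w0[of 0] by (simp add: v_def)
    let ?v = "\<lambda>T i. if i \<in> T then w i else v i"
    have base: "g (?v T) = xs ! 0" if T: "T \<subseteq> {1..Suc s}" "\<not> {1..Suc s} \<subseteq> T" for T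
    proof -
      define ys where "ys = map (?v T) [0..<?N]"
      have ys: "ys \<in> tuples U ?N" using v w by (auto simp: ys_def tuples_def)
      have nth: "ys ! i = ?v T i" if "i < ?N" for i
        using that unfolding ys_def by (simp del: upt_Suc)
      have v0: "?v T i = xs ! 0" if "i = 0 \<or> i \<ge> ?N" for i
        using w0[OF that] T(1) by (auto simp: v_def)
      have "asgn ?N ys i = ?v T i" for i
      proof (cases "i < ?N")
        case True
        then show ?thesis using nth[OF True] by (simp only: asgn_def if_True)
      next
        case False
        then have "asgn ?N ys i = ys ! 0" by (simp only: asgn_def if_False)
        moreover have "ys ! 0 = xs ! 0" using nth[of 0] v0[of 0] by simp
        moreover have "?v T i = xs ! 0" by (rule v0) (use False in simp)
        ultimately show ?thesis by (simp only:)
      qed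
      then have "asgn ?N ys = ?v T" by (rule ext)
      then have "g (?v T) = f ys" using g(2)[OF ys] by simp
      moreover obtain i where i: "i \<in> {1..Suc s}" "i \<notin> T" using T(2) by blast
      then have "ys ! i = ys ! 0" using nth[of i] nth[of 0] v0[of 0] k by (simp add: v_def)
      then have "f ys = ys ! 0" using f ys i(1) k unfolding absorbing_def by force
      ultimately show ?thesis using nth[of 0] v0[of 0] by simp
    qed
    have "g (?v {1..s}) = g (?v {1..Suc s})"
    proof (rule separated_last_block[OF sep \<alpha> g(1) v w, where b = "\<lambda>i. i"])
      fix T assume "T \<subset> {1..s}"
      then show "g (?v T) = g (?v (insert (Suc s) T))"
        using base[of T] base[of "insert (Suc s) T"] by fastforce
    qed
    moreover have "g (?v {1..s}) = xs ! 0" by (rule base) auto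
    moreover have "?v {1..Suc s} = w" by (auto simp: v_def)
    ultimately show "f xs = restrict (\<lambda>xs. xs ! 0) (tuples U ?N) xs"
      using g(2)[OF xs] xs by (simp add: w_def)
  qed simp
  then have "absorbing k n = {restrict (\<lambda>xs. xs ! 0) (tuples U ?N)}"
    using projection_absorbing by blast
  then show ?thesis by simp
qed

end

section \<open>Division and the counting recursion\<close>

context nilpotent_malcev
begin

text \<open>The maps \<open>d x e\<close> permute the universe with a common period
  \<open>Suc N\<close>, so their N-fold iterate is the inverse and still a term operation.\<close>

lemma left_division:
  obtains ld where "tmop (\<lambda>v. ld (v 0) (v 1) (v 2))"
    and "\<And>x e z. x \<in> U \<Longrightarrow> e \<in> U \<Longrightarrow> z \<in> U \<Longrightarrow> d x e (ld x e z) = z"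
    and "\<And>x e y. x \<in> U \<Longrightarrow> e \<in> U \<Longrightarrow> y \<in> U \<Longrightarrow> ld x e (d x e y) = y"
proof -
  obtain N where N: "\<And>b y. b \<in> U \<times> U \<Longrightarrow> y \<in> U \<Longrightarrow> ((\<lambda>y. d (fst b) (snd b) y) ^^ Suc N) y = y"
  proof (rule injective_family_period[of "U \<times> U" U "\<lambda>b y. d (fst b) (snd b) y"])
    show "inj_on (d (fst b) (snd b)) U" if "b \<in> U \<times> U" for b
      using that by (auto intro: inj_d_right)
  qed (use fin d_closed in auto)
  define ld where "ld x e z = (d x e ^^ N) z" for x e z
  have period: "(d x e ^^ Suc N) y = y" if "x \<in> U" "e \<in> U" "y \<in> U" for x e y
    using N[of "(x, e)" y] that by simp
  have "tmop (\<lambda>v. (d (v 0) (v 1) ^^ n) (v 2))" for n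
  proof (induction n)
    case (Suc n)
    from tm_d[OF tmop_var tmop_var Suc, of 0 1] show ?case by simp
  qed (simp add: tmop_var)
  then have "tmop (\<lambda>v. ld (v 0) (v 1) (v 2))" by (simp add: ld_def)
  moreover have "d x e (ld x e z) = z" if "x \<in> U" "e \<in> U" "z \<in> U" for x e z
    using period[OF that] by (simp add: ld_def)
  moreover have "ld x e (d x e y) = y" if "x \<in> U" "e \<in> U" "y \<in> U" for x e y
    using period[OF that] by (simp add: ld_def funpow_Suc_right del: funpow.simps)
  ultimately show ?thesis using that by blast
qed

text \<open>
  Setting the first free variable to the base variable and dividing splits a function into one that
  does not depend on this variable and one that absorbs it.
\<close>

lemma card_absorbing_Suc: "card (absorbing k (Suc n)) = card (absorbing k n) * card (absorbing (Suc k) n)"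
proof -
  obtain ld where ld: "tmop (\<lambda>v. ld (v 0) (v 1) (v 2))"
    and ld1: "\<And>x e z. x \<in> U \<Longrightarrow> e \<in> U \<Longrightarrow> z \<in> U \<Longrightarrow> d x e (ld x e z) = z"
    and ld2: "\<And>x e y. x \<in> U \<Longrightarrow> e \<in> U \<Longrightarrow> y \<in> U \<Longrightarrow> ld x e (d x e y) = y"
    by (fact left_division)
  \<comment> \<open>Dividing a value by itself returns the base; this makes the quotient absorb the
    new variable.\<close>
  have ld3: "ld x e x = e" if "x \<in> U" "e \<in> U" for x e
    using ld2[OF that that(2)] d_right[OF that] by simp
  let ?N = "Suc (k + n)" and ?M = "Suc (Suc (k + n))"
  \<comment> \<open>\<open>ins\<close> copies the base variable into place \<open>Suc k\<close>,
    that of the first free variable, and \<open>del\<close> drops this place.\<close>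
  define ins where "ins xs = map (\<lambda>i. xs ! (if i \<le> k then i else if i = Suc k then 0 else i - 1)) [0..<?M]"
    for xs :: "'a list"
  define del where "del xs = map (\<lambda>i. xs ! (if i \<le> k then i else Suc i)) [0..<?N]" for xs :: "'a list"
  have ins_nth: "ins xs ! i = xs ! (if i \<le> k then i else if i = Suc k then 0 else i - 1)" if "i < ?M" for xs i
    using that unfolding ins_def by (simp del: upt_Suc)
  have del_nth: "del xs ! i = xs ! (if i \<le> k then i else Suc i)" if "i < ?N" for xs i
    using that unfolding del_def by (simp del: upt_Suc)
  have tupI: "xs \<in> tuples U m" if "length xs = m" "\<And>i. i < m \<Longrightarrow> xs ! i \<in> U" for xs m
    using that by (auto simp: tuples_def in_set_conv_nth)
  have tupD: "length xs = m" "\<And>i. i < m \<Longrightarrow> xs ! i \<in> U" if "xs \<in> tuples U m" for xs m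
    using that nth_mem by (auto simp: tuples_def)
  have ins: "ins xs \<in> tuples U ?M" if "xs \<in> tuples U ?N" for xs
    by (rule tupI) (use tupD[OF that] ins_nth in \<open>auto simp: ins_def simp del: upt_Suc\<close>)
  have del: "del xs \<in> tuples U ?N" if "xs \<in> tuples U ?M" for xs
    by (rule tupI) (use tupD[OF that] del_nth in \<open>auto simp: del_def simp del: upt_Suc\<close>)
  have delins: "del (ins xs) = xs" if "xs \<in> tuples U ?N" for xs
    by (rule nth_equalityI) (use tupD[OF that] del_nth ins_nth in \<open>auto simp: del_def simp del: upt_Suc\<close>)
  have insdel: "ins (del xs) = xs" if "xs \<in> tuples U ?M" "xs ! Suc k = xs ! 0" for xs
  proof (rule nth_equalityI)
    show "length (ins (del xs)) = length xs" using tupD(1)[OF that(1)] by (simp add: ins_def)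
    fix i assume "i < length (ins (del xs))"
    then have i: "i < ?M" by (simp add: ins_def)
    show "ins (del xs) ! i = xs ! i"
      unfolding ins_nth[OF i] using del_nth i that(2) by (cases "i \<le> k"; cases "i = Suc k") auto
  qed
  have del0: "del xs ! 0 = xs ! 0" and ins0: "ins xs ! 0 = xs ! 0" for xs using del_nth ins_nth by auto
  have insk: "ins xs ! Suc k = xs ! 0" for xs using ins_nth by auto
  have rins: "represented ?N (\<lambda>xs. F (ins xs))" if "represented ?M F" for F
    unfolding ins_def by (rule represented_reindex[OF that]) auto
  have rdel: "represented ?M (\<lambda>xs. F (del xs))" if "represented ?N F" for F
    unfolding del_def by (rule represented_reindex[OF that]) auto
  have r0: "represented ?M (\<lambda>xs. xs ! 0)" by (rule represented_nth) simp
  have absD: "represented (Suc (k' + n')) f" "f \<in> extensional (tuples U (Suc (k' + n')))"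
    "\<And>xs i. xs \<in> tuples U (Suc (k' + n')) \<Longrightarrow> i \<in> {1..k'} \<Longrightarrow> xs ! i = xs ! 0 \<Longrightarrow> f xs = xs ! 0"
    "\<And>xs. xs \<in> tuples U (Suc (k' + n')) \<Longrightarrow> f xs \<in> U"
    if "f \<in> absorbing k' n'" for k' n' f
    using that term_functions_represented[of f] term_functions_extensional[of f]
      represented_closed[of "Suc (k' + n')" f] unfolding absorbing_def by auto
  have absI: "restrict F (tuples U (Suc (k' + n'))) \<in> absorbing k' n'"
    if "represented (Suc (k' + n')) F"
      "\<And>xs i. xs \<in> tuples U (Suc (k' + n')) \<Longrightarrow> i \<in> {1..k'} \<Longrightarrow> xs ! i = xs ! 0 \<Longrightarrow> F xs = xs ! 0"
    for k' n' F
    using represented_term_functions[OF that(1)] that(2) unfolding absorbing_def by auto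
  have sz: "Suc (k + Suc n) = ?M" "Suc (Suc k + n) = ?M" by auto
  define \<Phi> where "\<Phi> f = (restrict (\<lambda>xs. f (ins xs)) (tuples U ?N),
      restrict (\<lambda>xs. ld (f (ins (del xs))) (xs ! 0) (f xs)) (tuples U ?M))" for f
  define \<Psi> where "\<Psi> = (\<lambda>(f, h). restrict (\<lambda>xs. d (f (del xs)) (xs ! 0) (h xs)) (tuples U ?M))"
  have \<Phi>: "\<Phi> f \<in> absorbing k n \<times> absorbing (Suc k) n" if f: "f \<in> absorbing k (Suc n)" for f
  proof -
    note fD = absD[OF f, unfolded sz]
    have "restrict (\<lambda>xs. f (ins xs)) (tuples U ?N) \<in> absorbing k n"
    proof (rule absI[OF rins[OF fD(1)]])
      fix xs i assume xs: "xs \<in> tuples U ?N" and i: "i \<in> {1..k}" "xs ! i = xs ! 0"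
      have "ins xs ! i = ins xs ! 0" using ins_nth[of i] ins0 i by simp
      then show "f (ins xs) = xs ! 0" using fD(3)[OF ins[OF xs] i(1)] ins0 by simp
    qed
    moreover have "restrict (\<lambda>xs. ld (f (ins (del xs))) (xs ! 0) (f xs)) (tuples U ?M) \<in> absorbing (Suc k) n"
    proof (rule absI[where k' = "Suc k" and n' = n, unfolded sz])
      show "represented ?M (\<lambda>xs. ld (f (ins (del xs))) (xs ! 0) (f xs))"
        by (rule represented_comp3[OF ld rdel[OF rins[OF fD(1)]] r0 fD(1)])
      fix xs i assume xs: "xs \<in> tuples U ?M" and i: "i \<in> {1..Suc k}" "xs ! i = xs ! 0"
      have x0: "xs ! 0 \<in> U" using tupD(2)[OF xs] by simp
      show "ld (f (ins (del xs))) (xs ! 0) (f xs) = xs ! 0"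
      proof (cases "i = Suc k")
        case True
        then show ?thesis using insdel[OF xs] i(2) ld3[OF fD(4)[OF xs] x0] by simp
      next
        case False
        then have i': "i \<in> {1..k}" using i(1) by auto
        have "ins (del xs) ! i = xs ! i" using ins_nth[of i] del_nth[of i] i' by simp
        then have "f (ins (del xs)) = xs ! 0"
          using fD(3)[OF ins[OF del[OF xs]] i'] ins0 del0 i(2) by simp
        then show ?thesis using fD(3)[OF xs i' i(2)] ld3[OF x0 x0] by simp
      qed
    qed
    ultimately show ?thesis by (simp add: \<Phi>_def)
  qed
  have \<Psi>: "\<Psi> (f, h) \<in> absorbing k (Suc n)" if f: "f \<in> absorbing k n" and h: "h \<in> absorbing (Suc k) n" for f h
  proof -
    note fD = absD[OF f] and hD = absD[OF h, unfolded sz]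
    show ?thesis
      unfolding \<Psi>_def prod.case
    proof (rule absI[where k' = k and n' = "Suc n", unfolded sz])
      show "represented ?M (\<lambda>xs. d (f (del xs)) (xs ! 0) (h xs))"
        by (rule represented_comp3[OF tmop_d rdel[OF fD(1)] r0 hD(1)])
      fix xs i assume xs: "xs \<in> tuples U ?M" and i: "i \<in> {1..k}" "xs ! i = xs ! 0"
      have x0: "xs ! 0 \<in> U" using tupD(2)[OF xs] by simp
      have "del xs ! i = del xs ! 0" using del_nth[of i] del0 i by simp
      then have "f (del xs) = xs ! 0" using fD(3)[OF del[OF xs] i(1)] del0 by simp
      moreover have "h xs = xs ! 0" using hD(3)[OF xs _ i(2)] i(1) by simp
      ultimately show "d (f (del xs)) (xs ! 0) (h xs) = xs ! 0" using d_left[OF x0 x0] by simp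
    qed
  qed
  have "bij_betw \<Phi> (absorbing k (Suc n)) (absorbing k n \<times> absorbing (Suc k) n)"
  proof (rule bij_betw_byWitness[where f' = \<Psi>])
    show "\<Phi> ` absorbing k (Suc n) \<subseteq> absorbing k n \<times> absorbing (Suc k) n" using \<Phi> by blast
    show "\<Psi> ` (absorbing k n \<times> absorbing (Suc k) n) \<subseteq> absorbing k (Suc n)" using \<Psi> by blast
    show "\<forall>f\<in>absorbing k (Suc n). \<Psi> (\<Phi> f) = f"
    proof
      fix f assume f: "f \<in> absorbing k (Suc n)"
      note fD = absD[OF f, unfolded sz]
      show "\<Psi> (\<Phi> f) = f"
      proof (rule extensionalityI[OF _ fD(2)])
        show "\<Psi> (\<Phi> f) \<in> extensional (tuples U ?M)" by (simp add: \<Psi>_def \<Phi>_def)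
        fix xs assume xs: "xs \<in> tuples U ?M"
        then show "\<Psi> (\<Phi> f) xs = f xs"
          using del[OF xs] ld1[OF fD(4)[OF ins[OF del[OF xs]]] tupD(2)[OF xs] fD(4)[OF xs]]
          by (simp add: \<Psi>_def \<Phi>_def)
      qed
    qed
    show "\<forall>fh\<in>absorbing k n \<times> absorbing (Suc k) n. \<Phi> (\<Psi> fh) = fh"
    proof (intro ballI, elim SigmaE)
      fix fh f h assume f: "f \<in> absorbing k n" and h: "h \<in> absorbing (Suc k) n" and fh: "fh = (f, h)"
      note fD = absD[OF f] and hD = absD[OF h, unfolded sz]
      have \<Psi>ins: "\<Psi> (f, h) (ins xs) = f xs" if xs: "xs \<in> tuples U ?N" for xs
      proof -
        have "h (ins xs) = xs ! 0" using hD(3)[OF ins[OF xs], of "Suc k"] insk ins0 by simp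
        then show ?thesis
          using ins[OF xs] delins[OF xs] ins0 d_right[OF fD(4)[OF xs] tupD(2)[OF xs]]
          by (simp add: \<Psi>_def)
      qed
      have "restrict (\<lambda>xs. \<Psi> (f, h) (ins xs)) (tuples U ?N) = f"
        by (rule extensionalityI[OF _ fD(2)]) (use \<Psi>ins in auto)
      moreover have "restrict (\<lambda>xs. ld (\<Psi> (f, h) (ins (del xs))) (xs ! 0) (\<Psi> (f, h) xs)) (tuples U ?M) = h"
      proof (rule extensionalityI[OF _ hD(2)])
        fix xs assume xs: "xs \<in> tuples U ?M"
        have "ld (f (del xs)) (xs ! 0) (d (f (del xs)) (xs ! 0) (h xs)) = h xs"
          by (rule ld2) (use fD(4)[OF del[OF xs]] tupD(2)[OF xs] hD(4)[OF xs] in auto)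
        then show "restrict (\<lambda>xs. ld (\<Psi> (f, h) (ins (del xs))) (xs ! 0) (\<Psi> (f, h) xs)) (tuples U ?M) xs = h xs"
          using xs \<Psi>ins[OF del[OF xs]] by (simp add: \<Psi>_def)
      qed simp
      ultimately show "\<Phi> (\<Psi> fh) = fh" by (simp add: \<Phi>_def fh)
    qed
  qed
  then show ?thesis by (simp add: bij_betw_same_card card_cartesian_product)
qed

text \<open>The logarithm turns the product recursion for absorbing functions into Pascal's
  recursion, whose solution is a combination of binomial coefficients of order at most s.\<close>

lemma free_spectrum_poly:
  assumes sep: "separated p s \<alpha>" and \<alpha>: "\<alpha> \<subseteq> equality_rel A"
  shows "\<exists>P :: real poly. degree P \<le> s \<and>
    (\<forall>n\<ge>1. real (free_spectrum \<Sigma> A n) = 2 powr poly P (real n))"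
proof -
  define G where "G k n = log 2 (real (card (absorbing k n)))" for k n
  have pos: "card (absorbing k n) > 0" for k n
    using projection_absorbing finite_absorbing card_gt_0_iff by blast
  have G: "G 0 n = (\<Sum>j\<le>s. real (n choose j) * G (0 + j) 0)" for n
  proof (rule choose_transform)
    show "G k (Suc n) = G k n + G (Suc k) n" for k n
      using pos by (simp add: G_def card_absorbing_Suc log_mult)
    show "G k n = 0" if "k > s" for k n
      using absorbing_trivial[OF sep \<alpha> that] by (simp add: G_def)
  qed
  obtain B :: "real poly" where B: "degree B \<le> s"
    "\<And>n. poly B (real n) = (\<Sum>j\<le>s. real (n choose j) * G j 0)"
    using binomial_sum_poly[of s "\<lambda>j. G j 0"] by metis
  show ?thesis
  proof (intro exI conjI allI impI)
    \<comment> \<open>One of the n variables is the base, so B is evaluated at n - 1.\<close>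
    show "degree (pcompose B [:-1, 1:]) \<le> s" using B(1) by (simp add: degree_pcompose)
    fix n :: nat assume n: "n \<ge> 1"
    have "poly (pcompose B [:-1, 1:]) (real n) = poly B (real (n - 1))"
      using n by (simp add: poly_pcompose of_nat_diff)
    also have "\<dots> = G 0 (n - 1)" using B(2) G by simp
    also have "\<dots> = log 2 (real (free_spectrum \<Sigma> A n))"
      using n by (simp add: G_def absorbing_def free_spectrum_def)
    finally have "poly (pcompose B [:-1, 1:]) (real n) = log 2 (real (free_spectrum \<Sigma> A n))" .
    moreover have "free_spectrum \<Sigma> A n > 0"
      using pos[of 0 "n - 1"] n by (simp add: absorbing_def free_spectrum_def)
    ultimately show "real (free_spectrum \<Sigma> A n) = 2 powr poly (pcompose B [:-1, 1:]) (real n)"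
      by simp
  qed
qed

end

theorem theorem1p2:
  fixes \<Sigma> :: "'f signature"
    and E :: "((nat, 'f) trm \<times> (nat, 'f) trm) set"
    and A :: "('f, 'a) algebra"
    and q m h s :: nat
  assumes "q > 1" and "primepow q"
    and "m \<ge> 1"
    and "congruence_modular_variety \<Sigma> E"
    and "in_variety \<Sigma> E A"
    and "nilpotent \<Sigma> A"
    and "card (universe A) = q"
    and "\<forall>f n. \<Sigma> f = Some n \<longrightarrow> n \<le> m"
    and "h = con_height \<Sigma> A"
    and "s = (m * (q - 1)) ^ (h - 1)"
  shows "supernilpotent \<Sigma> A s \<and>
    (\<exists>p :: real poly. degree p \<le> s \<and>
       (\<forall>n\<ge>1. real (free_spectrum \<Sigma> A n) = 2 powr poly p (real n)))"
proof -
  interpret finite_algebra \<Sigma> A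
    using assms(1,5,7) by unfold_locales (auto simp: in_variety_def intro: card_ge_0_finite)
  obtain d where "tmop (\<lambda>v. d (v 0) (v 1) (v 2))"
    "\<And>x y. x \<in> U \<Longrightarrow> y \<in> U \<Longrightarrow> d x x y = y" "\<And>x y. x \<in> U \<Longrightarrow> y \<in> U \<Longrightarrow> d x y y = x"
    by (fact malcev_term[OF assms(4-6)])
  then interpret nilpotent_malcev \<Sigma> A d
    using assms(6) by unfold_locales auto
  obtain p r where pr: "prime p" "q = p ^ r" using assms(2) by (auto simp: primepow_def)
  obtain \<alpha> where sep: "separated p s \<alpha>" "\<alpha> \<subseteq> equality_rel A"
    using separated_equality[OF pr(1), of r m] pr(2) assms(1,3,7-10) by auto
  show ?thesis
    using separated_supernilpotent[OF sep] free_spectrum_poly[OF sep] by blast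
qed

end
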